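(* Let $X$ be a spectrally negative Lévy process (whose paths are not decreasing) with Gaussian coefficient $\sigma\ge 0$ and Lévy measure $\nu$ on $(0,\infty)$, and assume that if the paths of $X$ are of bounded variation then $\nu$ is absolutely continuous with respect to Lebesgue measure. Let $\omega$ be a discounting intensity with associated points $a=a_1<\dots<a_n\le a_{n+1}=0$ and associated constant $\phi>0$, and let $\mathcal{H}^{\omega}$ be the corresponding $\omega$-scale function. Let $W_p$ denote the $p$-scale function of $X$, for some $p\ge 0$. Then: (1) If $\sigma^2>0$, then $\mathcal{H}^{\omega}$ is continuously differentiable on $\mathbb{R}$. (2) If $\sigma^2=0$ and $X$ has paths of unbounded variation, and if in addition $W_p'$ is convex on $(0,\infty)$, then $\mathcal{H}^{\omega}$ is continuously differentiable on $\mathbb{R}$. (3) If $\sigma^2=0$ and $X$ has paths of bounded variation with $\nu(0,\infty)=\infty$, and if in addition $W_p'$ is convex on $(0,\infty)$, then $\mathcal{H}^{\omega}$ is continuously differentiable on $\mathbb{R}\setminus\{a_1,\dots,a_{n+1}\}$. (4) If $\sigma^2=0$ and $\nu(0,\infty)<\infty$, then $\mathcal{H}^{\omega}$ is continuously differentiable on $\mathbb{R}\setminus\{a_1,\dots,a_{n+1}\}$. Furthermore, if $\sigma>0$ and if $W_p'$ is convex on $(0,\infty)$, then $\mathcal{H}^{\omega}$ is twice continuously differentiable on $\mathbb{R}\setminus\{a_1,\dots,a_{n+1}\}$.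
   Context: Spectrally negative Lévy process: $X$ has Laplace exponent $$\psi(\theta)=\gamma\theta+\tfrac12\sigma^2\theta^2+\int_0^\infty\left(e^{-\theta z}-1+\theta z\mathbf 1_{(0,1]}(z)\right)\nu(dz),\quad \theta\ge0,$$ with $\gamma\in\mathbb{R}$, $\sigma\ge0$ and $\nu$ a $\sigma$-finite measure on $(0,\infty)$ satisfying $\int_0^\infty(1\wedge x^2)\nu(dx)<\infty$. The case where $X$ has decreasing paths is excluded. Scale functions: for $p\ge0$, $\Phi(p)=\sup\{\lambda\ge0:\psi(\lambda)=p\}$, and $W_p$ is the scale function vanishing on $(-\infty,0)$, continuous on $(0,\infty)$, with $\int_0^\infty e^{-\theta x}W_p(x)\,dx=(\psi(\theta)-p)^{-1}$ for all $\theta>\Phi(p)$. Under the standing assumption on $\nu$, $W_p$ is continuously differentiable on $(0,\infty)$. Discounting intensity: a function $\omega:\mathbb{R}\to[0,\infty)$ such that (i) $\omega$ is non-increasing; (ii) there exist $a\in(-\infty,0]$ and $\phi>0$ with $\omega(x)=\phi$ for all $x\in(-\infty,a)$, and there exists $\rho\in[0,\omega(0-)]$ with $\omega(x)=\rho$ for all $x\in[0,\infty)$; (iii) there is a finite partition $\{a_1,\dots,a_{n+1}\}$ of $[a,0]$, with $a=a_1<\dots<a_n\le a_{n+1}=0$, such that $\omega$ is absolutely continuous on each sub-interval $(a_k,a_{k+1})$, $k\in\{1,\dots,n\}$. $\omega$-scale function: $\mathcal{H}^{\omega}:\mathbb{R}\to\mathbb{R}$ is the (nonnegative, locally bounded)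 solution of $$\mathcal{H}^{\omega}(x)=e^{\Phi(\phi)(x-a)}+\int_a^xW_\phi(x-y)(\omega(y)-\phi)\mathcal{H}^{\omega}(y)\,dy,\quad x\in\mathbb{R},$$ where $\int_a^x=0$ if $a\ge x$. *)

theory Defs
  imports "HOL-Probability.Probability"
begin

section \<open>Regularity of real functions\<close>

definition cadlag :: "(real \<Rightarrow> real) \<Rightarrow> bool" where
  "cadlag f \<longleftrightarrow> (\<forall>t\<ge>0. (f \<longlongrightarrow> f t) (at_right t)) \<and> (\<forall>t>0. \<exists>l. (f \<longlongrightarrow> l) (at_left t))"

definition bounded_variation_on_Icc :: "(real \<Rightarrow> real) \<Rightarrow> real \<Rightarrow> real \<Rightarrow> bool" where
  "bounded_variation_on_Icc f a b \<longleftrightarrow>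
     (\<exists>B. \<forall>(n::nat) s. a \<le> s 0 \<and> (\<forall>i<n. s i \<le> s (Suc i)) \<and> s n \<le> b \<longrightarrow>
        (\<Sum>i<n. \<bar>f (s (Suc i)) - f (s i)\<bar>) \<le> B)"

text \<open>
  The \<open>\<epsilon>\<close>-\<open>\<delta>\<close> definition, for an interval \<open>I\<close> (which may be open). Not to be confused with
  absolute continuity of measures, \<^const>\<open>absolutely_continuous\<close>.
\<close>
definition abs_continuous_fun_on :: "real set \<Rightarrow> (real \<Rightarrow> real) \<Rightarrow> bool" where
  "abs_continuous_fun_on I f \<longleftrightarrow>
     (\<forall>\<epsilon>>0. \<exists>\<delta>>0. \<forall>(n::nat) u v.
        (\<forall>i<n. u i \<in> I \<and> v i \<in> I \<and> u i \<le> v i) \<and>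
        (\<forall>i<n. \<forall>j<n. i \<noteq> j \<longrightarrow> {u i<..<v i} \<inter> {u j<..<v j} = {}) \<and>
        (\<Sum>i<n. v i - u i) < \<delta> \<longrightarrow>
        (\<Sum>i<n. \<bar>f (v i) - f (u i)\<bar>) < \<epsilon>)"

definition C2_differentiable_on :: "(real \<Rightarrow> real) \<Rightarrow> real set \<Rightarrow> bool"
    (infix "C2'_differentiable'_on" 50) where
  "f C2_differentiable_on S \<longleftrightarrow>
     (\<exists>f'. (\<forall>x\<in>S. (f has_real_derivative f' x) (at x)) \<and> f' C1_differentiable_on S)"

text \<open>Differentiability is required explicitly, since \<^const>\<open>deriv\<close> is a total function.\<close>
definition has_convex_derivative_on :: "(real \<Rightarrow> real) \<Rightarrow> real set \<Rightarrow> bool" where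
  "has_convex_derivative_on f S \<longleftrightarrow>
     (\<forall>x\<in>S. f differentiable (at x)) \<and> convex_on S (deriv f)"

section \<open>Spectrally negative Levy processes\<close>

text \<open>Only the values \<open>X t\<close> with \<open>t \<ge> 0\<close> matter.\<close>
locale levy_process = prob_space M for M :: "'a measure" +
  fixes X :: "real \<Rightarrow> 'a \<Rightarrow> real"
  assumes measurable_X: "t \<ge> 0 \<Longrightarrow> X t \<in> borel_measurable M"
    and start_X: "AE w in M. X 0 w = 0"
    and cadlag_X: "AE w in M. cadlag (\<lambda>t. X t w)"
    and indep_increments: "0 \<le> \<tau> 0 \<Longrightarrow> (\<And>i. i < n \<Longrightarrow> \<tau> i \<le> \<tau> (Suc i)) \<Longrightarrow>
       indep_vars (\<lambda>_. borel) (\<lambda>i w. X (\<tau> (Suc i)) w - X (\<tau> i) w) {..<n::nat}"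
    and stationary_increments: "0 \<le> s \<Longrightarrow> s \<le> u \<Longrightarrow>
       distr M borel (\<lambda>w. X u w - X s w) = distr M borel (X (u - s))"

definition levy_measure_on_pos :: "real measure \<Rightarrow> bool" where
  "levy_measure_on_pos \<nu> \<longleftrightarrow>
     sigma_finite_measure \<nu> \<and> sets \<nu> = sets borel \<and> emeasure \<nu> {..0} = 0 \<and>
     (\<integral>\<^sup>+ x. ennreal (min 1 (x\<^sup>2)) \<partial>\<nu>) < \<infinity>"

definition laplace_exponent :: "real \<Rightarrow> real \<Rightarrow> real measure \<Rightarrow> real \<Rightarrow> real" where
  "laplace_exponent \<gamma> \<sigma> \<nu> \<theta> =
     \<gamma> * \<theta> + \<sigma>\<^sup>2 * \<theta>\<^sup>2 / 2 +
     (LINT z:{0<..}|\<nu>. exp (- \<theta> * z) - 1 + \<theta> * z * indicator {0<..1} z)"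

text \<open>
  The measure \<open>\<nu>\<close> on \<open>(0,\<infinity>)\<close> is the image of the jump measure under \<open>z \<mapsto> -z\<close>.
  ``Decreasing'' paths are meant in the weak sense, so that negatives of subordinators
  (including the zero process) are excluded.
\<close>
locale spectrally_negative_levy_process = levy_process M X
  for M :: "'a measure" and X :: "real \<Rightarrow> 'a \<Rightarrow> real" +
  fixes \<gamma> \<sigma> :: real and \<nu> :: "real measure"
  assumes no_positive_jumps:
      "AE w in M. \<forall>t>0. \<forall>l. ((\<lambda>s. X s w) \<longlongrightarrow> l) (at_left t) \<longrightarrow> X t w \<le> l"
    and not_decreasing: "\<not> (AE w in M. antimono_on {0..} (\<lambda>t. X t w))"
    and sigma_nonneg: "\<sigma> \<ge> 0"
    and levy_measure: "levy_measure_on_pos \<nu>"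
    and integrable_exp: "t \<ge> 0 \<Longrightarrow> \<theta> \<ge> 0 \<Longrightarrow> integrable M (\<lambda>w. exp (\<theta> * X t w))"
    and expectation_exp: "t \<ge> 0 \<Longrightarrow> \<theta> \<ge> 0 \<Longrightarrow>
       (LINT w|M. exp (\<theta> * X t w)) = exp (t * laplace_exponent \<gamma> \<sigma> \<nu> \<theta>)"

definition bounded_variation_paths :: "'a measure \<Rightarrow> (real \<Rightarrow> 'a \<Rightarrow> real) \<Rightarrow> bool" where
  "bounded_variation_paths M X \<longleftrightarrow>
     (AE w in M. \<forall>T\<ge>0. bounded_variation_on_Icc (\<lambda>t. X t w) 0 T)"

section \<open>Scale functions\<close>

definition right_inverse_exponent :: "(real \<Rightarrow> real) \<Rightarrow> real \<Rightarrow> real" where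
  "right_inverse_exponent \<psi> p = Sup {l. 0 \<le> l \<and> \<psi> l = p}"

text \<open>\<open>W\<close> is the \<open>p\<close>-scale function; its value at \<open>0\<close> is irrelevant and left open.\<close>
definition is_scale_function :: "(real \<Rightarrow> real) \<Rightarrow> real \<Rightarrow> (real \<Rightarrow> real) \<Rightarrow> bool" where
  "is_scale_function \<psi> p W \<longleftrightarrow>
     (\<forall>x<0. W x = 0) \<and> continuous_on {0<..} W \<and>
     (\<forall>\<theta> > right_inverse_exponent \<psi> p.
        set_integrable lborel {0<..} (\<lambda>x. exp (- \<theta> * x) * W x) \<and>
        (LBINT x:{0<..}. exp (- \<theta> * x) * W x) = 1 / (\<psi> \<theta> - p))"

section \<open>Discounting intensities and omega-scale functions\<close>

text \<open>
  The points \<open>a 1 < \<dots> < a n \<le> a (n + 1) = 0\<close> partition \<open>[a 1, 0]\<close>; other values of the sequence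
  \<open>a\<close> are irrelevant. The constant \<open>\<rho>\<close> is \<open>\<omega> 0\<close>.
\<close>
definition discounting_intensity ::
    "(real \<Rightarrow> real) \<Rightarrow> real \<Rightarrow> nat \<Rightarrow> (nat \<Rightarrow> real) \<Rightarrow> bool" where
  "discounting_intensity \<omega> \<phi> n a \<longleftrightarrow>
     (\<forall>x. 0 \<le> \<omega> x) \<and> antimono \<omega> \<and>
     1 \<le> n \<and> \<phi> > 0 \<and> (\<forall>x < a 1. \<omega> x = \<phi>) \<and>
     (\<exists>\<rho>. 0 \<le> \<rho> \<and> \<rho> \<le> Lim (at_left 0) \<omega> \<and> (\<forall>x\<ge>0. \<omega> x = \<rho>)) \<and>
     (\<forall>k\<in>{1..<n}. a k < a (k + 1)) \<and> a n \<le> a (n + 1) \<and> a (n + 1) = 0 \<and>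
     (\<forall>k\<in>{1..n}. abs_continuous_fun_on {a k<..<a (k + 1)} \<omega>)"

text \<open>
  Here \<open>a\<close> is the leftmost partition point and \<open>W\<close> the \<open>\<phi>\<close>-scale function. For \<open>x < a\<close> the
  set \<open>{a..x}\<close> is empty, so the integral vanishes.
\<close>
definition is_omega_scale_function ::
    "(real \<Rightarrow> real) \<Rightarrow> (real \<Rightarrow> real) \<Rightarrow> (real \<Rightarrow> real) \<Rightarrow> real \<Rightarrow> real \<Rightarrow> (real \<Rightarrow> real) \<Rightarrow> bool" where
  "is_omega_scale_function \<psi> W \<omega> \<phi> a H \<longleftrightarrow>
     (\<forall>x. 0 \<le> H x) \<and> (\<forall>K. compact K \<longrightarrow> bounded (H ` K)) \<and>
     (\<forall>x. set_integrable lborel {a..x} (\<lambda>y. W (x - y) * (\<omega> y - \<phi>) * H y) \<and>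
          H x = exp (right_inverse_exponent \<psi> \<phi> * (x - a)) +
                (LBINT y:{a..x}. W (x - y) * (\<omega> y - \<phi>) * H y))"

end

theory Submission
  imports Defs
begin

text \<open>
  Away from the jumps of \<open>\<omega>\<close>, the smoothness of \<open>H\<close> is that of a convolution \<open>W * g\<close> with a locally
  bounded \<open>g\<close>. If \<open>W = c + \<integral>v\<close> with \<open>v\<close> locally integrable, then \<open>(W * g)' = c g + v * g\<close>, and \<open>v * g\<close>
  is continuous, since convolving a locally integrable function with a bounded one gives a continuous
  one. So \<open>H\<close> is \<open>C\<^sup>1\<close> where \<open>c = 0\<close> or \<open>\<omega>\<close> is continuous, and absolute continuity of \<open>W\<close> (for the
  second derivative: of \<open>W'\<close>) suffices.

  If \<open>\<sigma> > 0\<close>, or if \<open>\<sigma> = 0\<close> and \<open>\<integral>\<^sub>0\<^sup>1 z \<nu>(dz) < \<infinity>\<close>, then \<open>\<psi>(\<theta>) - q\<close> is \<open>\<sigma>\<^sup>2 \<theta>\<^sup>2 / 2\<close>, respectively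
  \<open>c \<theta>\<close> with \<open>c > 0\<close>, times \<open>1 - L\<kappa>(\<theta>)\<close> for the Laplace transform of an explicit \<open>\<kappa>\<close>. A Neumann series
  inverts this factor and exhibits \<open>W\<close> as a primitive, by uniqueness of Laplace transforms. In the
  remaining case \<open>\<psi>(\<theta>) / \<theta> \<rightarrow> \<infinity>\<close>, which forces \<open>W\<^sub>p(0+) = 0\<close>; as \<open>W\<^sub>p'\<close> is convex, it is integrable
  near \<open>0\<close>, and \<open>W\<^sub>\<phi> = W\<^sub>p + (\<phi> - p) W\<^sub>p * W\<^sub>\<phi>\<close> carries the regularity over to \<open>W\<^sub>\<phi>\<close>. That \<open>c > 0\<close>, and
  that paths have bounded variation when \<open>\<integral>\<^sub>0\<^sup>1 z \<nu>(dz) < \<infinity>\<close>, holds because \<open>\<psi>(\<theta>) \<le> b \<theta>\<close> for all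
  \<open>\<theta> > 0\<close> makes \<open>X\<^sub>t - b t\<close> almost surely decreasing.
\<close>

section \<open>Convolution of integrable functions\<close>

text \<open>Transforms are compared only for large \<theta>. This makes the Neumann series available
  for every \<kappa> that occurs: its exponentially weighted L1 norm tends to 0 as \<theta> grows,
  so no sign or size condition on \<kappa> arises.

  For \<sigma> = 0 the split is by integrability of z near 0 under \<nu> rather than by the
  variation of the paths, so that one implication suffices: integrable small jumps give bounded
  variation, which excludes (2). If they are not integrable, then \<nu>(0,\<infinity>) =
  \<infinity>, which excludes (4), and convexity of the derivative gives a continuously
  differentiable H on the whole line, which serves (2) and (3) alike.

  The equation for H presupposes only that W(x - y) (\<omega>(y) - \<phi>) H(y) is integrable in y
  over [a, x], so measurability of (\<omega> - \<phi>) H has to be extracted from it. This requires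
  a W that does not vanish identically, hence a \<psi> that is not constantly \<phi> beyond
  \<Phi>(\<phi>); the exclusion of decreasing paths enters here as well as in c > 0.\<close>

definition conv :: "(real \<Rightarrow> real) \<Rightarrow> (real \<Rightarrow> real) \<Rightarrow> real \<Rightarrow> real" where
  "conv f g x = (\<integral>y. f (x - y) * g y \<partial>lborel)"

lemma integrable_translate:
  fixes f :: "real \<Rightarrow> real"
  assumes "integrable lborel f"
  shows "integrable lborel (\<lambda>x. f (x - y))"
  using lborel_integrable_real_affine[OF assms, of 1 "- y"] by simp

lemma integral_translate:
  fixes f :: "real \<Rightarrow> real"
  shows "(\<integral>x. f (x - y) \<partial>lborel) = (\<integral>x. f x \<partial>lborel)"
  using lborel_integral_real_affine[of 1 f "- y"] by simp

lemma integrable_reflect: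
  fixes f :: "real \<Rightarrow> real"
  assumes "integrable lborel f"
  shows "integrable lborel (\<lambda>y. f (x - y))"
  using lborel_integrable_real_affine[OF assms, of "-1" x] by simp

lemma integral_reflect:
  fixes f :: "real \<Rightarrow> real"
  shows "(\<integral>y. f (x - y) \<partial>lborel) = (\<integral>y. f y \<partial>lborel)"
  using lborel_integral_real_affine[of "-1" f x] by simp

text \<open>Integrating over \<open>x\<close> first, a translation shows the total mass to be the
  product of the two L1 norms. Existence, integral and L1 bound of convolutions all rest on
  this.\<close>

lemma integrable_conv_pair:
  fixes f g :: "real \<Rightarrow> real"
  assumes f: "integrable lborel f" and g: "integrable lborel g"
  shows "integrable (lborel \<Otimes>\<^sub>M lborel) (\<lambda>(y, x). f (x - y) * g y)"
proof (rule lborel_pair.Fubini_integrable)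
  have [measurable]: "f \<in> borel_measurable borel" "g \<in> borel_measurable borel"
    using f g by (auto dest: borel_measurable_integrable)
  show "(\<lambda>(y, x). f (x - y) * g y) \<in> borel_measurable (lborel \<Otimes>\<^sub>M lborel)"
    by measurable
  have "(\<integral>x. norm (f (x - y) * g y) \<partial>lborel) = (\<integral>x. \<bar>f x\<bar> \<partial>lborel) * \<bar>g y\<bar>" for y
    using integral_translate[of "\<lambda>x. \<bar>f x\<bar>" y] by (simp add: abs_mult)
  then show "integrable lborel (\<lambda>y. \<integral>x. norm (case (y, x) of (y, x) \<Rightarrow> f (x - y) * g y) \<partial>lborel)"
    using g by simp
  show "AE y in lborel. integrable lborel (\<lambda>x. case (y, x) of (y, x) \<Rightarrow> f (x - y) * g y)"
    using integrable_translate[OF f] by simp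
qed

lemma
  assumes f: "integrable lborel f" and g: "integrable lborel g"
  shows integrable_conv: "integrable lborel (conv f g)"
    and integral_conv: "(\<integral>x. conv f g x \<partial>lborel) = (\<integral>x. f x \<partial>lborel) * (\<integral>x. g x \<partial>lborel)"
proof -
  note p = integrable_conv_pair[OF f g]
  show "integrable lborel (conv f g)"
    using lborel_pair.integrable_snd[OF p] by (simp add: conv_def[abs_def])
  have "(\<integral>x. conv f g x \<partial>lborel) = (\<integral>y. (\<integral>x. f (x - y) * g y \<partial>lborel) \<partial>lborel)"
    using lborel_pair.Fubini_integral[OF p] by (simp add: conv_def[abs_def])
  then show "(\<integral>x. conv f g x \<partial>lborel) = (\<integral>x. f x \<partial>lborel) * (\<integral>x. g x \<partial>lborel)"
    by (simp add: integral_translate)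
qed

text \<open>Young's inequality in L1; it yields the geometric decay of iterated convolutions in
  \<open>neumann_series\<close>.\<close>

lemma integral_abs_conv_le:
  assumes f: "integrable lborel f" and g: "integrable lborel g"
  shows "(\<integral>x. \<bar>conv f g x\<bar> \<partial>lborel) \<le> (\<integral>x. \<bar>f x\<bar> \<partial>lborel) * (\<integral>x. \<bar>g x\<bar> \<partial>lborel)"
proof -
  have "(\<integral>x. \<bar>conv f g x\<bar> \<partial>lborel) \<le> (\<integral>x. conv (\<lambda>x. \<bar>f x\<bar>) (\<lambda>x. \<bar>g x\<bar>) x \<partial>lborel)"
  proof (rule integral_mono)
    show "\<bar>conv f g x\<bar> \<le> conv (\<lambda>x. \<bar>f x\<bar>) (\<lambda>x. \<bar>g x\<bar>) x" for x
      unfolding conv_def using integral_abs_bound[of lborel "\<lambda>y. f (x - y) * g y"]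
      by (simp add: abs_mult)
  qed (use f g integrable_conv in auto)
  also have "\<dots> = (\<integral>x. \<bar>f x\<bar> \<partial>lborel) * (\<integral>x. \<bar>g x\<bar> \<partial>lborel)"
    using f g by (simp add: integral_conv)
  finally show ?thesis .
qed

text \<open>For a causal function this is the primitive vanishing at 0. The strict bound
  \<open>t < x\<close> makes it exactly the convolution with the indicator of the open positive
  half-line.\<close>

definition primitive :: "(real \<Rightarrow> real) \<Rightarrow> real \<Rightarrow> real" where
  "primitive f x = (LBINT t:{..<x}. f t)"

text \<open>Associativity of convolution in disguise, since \<open>primitive\<close> is convolution
  with the unit step.\<close>

lemma conv_primitive:
  assumes f: "integrable lborel f" and g: "integrable lborel g"
  shows "conv (primitive f) g x = primitive (conv f g) x"
proof -
  have [measurable]: "f \<in> borel_measurable borel" "g \<in> borel_measurable borel"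
    using f g by (auto dest: borel_measurable_integrable)
  have p: "integrable (lborel \<Otimes>\<^sub>M lborel) (\<lambda>(y, u). indicator {..<x} u * (f (u - y) * g y))"
    by (rule Bochner_Integration.integrable_bound[OF integrable_conv_pair[OF f g]])
       (auto simp: indicator_def)
  have "(\<integral>u. indicator {..<x} u * (f (u - y) * g y) \<partial>lborel) = primitive f (x - y) * g y" for y
  proof -
    have "(\<integral>u. indicator {..<x} u * (f (u - y) * g y) \<partial>lborel) =
        (\<integral>u. (indicator {..<x - y} (u - y) * f (u - y)) * g y \<partial>lborel)"
      by (intro Bochner_Integration.integral_cong) (auto simp: indicator_def)
    also have "\<dots> = primitive f (x - y) * g y"
      using integral_translate[of "\<lambda>u. indicator {..<x - y} u * f u" y]
      by (simp add: primitive_def set_lebesgue_integral_def)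
    finally show ?thesis .
  qed
  then have "conv (primitive f) g x = (\<integral>y. (\<integral>u. indicator {..<x} u * (f (u - y) * g y) \<partial>lborel) \<partial>lborel)"
    by (simp add: conv_def)
  also have "\<dots> = (\<integral>u. (\<integral>y. indicator {..<x} u * (f (u - y) * g y) \<partial>lborel) \<partial>lborel)"
    using lborel_pair.Fubini_integral[OF p] by simp
  finally show ?thesis
    by (simp add: primitive_def set_lebesgue_integral_def conv_def)
qed

lemma continuous_on_primitive:
  assumes f: "integrable lborel f"
  shows "continuous_on UNIV (primitive f)"
proof (rule continuous_at_imp_continuous_on, rule ballI, rule continuous_at_sequentiallyI)
  fix x :: real and u :: "nat \<Rightarrow> real"
  assume u: "u \<longlonglongrightarrow> x"
  have [measurable]: "f \<in> borel_measurable borel"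
    using f by (auto dest: borel_measurable_integrable)
  have "(\<lambda>n. \<integral>t. indicator {..<u n} t * f t \<partial>lborel) \<longlonglongrightarrow> (\<integral>t. indicator {..<x} t * f t \<partial>lborel)"
  proof (rule integral_dominated_convergence[where w = "\<lambda>t. \<bar>f t\<bar>"])
    show "AE t in lborel. (\<lambda>n. indicator {..<u n} t * f t) \<longlonglongrightarrow> indicator {..<x} t * f t"
    proof (rule AE_mp[OF AE_lborel_singleton[of x]], rule AE_I2, rule impI)
      fix t assume "t \<noteq> x"
      then have "eventually (\<lambda>n. t < u n \<longleftrightarrow> t < x) sequentially"
        using order_tendstoD[OF u, of t] by (cases "t < x") (auto elim: eventually_mono)
      then show "(\<lambda>n. indicator {..<u n} t * f t) \<longlonglongrightarrow> indicator {..<x} t * f t"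
        by (intro tendsto_eventually) (auto elim!: eventually_mono simp: indicator_def)
    qed
  qed (use f in \<open>auto simp: indicator_def\<close>)
  then show "(\<lambda>n. primitive f (u n)) \<longlonglongrightarrow> primitive f x"
    by (simp add: primitive_def set_lebesgue_integral_def)
qed

section \<open>Continuity of the convolution of an integrable function with a bounded one\<close>

lemma integrable_mult_bounded:
  fixes f g :: "real \<Rightarrow> real"
  assumes "integrable lborel f" and [measurable]: "g \<in> borel_measurable borel"
    and "\<And>x. \<bar>g x\<bar> \<le> B"
  shows "integrable lborel (\<lambda>x. f x * g x)"
proof (rule Bochner_Integration.integrable_bound)
  show "integrable lborel (\<lambda>x. B * \<bar>f x\<bar>)"
    using assms by auto
  have [measurable]: "f \<in> borel_measurable borel"
    using assms by (auto dest: borel_measurable_integrable)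
  show "(\<lambda>x. f x * g x) \<in> borel_measurable lborel"
    by measurable
  have "0 \<le> B" using assms(3)[of 0] by linarith
  then show "AE x in lborel. norm (f x * g x) \<le> norm (B * \<bar>f x\<bar>)"
    using assms(3) by (intro AE_I2) (auto simp: abs_mult mult.commute[of "\<bar>f _\<bar>"] intro!: mult_right_mono)
qed

text \<open>The convolutions differ uniformly by at most \<open>B\<close> times the L1 distance of
  the kernels, so continuity survives as a uniform limit.\<close>

lemma continuous_on_conv_L1_limit:
  assumes s: "\<And>n. integrable lborel (s n)" and f: "integrable lborel f"
    and g[measurable]: "g \<in> borel_measurable borel" and B: "\<And>x. \<bar>g x\<bar> \<le> B"
    and lim: "(\<lambda>n. \<integral>x. \<bar>s n x - f x\<bar> \<partial>lborel) \<longlonglongrightarrow> 0"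
    and cont: "\<And>n. continuous_on UNIV (conv (s n) g)"
  shows "continuous_on UNIV (conv f g)"
proof (rule uniform_limit_theorem[where F = sequentially])
  show "\<forall>\<^sub>F n in sequentially. continuous_on UNIV (conv (s n) g)"
    using cont by simp
  have B0: "0 \<le> B" using B[of 0] by linarith
  have le: "dist (conv (s n) g x) (conv f g x) \<le> B * (\<integral>x. \<bar>s n x - f x\<bar> \<partial>lborel)" for n x
  proof -
    have i: "integrable lborel (\<lambda>y. h (x - y) * g y)" if "integrable lborel h" for h
      using that by (intro integrable_mult_bounded[where B = B] integrable_reflect g B)
    have "conv (s n) g x - conv f g x = (\<integral>y. (s n (x - y) - f (x - y)) * g y \<partial>lborel)"
      using i[OF s] i[OF f] by (simp add: conv_def left_diff_distrib)
    also have "\<bar>\<dots>\<bar> \<le> (\<integral>y. \<bar>(s n (x - y) - f (x - y)) * g y\<bar> \<partial>lborel)"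
      by (rule integral_abs_bound)
    also have "\<dots> \<le> (\<integral>y. B * \<bar>s n (x - y) - f (x - y)\<bar> \<partial>lborel)"
    proof (rule integral_mono)
      show "integrable lborel (\<lambda>y. \<bar>(s n (x - y) - f (x - y)) * g y\<bar>)"
        using i[OF Bochner_Integration.integrable_diff[OF s[of n] f]] by auto
      show "integrable lborel (\<lambda>y. B * \<bar>s n (x - y) - f (x - y)\<bar>)"
        using integrable_reflect[OF Bochner_Integration.integrable_diff[OF s[of n] f], of x] by auto
    qed (use B in \<open>auto simp: abs_mult mult.commute intro!: mult_right_mono\<close>)
    also have "\<dots> = B * (\<integral>x. \<bar>s n x - f x\<bar> \<partial>lborel)"
      using integral_reflect[of "\<lambda>y. \<bar>s n y - f y\<bar>" x] by simp
    finally show ?thesis by (simp add: dist_real_def)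
  qed
  show "uniform_limit UNIV (\<lambda>n. conv (s n) g) (conv f g) sequentially"
  proof (rule uniform_limitI)
    fix e :: real assume "e > 0"
    have "(\<lambda>n. B * (\<integral>x. \<bar>s n x - f x\<bar> \<partial>lborel)) \<longlonglongrightarrow> 0"
      using tendsto_mult_right_zero[OF lim] .
    then have "\<forall>\<^sub>F n in sequentially. B * (\<integral>x. \<bar>s n x - f x\<bar> \<partial>lborel) < e"
      using \<open>e > 0\<close> by (rule order_tendstoD)
    then show "\<forall>\<^sub>F n in sequentially. \<forall>x\<in>UNIV. dist (conv (s n) g x) (conv f g x) < e"
      by eventually_elim (use le order_le_less_trans in blast)
  qed
qed simp

text \<open>The cutoff destroys continuity of the kernel only at \<open>-R\<close> and
  \<open>R\<close>, that is for two values of \<open>y\<close>. These form a null set, so dominated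
  convergence along a sequence still applies.\<close>

lemma continuous_on_conv_truncated:
  assumes h: "continuous_on UNIV h" "\<And>x. \<bar>h x\<bar> \<le> C"
    and g[measurable]: "g \<in> borel_measurable borel" and B: "\<And>x. \<bar>g x\<bar> \<le> B"
  shows "continuous_on UNIV (conv (\<lambda>x. indicator {-R..R} x * h x) g)"
proof (rule continuous_at_imp_continuous_on, rule ballI, rule continuous_at_sequentiallyI)
  fix x :: real and u :: "nat \<Rightarrow> real"
  assume u: "u \<longlonglongrightarrow> x"
  have [measurable]: "h \<in> borel_measurable borel"
    using h borel_measurable_continuous_onI by blast
  have "eventually (\<lambda>n. dist (u n) x < 1) sequentially"
    using u by (simp add: tendsto_iff)
  then obtain N where N: "\<And>n. n \<ge> N \<Longrightarrow> \<bar>u n - x\<bar> < 1"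
    by (auto simp: eventually_sequentially dist_real_def)
  have BC: "0 \<le> B" "0 \<le> C" using B[of 0] h(2)[of 0] by linarith+
  have "(\<lambda>n. \<integral>y. (indicator {-R..R} (u (n + N) - y) * h (u (n + N) - y)) * g y \<partial>lborel)
     \<longlonglongrightarrow> (\<integral>y. (indicator {-R..R} (x - y) * h (x - y)) * g y \<partial>lborel)"
  \<comment> \<open>The interval is enlarged by 1 on both sides because the shifted sequence stays
    within distance 1 of \<open>x\<close>.\<close>
  proof (rule integral_dominated_convergence[where w = "\<lambda>y. indicator {x - R - 1..x + R + 1} y * (C * B)"])
    show "AE y in lborel. (\<lambda>n. (indicator {-R..R} (u (n + N) - y) * h (u (n + N) - y)) * g y)
       \<longlonglongrightarrow> (indicator {-R..R} (x - y) * h (x - y)) * g y"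
    proof (rule AE_mp[OF AE_lborel_singleton[of "x - R"]],
        rule AE_mp[OF AE_lborel_singleton[of "x + R"]], rule AE_I2, intro impI)
      fix y assume y: "y \<noteq> x + R" "y \<noteq> x - R"
      have uN: "(\<lambda>n. u (n + N) - y) \<longlonglongrightarrow> x - y"
        by (intro tendsto_intros LIMSEQ_ignore_initial_segment u)
      have "eventually (\<lambda>n. u (n + N) - y > -R \<longleftrightarrow> x - y > -R) sequentially"
        "eventually (\<lambda>n. u (n + N) - y < R \<longleftrightarrow> x - y < R) sequentially"
        "eventually (\<lambda>n. u (n + N) - y \<noteq> R \<and> u (n + N) - y \<noteq> -R) sequentially"
        using order_tendstoD[OF uN, of R] order_tendstoD[OF uN, of "-R"] y
          tendsto_imp_eventually_ne[OF uN, of R] tendsto_imp_eventually_ne[OF uN, of "-R"]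
        by (cases "x - y > -R"; cases "x - y < R"; auto elim: eventually_mono eventually_elim2)+
      then have "eventually (\<lambda>n. indicator {-R..R} (u (n + N) - y) = (indicator {-R..R} (x - y) :: real)) sequentially"
        by eventually_elim (use y in \<open>auto simp: indicator_def\<close>)
      then have 1: "(\<lambda>n. indicator {-R..R} (u (n + N) - y)) \<longlonglongrightarrow> (indicator {-R..R} (x - y) :: real)"
        by (rule tendsto_eventually)
      have 2: "(\<lambda>n. h (u (n + N) - y)) \<longlonglongrightarrow> h (x - y)"
        using uN h(1) by (auto simp: continuous_on_eq_continuous_at intro: isCont_tendsto_compose)
      show "(\<lambda>n. (indicator {-R..R} (u (n + N) - y) * h (u (n + N) - y)) * g y)
         \<longlonglongrightarrow> (indicator {-R..R} (x - y) * h (x - y)) * g y"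
        by (intro tendsto_intros 1 2)
    qed
    show "AE y in lborel. norm ((indicator {-R..R} (u (n + N) - y) * h (u (n + N) - y)) * g y)
       \<le> indicator {x - R - 1..x + R + 1} y * (C * B)" for n
    proof (rule AE_I2)
      fix y
      have "\<bar>h (u (n + N) - y)\<bar> * \<bar>g y\<bar> \<le> C * B"
        using h B BC by (intro mult_mono) auto
      then show "norm ((indicator {-R..R} (u (n + N) - y) * h (u (n + N) - y)) * g y)
       \<le> indicator {x - R - 1..x + R + 1} y * (C * B)"
        using N[of "n + N"] BC by (auto simp: indicator_def abs_mult abs_less_iff)
    qed
    show "integrable lborel (\<lambda>y. indicator {x - R - 1..x + R + 1} y * (C * B))"
      by (intro integrable_mult_left integrable_real_indicator) (auto simp: emeasure_lborel_Icc_eq)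
  qed measurable
  then show "(\<lambda>n. conv (\<lambda>x. indicator {-R..R} x * h x) g (u n)) \<longlonglongrightarrow> conv (\<lambda>x. indicator {-R..R} x * h x) g x"
    unfolding conv_def by (rule LIMSEQ_offset)
qed

text \<open>L1 approximation in two stages: truncate \<open>f\<close> in height and in space, then
  approximate the truncation almost everywhere by continuous functions.\<close>

lemma continuous_on_conv:
  assumes f: "integrable lborel f"
    and g[measurable]: "g \<in> borel_measurable borel" and B: "\<And>x. \<bar>g x\<bar> \<le> B"
  shows "continuous_on UNIV (conv f g)"
proof -
  have f'[measurable]: "f \<in> borel_measurable borel"
    using f by (auto dest: borel_measurable_integrable)
  define t where "t m x = indicator {-real m..real m} x * max (-real m) (min (real m) (f x))" for m x
  have tm[measurable]: "t m \<in> borel_measurable borel" for m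
    unfolding t_def[abs_def] by measurable
  have tb: "\<bar>t m x\<bar> \<le> real m * indicator {-real m..real m} x" for m x
    by (auto simp: t_def indicator_def)
  have tf: "\<bar>t m x\<bar> \<le> \<bar>f x\<bar>" for m x
    by (auto simp: t_def indicator_def)
  have ti: "integrable lborel (t m)" for m
    by (rule Bochner_Integration.integrable_bound[OF f]) (use tf in auto)
  show ?thesis
  proof (rule continuous_on_conv_L1_limit[where s = t])
    have "(\<lambda>m. \<integral>x. \<bar>t m x - f x\<bar> \<partial>lborel) \<longlonglongrightarrow> (\<integral>x. 0 \<partial>(lborel :: real measure))"
    proof (rule integral_dominated_convergence[where w = "\<lambda>x. 2 * \<bar>f x\<bar>"])
      show "AE x in lborel. (\<lambda>m. \<bar>t m x - f x\<bar>) \<longlonglongrightarrow> 0"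
      proof (rule AE_I2)
        fix x
        obtain N :: nat where N: "real N \<ge> max \<bar>x\<bar> \<bar>f x\<bar>"
          using real_arch_simple by blast
        have "eventually (\<lambda>m. t m x = f x) sequentially"
          using eventually_ge_at_top[of N]
        proof eventually_elim
          case (elim m)
          then have "real N \<le> real m" by simp
          then have "\<bar>x\<bar> \<le> real m" "\<bar>f x\<bar> \<le> real m"
            using N by linarith+
          then show ?case
            by (simp add: t_def indicator_def abs_le_iff)
        qed
        then show "(\<lambda>m. \<bar>t m x - f x\<bar>) \<longlonglongrightarrow> 0"
          by (intro tendsto_eventually) (auto elim: eventually_mono)
      qed
      show "AE x in lborel. norm \<bar>t m x - f x\<bar> \<le> 2 * \<bar>f x\<bar>" for m
        proof (rule AE_I2)
        fix x
        show "norm \<bar>t m x - f x\<bar> \<le> 2 * \<bar>f x\<bar>"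
          using tf[of m x] abs_triangle_ineq4[of "t m x" "f x"] by simp
      qed
    qed (use f in auto)
    then show "(\<lambda>m. \<integral>x. \<bar>t m x - f x\<bar> \<partial>lborel) \<longlonglongrightarrow> 0"
      by simp
    fix m
    \<comment> \<open>A Lebesgue measurable function is an almost everywhere limit of continuous
      ones. Clipping them at height \<open>m\<close> supplies a dominating function and leaves the
      limit unchanged, since \<open>t m\<close> is itself bounded by \<open>m\<close>.\<close>
    have "t m \<in> borel_measurable lebesgue"
      using tm by (simp add: measurable_completion)
    then obtain N G where N: "negligible N" and G: "\<And>n :: nat. continuous_on UNIV (G n)"
      and lim: "\<And>x. x \<notin> N \<Longrightarrow> (\<lambda>n. G n x) \<longlonglongrightarrow> t m x"
      using lebesgue_measurable_imp_measurable_on_real[of "t m" UNIV]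
      by (auto simp: measurable_on_def)
    define c where "c n x = max (- real m) (min (real m) (G n x))" for n x
    have cc: "continuous_on UNIV (c n)" for n
      unfolding c_def[abs_def] by (intro continuous_intros G)
    have cb: "\<bar>c n x\<bar> \<le> real m" for n x
      by (auto simp: c_def)
    define s where "s n = (\<lambda>x. indicator {-real m..real m} x * c n x)" for n
    have [measurable]: "c n \<in> borel_measurable borel" for n
      using cc borel_measurable_continuous_onI by blast
    have sm[measurable]: "s n \<in> borel_measurable borel" for n
      unfolding s_def by measurable
    have ib: "integrable lborel (\<lambda>x. real m * indicator {-real m..real m} x)"
      by simp
    have sb: "\<bar>s n x\<bar> \<le> real m * indicator {-real m..real m} x" for n x
      using cb by (auto simp: s_def indicator_def)
    have si: "integrable lborel (s n)" for n
      by (rule Bochner_Integration.integrable_bound[OF ib]) (use sb in auto)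
    show "continuous_on UNIV (conv (t m) g)"
    proof (rule continuous_on_conv_L1_limit[OF si ti g B])
      show "continuous_on UNIV (conv (s n) g)" for n
        unfolding s_def by (rule continuous_on_conv_truncated[OF cc cb g B])
      have "(\<lambda>n. \<integral>x. \<bar>s n x - t m x\<bar> \<partial>lborel) \<longlonglongrightarrow> (\<integral>x. 0 \<partial>(lborel :: real measure))"
      proof (rule integral_dominated_convergence[where w = "\<lambda>x. 2 * (real m * indicator {-real m..real m} x)"])
        have "AE x in lebesgue. x \<notin> N"
          using N by (simp add: negligible_iff_null_sets AE_not_in)
        then have "AE x in lborel. x \<notin> N"
          by (simp add: AE_completion_iff)
        then show "AE x in lborel. (\<lambda>n. \<bar>s n x - t m x\<bar>) \<longlonglongrightarrow> 0"
        proof eventually_elim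
          case (elim x)
          have "(\<lambda>n. s n x) \<longlonglongrightarrow> indicator {-real m..real m} x * max (- real m) (min (real m) (t m x))"
            unfolding s_def c_def by (intro tendsto_intros lim elim)
          also have "indicator {-real m..real m} x * max (- real m) (min (real m) (t m x)) = t m x"
            by (auto simp: t_def indicator_def)
          finally show ?case
            by (simp add: LIM_zero_iff tendsto_rabs_zero)
        qed
        show "AE x in lborel. norm \<bar>s n x - t m x\<bar> \<le> 2 * (real m * indicator {-real m..real m} x)" for n
          proof (rule AE_I2)
          fix x
          show "norm \<bar>s n x - t m x\<bar> \<le> 2 * (real m * indicator {-real m..real m} x)"
            using sb[of n x] tb[of m x] abs_triangle_ineq4[of "s n x" "t m x"] by simp
        qed
      qed (use ib in auto)
      then show "(\<lambda>n. \<integral>x. \<bar>s n x - t m x\<bar> \<partial>lborel) \<longlonglongrightarrow> 0"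
        by simp
    qed
  qed (use ti f B in auto)
qed

section \<open>Laplace transforms\<close>

definition exp_integrable :: "real \<Rightarrow> (real \<Rightarrow> real) \<Rightarrow> bool" where
  "exp_integrable \<theta> f \<longleftrightarrow> integrable lborel (\<lambda>x. exp (- \<theta> * x) * f x)"

definition laplace :: "(real \<Rightarrow> real) \<Rightarrow> real \<Rightarrow> real" where
  "laplace f \<theta> = (\<integral>x. exp (- \<theta> * x) * f x \<partial>lborel)"

text \<open>Vanishing at 0 is included: scale functions have no prescribed value there, and
  \<open>laplace_inject\<close> is to give equality at every point.\<close>

definition causal :: "(real \<Rightarrow> real) \<Rightarrow> bool" where
  "causal f \<longleftrightarrow> (\<forall>x\<le>0. f x = 0)"

lemma AE_lborelI_except:
  fixes c :: real
  assumes "\<And>x. x \<noteq> c \<Longrightarrow> P x"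
  shows "AE x in lborel. P x"
  using AE_lborel_singleton[of c] by eventually_elim (rule assms)

text \<open>The weights multiply because \<open>(x - y) + y = x\<close>; hence the L1 facts on
  \<open>conv\<close> carry over to exponentially weighted functions.\<close>

lemma exp_times_conv:
  "exp (- \<theta> * x) * conv f g x = conv (\<lambda>x. exp (- \<theta> * x) * f x) (\<lambda>x. exp (- \<theta> * x) * g x) x"
proof -
  have "exp (- \<theta> * (x - y)) * exp (- \<theta> * y) = exp (- \<theta> * x)" for y
    by (simp add: exp_add[symmetric] algebra_simps)
  then have *: "exp (- \<theta> * (x - y)) * f (x - y) * (exp (- \<theta> * y) * g y) = exp (- \<theta> * x) * (f (x - y) * g y)" for y
    by (metis mult.assoc mult.left_commute)
  show ?thesis
    unfolding conv_def * by (simp only: integral_mult_right_zero)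
qed

lemma exp_integrable_conv:
  assumes "exp_integrable \<theta> f" "exp_integrable \<theta> g"
  shows "exp_integrable \<theta> (conv f g)"
  using assms integrable_conv unfolding exp_integrable_def exp_times_conv by blast

lemma laplace_conv:
  assumes "exp_integrable \<theta> f" "exp_integrable \<theta> g"
  shows "laplace (conv f g) \<theta> = laplace f \<theta> * laplace g \<theta>"
  using assms integral_conv unfolding exp_integrable_def laplace_def exp_times_conv by blast

lemma causal_conv:
  assumes "causal f" "causal g"
  shows "causal (conv f g)"
proof -
  have *: "f (x - y) * g y = 0" if "x \<le> 0" for x y
    using assms that unfolding causal_def by (cases "y \<le> 0") auto
  have "conv f g x = 0" if "x \<le> 0" for x
    unfolding conv_def *[OF that] by simp
  then show ?thesis
    by (simp add: causal_def)
qed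

lemma borel_measurable_exp_integrable:
  assumes "exp_integrable \<theta> f"
  shows "f \<in> borel_measurable borel"
proof -
  have [measurable]: "(\<lambda>x. exp (- \<theta> * x) * f x) \<in> borel_measurable borel"
    using assms borel_measurable_integrable unfolding exp_integrable_def by force
  have "(\<lambda>x. exp (\<theta> * x) * (exp (- \<theta> * x) * f x)) \<in> borel_measurable borel"
    by measurable
  also have "(\<lambda>x. exp (\<theta> * x) * (exp (- \<theta> * x) * f x)) = f"
    by (simp add: mult.assoc[symmetric] exp_add[symmetric])
  finally show ?thesis .
qed

lemma exp_integrable_mono:
  assumes "exp_integrable \<theta> f" "causal f" "\<theta> \<le> \<theta>'"
  shows "exp_integrable \<theta>' f"
proof -
  have [measurable]: "f \<in> borel_measurable borel"
    using assms borel_measurable_exp_integrable by blast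
  have "\<bar>exp (- \<theta>' * x) * f x\<bar> \<le> \<bar>exp (- \<theta> * x) * f x\<bar>" for x
  proof (cases "x \<le> 0")
    case False
    then have "exp (- \<theta>' * x) \<le> exp (- \<theta> * x)"
      using assms by simp
    then show ?thesis
      by (auto simp: abs_mult intro!: mult_right_mono)
  qed (use assms in \<open>simp add: causal_def\<close>)
  then show ?thesis
    using assms unfolding exp_integrable_def by - (erule Bochner_Integration.integrable_bound, auto)
qed

lemma exp_integrable_cutoff:
  assumes "exp_integrable \<theta> f" "causal f"
  shows "integrable lborel (\<lambda>x. indicator {..R} x * f x)"
proof -
  have [measurable]: "f \<in> borel_measurable borel"
    using assms borel_measurable_exp_integrable by blast
  \<comment> \<open>The weight with exponent \<open>\<bar>\<theta>\<bar>\<close> is at least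
    \<open>exp (- \<bar>\<theta>\<bar> * R)\<close> on \<open>{0<..R}\<close>, which is what the
    domination needs.\<close>
  have "exp_integrable \<bar>\<theta>\<bar> f"
    using exp_integrable_mono[OF assms] by auto
  then have "integrable lborel (\<lambda>x. exp (\<bar>\<theta>\<bar> * R) * (exp (- \<bar>\<theta>\<bar> * x) * f x))"
    unfolding exp_integrable_def by (rule integrable_mult_right)
  then show ?thesis
  proof (rule Bochner_Integration.integrable_bound)
    have "\<bar>indicator {..R} x * f x\<bar> \<le> exp (\<bar>\<theta>\<bar> * R) * (exp (- \<bar>\<theta>\<bar> * x) * \<bar>f x\<bar>)" for x
    proof (cases "0 < x \<and> x \<le> R")
      case True
      then have "exp (\<bar>\<theta>\<bar> * R) * exp (- \<bar>\<theta>\<bar> * x) \<ge> 1"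
        by (auto simp: exp_add[symmetric] algebra_simps intro!: mult_right_mono)
      then have "1 * \<bar>f x\<bar> \<le> (exp (\<bar>\<theta>\<bar> * R) * exp (- \<bar>\<theta>\<bar> * x)) * \<bar>f x\<bar>"
        by (intro mult_right_mono) auto
      then show ?thesis
        using True by (simp add: mult.assoc)
    qed (use assms in \<open>auto simp: causal_def not_less\<close>)
    then show "AE x in lborel. norm (indicator {..R} x * f x) \<le> norm (exp (\<bar>\<theta>\<bar> * R) * (exp (- \<bar>\<theta>\<bar> * x) * f x))"
      by (simp add: abs_mult)
  qed measurable
qed

lemma
  assumes "exp_integrable \<theta> f" "exp_integrable \<theta> g"
  shows exp_integrable_add: "exp_integrable \<theta> (\<lambda>x. f x + g x)"
    and laplace_add: "laplace (\<lambda>x. f x + g x) \<theta> = laplace f \<theta> + laplace g \<theta>"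
    and exp_integrable_diff: "exp_integrable \<theta> (\<lambda>x. f x - g x)"
    and laplace_diff: "laplace (\<lambda>x. f x - g x) \<theta> = laplace f \<theta> - laplace g \<theta>"
  using assms by (auto simp: exp_integrable_def laplace_def distrib_left right_diff_distrib)

lemma
  shows exp_integrable_cmult: "exp_integrable \<theta> f \<Longrightarrow> exp_integrable \<theta> (\<lambda>x. c * f x)"
    and laplace_cmult: "laplace (\<lambda>x. c * f x) \<theta> = c * laplace f \<theta>"
proof -
  have *: "exp (- \<theta> * x) * (c * f x) = c * (exp (- \<theta> * x) * f x)" for x
    by simp
  show "exp_integrable \<theta> f \<Longrightarrow> exp_integrable \<theta> (\<lambda>x. c * f x)" "laplace (\<lambda>x. c * f x) \<theta> = c * laplace f \<theta>"
    unfolding exp_integrable_def laplace_def * by auto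
qed

section \<open>The unit step and the transform of a primitive\<close>

definition heaviside :: "real \<Rightarrow> real" where
  "heaviside = indicator {0<..}"

lemma causal_heaviside: "causal heaviside"
  by (simp add: causal_def heaviside_def)

lemma
  assumes "\<theta> > 0"
  shows exp_integrable_heaviside: "exp_integrable \<theta> heaviside"
    and laplace_heaviside: "laplace heaviside \<theta> = 1 / \<theta>"
proof -
  have "(\<integral>\<^sup>+x. ennreal (exp (- \<theta> * x)) * indicator {0..} x \<partial>lborel) = ennreal (0 - (- exp (- \<theta> * 0) / \<theta>))"
  proof (rule nn_integral_FTC_atLeast)
    show "((\<lambda>x. - exp (- \<theta> * x) / \<theta>) has_real_derivative exp (- \<theta> * x)) (at x)" for x
      using assms by (auto intro!: derivative_eq_intros)
    have "((\<lambda>x. exp (- (\<theta> * x))) \<longlongrightarrow> 0) at_top"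
      using assms
      by (intro filterlim_compose[OF exp_at_bot] filterlim_compose[OF filterlim_uminus_at_bot_at_top]
          filterlim_tendsto_pos_mult_at_top[OF tendsto_const] filterlim_ident)
    from tendsto_divide[OF tendsto_minus[OF this] tendsto_const[of \<theta>]]
    show "((\<lambda>x. - exp (- \<theta> * x) / \<theta>) \<longlongrightarrow> 0) at_top"
      using assms by simp
  qed auto
  also have "(\<integral>\<^sup>+x. ennreal (exp (- \<theta> * x)) * indicator {0..} x \<partial>lborel) =
      (\<integral>\<^sup>+x. ennreal (exp (- \<theta> * x) * heaviside x) \<partial>lborel)"
    by (intro nn_integral_cong_AE AE_lborelI_except[of 0])
       (auto simp: heaviside_def indicator_def)
  finally have "has_bochner_integral lborel (\<lambda>x. exp (- \<theta> * x) * heaviside x) (1 / \<theta>)"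
    using assms by (intro has_bochner_integral_nn_integral) (auto simp: heaviside_def)
  then show "exp_integrable \<theta> heaviside" "laplace heaviside \<theta> = 1 / \<theta>"
    by (auto simp: exp_integrable_def laplace_def dest: has_bochner_integral_integral_eq integrable.intros)
qed

lemma primitive_eq_conv: "primitive f = conv heaviside f"
proof
  fix x
  have "heaviside (x - y) = indicator {..<x} y" for y
    by (simp add: heaviside_def indicator_def)
  then show "primitive f x = conv heaviside f x"
    by (simp add: primitive_def conv_def set_lebesgue_integral_def)
qed

lemma
  assumes "exp_integrable \<theta> f" "\<theta> > 0"
  shows exp_integrable_primitive: "exp_integrable \<theta> (primitive f)"
    and laplace_primitive: "laplace (primitive f) \<theta> = laplace f \<theta> / \<theta>"
  using assms exp_integrable_heaviside laplace_heaviside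
  by (auto simp: primitive_eq_conv laplace_conv intro: exp_integrable_conv)

lemma causal_primitive: "causal f \<Longrightarrow> causal (primitive f)"
  unfolding primitive_eq_conv by (intro causal_conv causal_heaviside)

section \<open>Uniqueness of Laplace transforms\<close>

lemma exp_integrable_power:
  assumes "causal f" "exp_integrable \<theta> f" 
  shows "integrable lborel (\<lambda>x. exp (- x) ^ n * (exp (- \<theta> * x) * f x))"
    and "(\<integral>x. exp (- x) ^ n * (exp (- \<theta> * x) * f x) \<partial>lborel) = laplace f (\<theta> + n)"
proof -
  have eq: "exp (- x) ^ n * exp (- \<theta> * x) = exp (- (\<theta> + n) * x)" for x
    by (simp add: exp_of_nat_mult[symmetric] exp_add[symmetric] algebra_simps)
  have *: "exp (- x) ^ n * (exp (- \<theta> * x) * f x) = exp (- (\<theta> + n) * x) * f x" for x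
    by (simp only: mult.assoc[symmetric] eq)
  have "exp_integrable (\<theta> + n) f"
    using exp_integrable_mono assms by auto
  then show "integrable lborel (\<lambda>x. exp (- x) ^ n * (exp (- \<theta> * x) * f x))"
    "(\<integral>x. exp (- x) ^ n * (exp (- \<theta> * x) * f x) \<partial>lborel) = laplace f (\<theta> + n)"
    unfolding exp_integrable_def laplace_def * by auto
qed

text \<open>Substituting \<open>y = exp (- x)\<close> turns values of the transform into moments, so Weierstrass' theorem applies.\<close>

lemma laplace_eq_0_imp_eq_0:
  assumes f: "causal f" "continuous_on {0<..} f"
    and int: "exp_integrable \<theta> f" and zero: "\<And>\<theta>'. \<theta>' \<ge> \<theta> \<Longrightarrow> laplace f \<theta>' = 0"
  shows "f x = 0"
proof -
  define u where "u x = exp (- \<theta> * x) * f x" for x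
  have ui: "integrable lborel u"
    using int by (simp add: exp_integrable_def u_def[abs_def])
  have um[measurable]: "u \<in> borel_measurable borel"
    using ui by (auto dest: borel_measurable_integrable)
  have u0: "u x = 0" if "x \<le> 0" for x
    using f that by (simp add: u_def causal_def)
  have poly: "integrable lborel (\<lambda>x. p (exp (- x)) * u x) \<and> (\<integral>x. p (exp (- x)) * u x \<partial>lborel) = 0"
    if p: "real_polynomial_function p" for p
  proof -
    obtain a n where p: "p = (\<lambda>x. \<Sum>i\<le>n. a i * x ^ i)"
      using real_polynomial_function_imp_sum[OF p] by blast
    have i: "integrable lborel (\<lambda>x. a i * (exp (- x) ^ i * u x))" for i
      unfolding u_def using exp_integrable_power[OF f(1) int] by (intro integrable_mult_right)
    have "(\<integral>x. a i * (exp (- x) ^ i * u x) \<partial>lborel) = 0" for i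
      unfolding u_def using exp_integrable_power(2)[OF f(1) int] zero by simp
    then have "(\<integral>x. (\<Sum>i\<le>n. a i * (exp (- x) ^ i * u x)) \<partial>lborel) = 0"
      using i by (subst Bochner_Integration.integral_sum) (auto intro!: sum.neutral)
    moreover have "integrable lborel (\<lambda>x. \<Sum>i\<le>n. a i * (exp (- x) ^ i * u x))"
      by (intro Bochner_Integration.integrable_sum i)
    moreover have *: "p (exp (- x)) * u x = (\<Sum>i\<le>n. a i * (exp (- x) ^ i * u x))" for x
      unfolding p by (simp only: sum_distrib_right mult.assoc)
    ultimately show ?thesis
      unfolding * by blast
  qed
  have cont: "(\<integral>x. h (exp (- x)) * u x \<partial>lborel) = 0"
    if h: "continuous_on UNIV h" and C: "\<And>x. \<bar>h x\<bar> \<le> C" for h :: "real \<Rightarrow> real" and C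
  proof (rule ccontr)
    define J where "J = (\<integral>x. h (exp (- x)) * u x \<partial>lborel)"
    define K where "K = (\<integral>x. \<bar>u x\<bar> \<partial>lborel)"
    assume "(\<integral>x. h (exp (- x)) * u x \<partial>lborel) \<noteq> 0"
    then have J: "\<bar>J\<bar> > 0" by (simp add: J_def)
    have K: "K \<ge> 0" by (simp add: K_def)
    \<comment> \<open>The denominator \<open>K + 1\<close> allows \<open>K = 0\<close> and keeps
      \<open>e * K\<close> strictly below \<open>\<bar>J\<bar>\<close>.\<close>
    define e where "e = \<bar>J\<bar> / (K + 1)"
    have "e > 0" using J K by (simp add: e_def)
    have "continuous_on {0..1} h" using h continuous_on_subset by blast
    then obtain p where p: "real_polynomial_function p" "\<And>x. x \<in> {0..1} \<Longrightarrow> \<bar>h x - p x\<bar> < e"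
      using Stone_Weierstrass_real_polynomial_function[OF compact_Icc _ \<open>e > 0\<close>] by metis
    have [measurable]: "h \<in> borel_measurable borel"
      using h borel_measurable_continuous_onI by blast
    have hi: "integrable lborel (\<lambda>x. h (exp (- x)) * u x)"
      using integrable_mult_bounded[OF ui, of "\<lambda>x. h (exp (- x))" C] C by (simp add: mult.commute)
    have "J = (\<integral>x. h (exp (- x)) * u x \<partial>lborel) - (\<integral>x. p (exp (- x)) * u x \<partial>lborel)"
      using poly[OF p(1)] by (simp add: J_def)
    also have "\<dots> = (\<integral>x. (h (exp (- x)) - p (exp (- x))) * u x \<partial>lborel)"
      using poly[OF p(1)] hi by (simp add: left_diff_distrib)
    also have "\<bar>\<dots>\<bar> \<le> (\<integral>x. \<bar>(h (exp (- x)) - p (exp (- x))) * u x\<bar> \<partial>lborel)"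
      by (rule integral_abs_bound)
    also have "\<dots> \<le> (\<integral>x. e * \<bar>u x\<bar> \<partial>lborel)"
    proof (rule integral_mono)
      show "integrable lborel (\<lambda>x. \<bar>(h (exp (- x)) - p (exp (- x))) * u x\<bar>)"
        using poly[OF p(1)] hi by (simp add: left_diff_distrib)
      show "\<bar>(h (exp (- x)) - p (exp (- x))) * u x\<bar> \<le> e * \<bar>u x\<bar>" for x
        using p(2)[of "exp (- x)"] u0[of x] by (cases "x \<le> 0") (auto simp: abs_mult intro!: mult_right_mono)
    qed (use ui in auto)
    also have "\<dots> = e * K" by (simp add: K_def)
    also have "\<dots> < \<bar>J\<bar>" using J K by (simp add: e_def field_simps)
    finally show False by simp
  qed
  have half: "(\<integral>x. indicator {..<b} x * u x \<partial>lborel) = 0" for b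
  proof -
    \<comment> \<open>Ramps of slope \<open>n\<close> that start at \<open>exp (- b)\<close>: in the
      variable \<open>exp (- x)\<close> they converge to the indicator of
      \<open>x < b\<close>.\<close>
    define h where "h n y = max 0 (min 1 (real n * (y - exp (- b))))" for n y
    have "(\<lambda>n. \<integral>x. h n (exp (- x)) * u x \<partial>lborel) \<longlonglongrightarrow> (\<integral>x. indicator {..<b} x * u x \<partial>lborel)"
    proof (rule integral_dominated_convergence[where w = "\<lambda>x. \<bar>u x\<bar>"])
      show "AE x in lborel. (\<lambda>n. h n (exp (- x)) * u x) \<longlonglongrightarrow> indicator {..<b} x * u x"
      proof (intro AE_I2 tendsto_mult tendsto_const)
        fix x
        show "(\<lambda>n. h n (exp (- x))) \<longlonglongrightarrow> indicator {..<b} x"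
        proof (cases "x < b")
          case True
          then have d: "exp (- x) - exp (- b) > 0" by simp
          obtain N :: nat where "real N * (exp (- x) - exp (- b)) \<ge> 1"
            using reals_Archimedean3[OF d, rule_format, of 1] less_imp_le by blast
          then have "real n * (exp (- x) - exp (- b)) \<ge> 1" if "n \<ge> N" for n
            using that d mult_right_mono[of "real N" "real n" "exp (- x) - exp (- b)"] by linarith
          then have "eventually (\<lambda>n. h n (exp (- x)) = 1) sequentially"
            unfolding eventually_sequentially h_def by (intro exI[of _ N]) simp
          then show ?thesis
            using True by (intro tendsto_eventually) simp
        next
          case False
          then have le: "real n * (exp (- x) - exp (- b)) \<le> 0" for n
            by (intro mult_nonneg_nonpos) auto
          have "h n (exp (- x)) = 0" for n
            unfolding h_def using le[of n] by linarith
          then show ?thesis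
            using False by simp
        qed
      qed
      show "AE x in lborel. norm (h n (exp (- x)) * u x) \<le> \<bar>u x\<bar>" for n
        by (intro AE_I2) (auto simp: h_def abs_mult intro!: mult_left_le_one_le)
      show "(\<lambda>x. h n (exp (- x)) * u x) \<in> borel_measurable lborel" for n
        unfolding h_def by measurable
    qed (use ui in auto)
    moreover have "(\<integral>x. h n (exp (- x)) * u x \<partial>lborel) = 0" for n
      by (rule cont[where C = 1]) (auto simp: h_def intro!: continuous_intros)
    ultimately show ?thesis
      by (simp add: LIMSEQ_const_iff)
  qed
  have "u x = 0" if x: "x > 0" for x
  proof -
    \<comment> \<open>Starting at \<open>x / 2\<close> keeps the interval inside
      \<open>{0<..}\<close>, where \<open>f\<close> is continuous.\<close>
    have uc: "continuous_on {x / 2..x + 1} u"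
      unfolding u_def using x by (intro continuous_intros continuous_on_subset[OF f(2)]) auto
    have "((\<lambda>y. integral {x / 2..y} u) has_real_derivative u x) (at x within {x / 2..x + 1})"
      by (rule integral_has_real_derivative[OF uc]) (use x in auto)
    then have D: "((\<lambda>y. integral {x / 2..y} u) has_real_derivative u x) (at x)"
      using x by (subst (asm) at_within_interior) (auto simp: interior_atLeastAtMost_real)
    have "integral {x / 2..y} u = 0" if "y \<in> {x / 2<..}" for y
    proof -
      have "integral {x / 2..y} u = (\<integral>t. indicator {x / 2..y} t * u t \<partial>lborel)"
        using set_borel_integral_eq_integral(2)[of "{x / 2..y}" u] integrable_mult_indicator[OF _ ui, of "{x / 2..y}"]
        by (simp add: set_integrable_def set_lebesgue_integral_def)
      also have "\<dots> = (\<integral>t. indicator {..<y} t * u t - indicator {..<x / 2} t * u t \<partial>lborel)"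
        using that by (intro integral_cong_AE AE_lborelI_except[of y])
          (auto simp: indicator_def)
      also have "\<dots> = 0"
        using half integrable_mult_indicator[OF _ ui] by simp
      finally show ?thesis .
    qed
    then have "((\<lambda>y. integral {x / 2..y} u) has_real_derivative 0) (at x)"
      using x by (subst DERIV_cong_ev[OF refl _ refl, where g = "\<lambda>_. 0"])
        (auto simp: eventually_nhds intro!: exI[of _ "{x / 2<..}"])
    then show ?thesis
      using D DERIV_unique by blast
  qed
  then have "u x = 0"
    using u0 by (cases "x > 0") auto
  then show ?thesis by (simp add: u_def)
qed

lemma laplace_inject:
  assumes f: "causal f" "continuous_on {0<..} f" "exp_integrable \<theta> f"
    and g: "causal g" "continuous_on {0<..} g" "exp_integrable \<theta> g"
    and eq: "\<And>\<theta>'. \<theta>' \<ge> \<theta> \<Longrightarrow> laplace f \<theta>' = laplace g \<theta>'"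
  shows "f = g"
proof
  fix x
  have "f x - g x = 0"
  proof (rule laplace_eq_0_imp_eq_0[where f = "\<lambda>x. f x - g x"])
    show "causal (\<lambda>x. f x - g x)"
      using f g by (simp add: causal_def)
    show "continuous_on {0<..} (\<lambda>x. f x - g x)"
      using f g by (intro continuous_intros)
    show "exp_integrable \<theta> (\<lambda>x. f x - g x)"
      using f g by (intro exp_integrable_diff)
    show "laplace (\<lambda>x. f x - g x) \<theta>' = 0" if "\<theta> \<le> \<theta>'" for \<theta>'
      using that f g eq exp_integrable_mono by (subst laplace_diff) auto
  qed
  then show "f x = g x" by simp
qed

section \<open>Neumann series\<close>

text \<open>Dominated convergence as \<theta> tends to \<infinity>: causality makes the weighted
  function shrink pointwise to 0.\<close>

lemma exp_integral_small:
  assumes "exp_integrable \<theta>\<^sub>0 f" "causal f" "e > 0"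
  shows "\<exists>\<theta>\<^sub>1\<ge>\<theta>\<^sub>0. \<forall>\<theta>\<ge>\<theta>\<^sub>1. (\<integral>x. \<bar>exp (- \<theta> * x) * f x\<bar> \<partial>lborel) < e"
proof -
  have [measurable]: "f \<in> borel_measurable borel"
    using assms borel_measurable_exp_integrable by blast
  have "((\<lambda>t. \<integral>x. \<bar>exp (- t * x) * f x\<bar> \<partial>lborel) \<longlongrightarrow> (\<integral>x. 0 \<partial>(lborel :: real measure))) at_top"
  proof (rule integral_dominated_convergence_at_top[where w = "\<lambda>x. \<bar>exp (- \<theta>\<^sub>0 * x) * f x\<bar>"])
    show "\<forall>\<^sub>F t in at_top. AE x in lborel. norm \<bar>exp (- t * x) * f x\<bar> \<le> \<bar>exp (- \<theta>\<^sub>0 * x) * f x\<bar>"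
      using eventually_ge_at_top[of \<theta>\<^sub>0]
    proof eventually_elim
      case (elim t)
      have "\<bar>exp (- t * x) * f x\<bar> \<le> \<bar>exp (- \<theta>\<^sub>0 * x) * f x\<bar>" for x
      proof (cases "x \<le> 0")
        case False
        then have "exp (- t * x) \<le> exp (- \<theta>\<^sub>0 * x)"
          using elim by simp
        then show ?thesis
          by (auto simp: abs_mult intro!: mult_right_mono)
      qed (use assms in \<open>simp add: causal_def\<close>)
      then show ?case by simp
    qed
    show "AE x in lborel. ((\<lambda>t. \<bar>exp (- t * x) * f x\<bar>) \<longlongrightarrow> 0) at_top"
    proof (rule AE_I2)
      fix x
      show "((\<lambda>t. \<bar>exp (- t * x) * f x\<bar>) \<longlongrightarrow> 0) at_top"
      proof (cases "x \<le> 0")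
        case False
        have "((\<lambda>t. exp (- (x * t))) \<longlongrightarrow> 0) at_top"
          using False
          by (intro filterlim_compose[OF exp_at_bot] filterlim_compose[OF filterlim_uminus_at_bot_at_top]
              filterlim_tendsto_pos_mult_at_top[OF tendsto_const] filterlim_ident) auto
        then have "((\<lambda>t. exp (- t * x)) \<longlongrightarrow> 0) at_top"
          by (simp add: mult.commute)
        then show ?thesis
          by (intro tendsto_rabs_zero tendsto_mult_left_zero)
      qed (use assms in \<open>simp add: causal_def\<close>)
    qed
    show "integrable lborel (\<lambda>x. \<bar>exp (- \<theta>\<^sub>0 * x) * f x\<bar>)"
      using assms by (simp add: exp_integrable_def)
  qed measurable
  then have "\<forall>\<^sub>F t in at_top. (\<integral>x. \<bar>exp (- t * x) * f x\<bar> \<partial>lborel) < e"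
    using assms(3) by (auto dest: order_tendstoD)
  then obtain N where "\<forall>t\<ge>N. (\<integral>x. \<bar>exp (- t * x) * f x\<bar> \<partial>lborel) < e"
    by (auto simp: eventually_at_top_linorder)
  then show ?thesis
    by (intro exI[of _ "max \<theta>\<^sub>0 N"]) auto
qed

text \<open>\<open>r\<close> is the sum of the convolution powers of \<kappa>; the zeroth power, a
  unit mass at 0, is represented by the summand 1 in \<open>1 + laplace r \<theta>\<close>. The
  series does not involve \<theta>, so one \<open>r\<close> serves all large \<theta>.\<close>

lemma neumann_series:
  assumes k: "exp_integrable \<theta>\<^sub>0 \<kappa>" "causal \<kappa>"
  shows "\<exists>r \<theta>\<^sub>1. \<theta>\<^sub>0 \<le> \<theta>\<^sub>1 \<and> causal r \<and>
    (\<forall>\<theta>\<ge>\<theta>\<^sub>1. exp_integrable \<theta> r \<and> (1 - laplace \<kappa> \<theta>) * (1 + laplace r \<theta>) = 1)"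
proof -
  obtain \<theta>\<^sub>1 where t1: "\<theta>\<^sub>0 \<le> \<theta>\<^sub>1"
    and small: "\<And>\<theta>. \<theta> \<ge> \<theta>\<^sub>1 \<Longrightarrow> (\<integral>x. \<bar>exp (- \<theta> * x) * \<kappa> x\<bar> \<partial>lborel) < 1 / 2"
    using exp_integral_small[OF k, of "1 / 2"] by auto
  \<comment> \<open>\<open>p n\<close> is the convolution power of order \<open>n + 1\<close>,
    whence the exponents \<open>Suc n\<close> below.\<close>
  define p where "p n = (conv \<kappa> ^^ n) \<kappa>" for n
  have p0: "p 0 = \<kappa>" and pS: "p (Suc n) = conv \<kappa> (p n)" for n
    by (simp_all add: p_def)
  have pc: "causal (p n)" for n
    by (induction n) (auto simp: p0 pS k causal_conv)
  \<comment> \<open>Where the series diverges, \<open>r x\<close> is a meaningless value of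
    \<open>suminf\<close>; this will concern a null set only. For \<open>x \<le> 0\<close> all terms
    vanish, so causality holds at every point.\<close>
  define r where "r x = (\<Sum>n. p n x)" for x
  have "causal r"
    using pc by (simp add: causal_def r_def)
  moreover have "exp_integrable \<theta> r \<and> (1 - laplace \<kappa> \<theta>) * (1 + laplace r \<theta>) = 1"
    if t: "\<theta> \<ge> \<theta>\<^sub>1" for \<theta>
  proof -
    have ki: "exp_integrable \<theta> \<kappa>"
      using k t t1 exp_integrable_mono by auto
    have pi: "exp_integrable \<theta> (p n)" for n
      by (induction n) (auto simp: p0 pS ki exp_integrable_conv)
    have pL: "laplace (p n) \<theta> = laplace \<kappa> \<theta> ^ Suc n" for n
      by (induction n) (auto simp: p0 pS ki pi laplace_conv)
    define s where "s n x = exp (- \<theta> * x) * p n x" for n x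
    have si: "integrable lborel (s n)" for n
      using pi[of n] by (simp add: s_def[abs_def] exp_integrable_def)
    have [measurable]: "s n \<in> borel_measurable borel" for n
      using si[of n] by (auto dest: borel_measurable_integrable)
    have sI: "(\<integral>x. \<bar>s n x\<bar> \<partial>lborel) \<le> (1 / 2) ^ Suc n" for n
    proof (induction n)
      case 0
      then show ?case using small[OF t] by (simp add: s_def p0)
    next
      case (Suc n)
      have "(\<integral>x. \<bar>s (Suc n) x\<bar> \<partial>lborel) \<le> (\<integral>x. \<bar>s 0 x\<bar> \<partial>lborel) * (\<integral>x. \<bar>s n x\<bar> \<partial>lborel)"
        using integral_abs_conv_le[OF si[of 0] si[of n]]
        unfolding s_def pS p0 exp_times_conv .
      also have "\<dots> \<le> (1 / 2) * (1 / 2) ^ Suc n"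
        using small[OF t] Suc by (intro mult_mono) (auto simp: s_def p0)
      finally show ?case by simp
    qed
    have half: "summable (\<lambda>n. (1 / 2 :: real) ^ Suc n)"
      by (rule summable_Suc_iff[THEN iffD2]) (simp add: summable_geometric)
    \<comment> \<open>Exchanging sum and integral for nonnegative terms gives absolute convergence
      almost everywhere.\<close>
    have "(\<integral>\<^sup>+x. (\<Sum>n. ennreal \<bar>s n x\<bar>) \<partial>lborel) = (\<Sum>n. \<integral>\<^sup>+x. ennreal \<bar>s n x\<bar> \<partial>lborel)"
      by (rule nn_integral_suminf) measurable
    also have "\<dots> \<le> (\<Sum>n. ennreal ((1 / 2) ^ Suc n))"
      using sI si by (intro suminf_le summableI) (auto simp: nn_integral_eq_integral)
    also have "\<dots> = ennreal (\<Sum>n. (1 / 2) ^ Suc n)"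
      by (rule suminf_ennreal2[OF _ half]) simp
    also have "\<dots> < \<infinity>"
      by simp
    finally have "AE x in lborel. (\<Sum>n. ennreal \<bar>s n x\<bar>) \<noteq> \<infinity>"
      by (intro nn_integral_PInf_AE) auto
    then have AEs: "AE x in lborel. summable (\<lambda>n. norm (s n x))"
      by eventually_elim (auto intro!: summable_suminf_not_top simp: infinity_ennreal_def)
    have ssum: "summable (\<lambda>n. \<integral>x. norm (s n x) \<partial>lborel)"
    proof (rule summable_comparison_test')
      show "summable (\<lambda>n. (1 / 2 :: real) ^ Suc n)"
        by (rule half)
      show "norm (\<integral>x. norm (s n x) \<partial>lborel) \<le> (1 / 2) ^ Suc n" for n
        using sI[of n] by simp
    qed
    have rs: "AE x in lborel. (\<Sum>n. s n x) = exp (- \<theta> * x) * r x"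
      using AEs
    proof eventually_elim
      case (elim x)
      have "summable (\<lambda>n. exp (\<theta> * x) * s n x)"
        using summable_norm_cancel[OF elim] by (rule summable_mult)
      then have "summable (\<lambda>n. p n x)"
        by (simp add: s_def mult.assoc[symmetric] exp_add[symmetric])
      then show ?case
        unfolding s_def r_def by (rule suminf_mult)
    qed
    have rm: "r \<in> borel_measurable borel"
      unfolding r_def[abs_def]
      using borel_measurable_exp_integrable[OF pi] by measurable
    have ri: "integrable lborel (\<lambda>x. exp (- \<theta> * x) * r x)"
      by (rule integrable_cong_AE_imp[OF integrable_suminf[OF si AEs ssum]])
         (use rs rm in auto)
    have "(\<lambda>n. laplace \<kappa> \<theta> ^ Suc n) sums (\<integral>x. (\<Sum>n. s n x) \<partial>lborel)"
      using sums_integral[OF si AEs ssum] pL by (simp add: laplace_def s_def)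
    also have "(\<integral>x. (\<Sum>n. s n x) \<partial>lborel) = laplace r \<theta>"
      unfolding laplace_def using rs rm by (intro integral_cong_AE) auto
    finally have 1: "(\<lambda>n. laplace \<kappa> \<theta> ^ Suc n) sums laplace r \<theta>" .
    have "\<bar>laplace \<kappa> \<theta>\<bar> \<le> (\<integral>x. \<bar>exp (- \<theta> * x) * \<kappa> x\<bar> \<partial>lborel)"
      unfolding laplace_def by (rule integral_abs_bound)
    with small[OF t] have L: "\<bar>laplace \<kappa> \<theta>\<bar> < 1"
      by linarith
    then have "(\<lambda>n. laplace \<kappa> \<theta> * laplace \<kappa> \<theta> ^ n) sums (laplace \<kappa> \<theta> * (1 / (1 - laplace \<kappa> \<theta>)))"
      by (intro sums_mult geometric_sums) auto
    with 1 have "laplace r \<theta> = laplace \<kappa> \<theta> / (1 - laplace \<kappa> \<theta>)"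
      using sums_unique2 by force
    then show ?thesis
      using ri L by (auto simp: exp_integrable_def field_simps)
  qed
  ultimately show ?thesis
    using t1 by blast
qed

section \<open>Convolutions with locally integrable causal kernels\<close>

definition trunc :: "real \<Rightarrow> (real \<Rightarrow> real) \<Rightarrow> real \<Rightarrow> real" where
  "trunc R f x = indicator {..R} x * f x"

text \<open>Only the right end is cut off, since the functions concerned vanish to the left of some
  point; integrability at \<open>-\<infinity>\<close> is thus included.\<close>

definition loc_integrable :: "(real \<Rightarrow> real) \<Rightarrow> bool" where
  "loc_integrable f \<longleftrightarrow> (\<forall>R. integrable lborel (trunc R f))"

lemma exp_integrable_imp_loc_integrable:
  "exp_integrable \<theta> f \<Longrightarrow> causal f \<Longrightarrow> loc_integrable f"
  unfolding loc_integrable_def trunc_def[abs_def] using exp_integrable_cutoff by blast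

lemma causal_trunc: "causal f \<Longrightarrow> causal (trunc R f)"
  by (simp add: causal_def trunc_def)

lemma primitive_trunc: "x \<le> R \<Longrightarrow> primitive (trunc R f) x = primitive f x"
  unfolding primitive_def by (intro set_lebesgue_integral_cong) (auto simp: trunc_def)

lemma loc_integrableI_bounded:
  assumes [measurable]: "g \<in> borel_measurable borel"
    and zero: "\<And>x. x < a \<Longrightarrow> g x = 0"
    and bd: "\<And>R. \<exists>B. \<forall>x\<le>R. \<bar>g x\<bar> \<le> B"
  shows "loc_integrable g"
  unfolding loc_integrable_def
proof
  fix R
  obtain B where B: "\<And>x. x \<le> R \<Longrightarrow> \<bar>g x\<bar> \<le> B"
    using bd[of R] by blast
  show "integrable lborel (trunc R g)"
  proof (rule Bochner_Integration.integrable_bound)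
    show "integrable lborel (\<lambda>x. indicator {a..R} x * B)"
      by (intro integrable_mult_left integrable_real_indicator) (auto simp: emeasure_lborel_Icc_eq)
    show "AE x in lborel. norm (trunc R g x) \<le> norm (indicator {a..R} x * B)"
    proof (rule AE_I2)
      fix x
      show "norm (trunc R g x) \<le> norm (indicator {a..R} x * B)"
        using zero[of x] B[of x] by (cases "x < a") (auto simp: trunc_def indicator_def)
    qed
  qed (simp add: trunc_def[abs_def])
qed

text \<open>The integrand lives on \<open>a \<le> y < x\<close>, where
  \<open>x - y \<le> R - a\<close>. Facts about L1 kernels thereby become available for locally
  integrable ones.\<close>

lemma conv_trunc:
  assumes "causal f" "\<And>x. x < a \<Longrightarrow> g x = 0" "x \<le> R"
  shows "conv f g x = conv (trunc (R - a) f) (trunc R g) x"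
proof -
  have "f (x - y) * g y = trunc (R - a) f (x - y) * trunc R g y" for y
    using assms unfolding causal_def trunc_def
    by (cases "y < a"; cases "x - y \<le> 0") (auto simp: indicator_def)
  then show ?thesis
    by (simp add: conv_def)
qed

section \<open>Continuity and differentiability of convolutions with causal kernels\<close>

lemma primitive_has_real_derivative:
  assumes f: "integrable lborel f" and c: "isCont f x"
  shows "(primitive f has_real_derivative f x) (at x)"
proof -
  have si: "set_integrable lborel S f" if "S \<in> sets borel" for S
    using integrable_mult_indicator[OF _ f] that by (simp add: set_integrable_def)
  have "((\<lambda>u. integral {x - 1..u} f) has_vector_derivative f x) (at x within ({x - 1..x + 1} - {}))"
    using c set_borel_integral_eq_integral(1)[OF si]
    by (intro integral_has_vector_derivative_continuous_at) (auto intro: continuous_at_imp_continuous_at_within)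
  then have "((\<lambda>u. integral {x - 1..u} f) has_real_derivative f x) (at x)"
    by (subst (asm) Diff_empty, subst (asm) at_within_interior)
       (auto simp: interior_atLeastAtMost_real has_real_derivative_iff_has_vector_derivative)
  then have "((\<lambda>u. primitive f (x - 1) + integral {x - 1..u} f) has_real_derivative f x) (at x)"
    by (auto intro!: derivative_eq_intros)
  moreover have "primitive f u = primitive f (x - 1) + integral {x - 1..u} f" if "u \<in> {x - 1<..}" for u
  proof -
    have "integral {x - 1..u} f = (LBINT t:{x - 1..u}. f t)"
      using set_borel_integral_eq_integral(2)[OF si] by simp
    also have "\<dots> = (LBINT t:{x - 1..<u}. f t)"
      unfolding set_lebesgue_integral_def
      using f borel_measurable_integrable[OF f]
      by (intro integral_cong_AE AE_lborelI_except[of u]) (auto simp: indicator_def)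
    finally have "primitive f (x - 1) + integral {x - 1..u} f = (LBINT t:{..<x - 1} \<union> {x - 1..<u}. f t)"
      unfolding primitive_def by (subst set_integral_Un) (auto intro: si)
    also have "{..<x - 1} \<union> {x - 1..<u} = {..<u}"
      using that by auto
    finally show ?thesis
      by (simp add: primitive_def)
  qed
  ultimately show ?thesis
    by (subst DERIV_cong_ev[OF refl _ refl, where g = "\<lambda>u. primitive f (x - 1) + integral {x - 1..u} f"])
       (auto simp: eventually_nhds intro!: exI[of _ "{x - 1<..}"])
qed

lemma abs_primitive_le:
  assumes "integrable lborel f"
  shows "\<bar>primitive f x\<bar> \<le> (\<integral>x. \<bar>f x\<bar> \<partial>lborel)"
proof -
  have "\<bar>primitive f x\<bar> \<le> (\<integral>t. \<bar>indicator {..<x} t * f t\<bar> \<partial>lborel)"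
    unfolding primitive_def set_lebesgue_integral_def real_scaleR_def by (rule integral_abs_bound)
  also have "\<dots> \<le> (\<integral>x. \<bar>f x\<bar> \<partial>lborel)"
    using assms integrable_mult_indicator[OF _ assms, of "{..<x}"]
    by (intro integral_mono) (auto simp: indicator_def)
  finally show ?thesis .
qed

locale kernel_convolution =
  fixes v g :: "real \<Rightarrow> real" and a :: real
  assumes v: "causal v" "loc_integrable v"
    and g: "g \<in> borel_measurable borel" "\<And>x. x < a \<Longrightarrow> g x = 0" "\<And>R. \<exists>B. \<forall>x\<le>R. \<bar>g x\<bar> \<le> B"
begin

lemma loc_integrable_g: "loc_integrable g"
  using loc_integrableI_bounded g by blast

lemma isCont_conv: "isCont (conv v g) x"
proof -
  obtain B where B: "\<And>y. y \<le> x + 1 \<Longrightarrow> \<bar>g y\<bar> \<le> B"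
    using g(3)[of "x + 1"] by blast
  have [measurable]: "g \<in> borel_measurable borel"
    by (rule g)
  have "continuous_on UNIV (conv (trunc (x + 1 - a) v) (trunc (x + 1) g))"
  proof (rule continuous_on_conv)
    show "integrable lborel (trunc (x + 1 - a) v)"
      using v by (simp add: loc_integrable_def)
    show "trunc (x + 1) g \<in> borel_measurable borel"
      unfolding trunc_def[abs_def] by measurable
    show "\<bar>trunc (x + 1) g y\<bar> \<le> \<bar>B\<bar>" for y
      using B[of y] by (auto simp: trunc_def indicator_def)
  qed
  then have "isCont (conv (trunc (x + 1 - a) v) (trunc (x + 1) g)) x"
    by (simp add: continuous_on_eq_continuous_at)
  moreover have "eventually (\<lambda>y. conv v g y = conv (trunc (x + 1 - a) v) (trunc (x + 1) g) y) (nhds x)"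
    using conv_trunc[OF v(1) g(2)] unfolding eventually_nhds
    by (intro exI[of _ "{..<x + 1}"]) auto
  ultimately show ?thesis
    using isCont_cong by fast
qed

text \<open>\<open>W\<close> is a jump of height \<open>c\<close> at 0 plus an absolutely continuous
  part, so the convolution is locally the primitive of \<open>c * g + conv v g\<close>. The second
  summand is continuous anyway; a discontinuity of \<open>g\<close> can only enter through
  \<open>c\<close>.\<close>

lemma conv_has_real_derivative:
  assumes W: "causal W" "\<And>x. x > 0 \<Longrightarrow> W x = c + primitive v x"
    and cont: "c = 0 \<or> isCont g x"
  shows "(conv W g has_real_derivative c * g x + conv v g x) (at x)"
proof -
  define R where "R = x + 1"
  define v' where "v' = trunc (R - a) v"
  define g' where "g' = trunc R g"
  have v': "integrable lborel v'" "causal v'" and g': "integrable lborel g'"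
    using v loc_integrable_g by (auto simp: loc_integrable_def v'_def g'_def causal_trunc)
  have eq: "conv W g y = primitive (\<lambda>u. c * g' u + conv v' g' u) y" if "y < R" for y
  proof -
    have "conv W g y = conv (trunc (R - a) W) g' y"
      unfolding g'_def using that by (intro conv_trunc W g) auto
    also have "\<dots> = (\<integral>z. c * (heaviside (y - z) * g' z) + primitive v' (y - z) * g' z \<partial>lborel)"
      unfolding conv_def
    proof (rule Bochner_Integration.integral_cong[OF refl])
      fix z
      show "trunc (R - a) W (y - z) * g' z = c * (heaviside (y - z) * g' z) + primitive v' (y - z) * g' z"
      proof (cases "y - z \<le> 0 \<or> z < a")
        case True
        then show ?thesis
          using W(1) causal_primitive[OF v'(2)] g(2)[of z]
          by (auto simp: trunc_def heaviside_def g'_def causal_def)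
      next
        case False
        then show ?thesis
          using that W(2)[of "y - z"] primitive_trunc[of "y - z" "R - a" v]
          by (auto simp: trunc_def heaviside_def v'_def distrib_right)
      qed
    qed
    also have "\<dots> = c * (\<integral>z. heaviside (y - z) * g' z \<partial>lborel) + (\<integral>z. primitive v' (y - z) * g' z \<partial>lborel)"
    proof -
      have "integrable lborel (\<lambda>z. g' z * heaviside (y - z))"
        by (rule integrable_mult_bounded[OF g', where B = 1]) (auto simp: heaviside_def)
      moreover have "integrable lborel (\<lambda>z. g' z * primitive v' (y - z))"
      proof (rule integrable_mult_bounded[OF g'])
        have "primitive v' \<in> borel_measurable borel"
          using continuous_on_primitive[OF v'(1)] borel_measurable_continuous_onI by blast
        then show "(\<lambda>z. primitive v' (y - z)) \<in> borel_measurable borel"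
          by measurable
      qed (rule abs_primitive_le[OF v'(1)])
      ultimately show ?thesis
        by (simp add: mult.commute)
    qed
    also have "\<dots> = c * primitive g' y + primitive (conv v' g') y"
      using conv_primitive[OF v'(1) g', of y] by (simp add: primitive_eq_conv[of g'] conv_def)
    also have "\<dots> = primitive (\<lambda>u. c * g' u + conv v' g' u) y"
    proof -
      have "set_integrable lborel {..<y} g'" "set_integrable lborel {..<y} (conv v' g')"
        using integrable_mult_indicator[OF _ g'] integrable_mult_indicator[OF _ integrable_conv[OF v'(1) g']]
        by (auto simp: set_integrable_def)
      then show ?thesis
        by (simp add: primitive_def set_integral_add)
    qed
    finally show ?thesis .
  qed
  have nh: "eventually (\<lambda>y. y < R) (nhds x)"
    unfolding R_def by (intro eventually_nhds_in_open[of "{..<x + 1}", simplified]) auto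
  have gx: "conv v' g' x = conv v g x" "g' x = g x"
    using conv_trunc[OF v(1) g(2), where x = x and R = R] by (auto simp: v'_def g'_def R_def trunc_def)
  have "eventually (\<lambda>y. conv v g y = conv v' g' y) (nhds x)"
    using nh by eventually_elim (simp add: v'_def g'_def conv_trunc[OF v(1) g(2)])
  then have "isCont (conv v' g') x"
    using isCont_conv[of x] isCont_cong by fast
  moreover have "c = 0 \<or> isCont g' x"
  proof -
    have "eventually (\<lambda>y. g y = g' y) (nhds x)"
      using nh by eventually_elim (simp add: g'_def trunc_def)
    then show ?thesis
      using cont isCont_cong by fast
  qed
  ultimately have "isCont (\<lambda>u. c * g' u + conv v' g' u) x"
    by (cases "c = 0") (auto intro!: continuous_intros)
  then have "(primitive (\<lambda>u. c * g' u + conv v' g' u) has_real_derivative c * g' x + conv v' g' x) (at x)"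
    using g' v' by (intro primitive_has_real_derivative) (auto intro: integrable_conv)
  then show ?thesis
    unfolding gx
    using nh eq by (subst DERIV_cong_ev[OF refl _ refl]) (auto elim: eventually_mono)
qed

end

section \<open>The Laplace exponent\<close>

locale levy_measure =
  fixes \<nu> :: "real measure"
  assumes levy: "levy_measure_on_pos \<nu>"
begin

lemma sets_nu[measurable_cong]: "sets \<nu> = sets borel"
  using levy by (simp add: levy_measure_on_pos_def)

sublocale sigma_finite_measure \<nu>
  using levy by (simp add: levy_measure_on_pos_def)

sublocale pair_sigma_finite \<nu> lborel ..

lemma AE_pos: "AE z in \<nu>. z > 0"
proof (rule AE_I[where N = "{..0}"])
  show "emeasure \<nu> {..0} = 0" "{..0} \<in> sets \<nu>"
    using levy by (auto simp: levy_measure_on_pos_def sets_nu)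
qed auto

lemma integrable_min_sq: "integrable \<nu> (\<lambda>z. min 1 (z\<^sup>2))"
proof (rule integrableI_bounded)
  show "(\<integral>\<^sup>+ z. ennreal (norm (min 1 (z\<^sup>2))) \<partial>\<nu>) < \<infinity>"
    using levy by (simp add: levy_measure_on_pos_def)
qed measurable

lemma integrable_bound_min_sq:
  assumes [measurable]: "f \<in> borel_measurable borel"
    and "\<And>z. 0 < z \<Longrightarrow> \<bar>f z\<bar> \<le> C * min 1 (z\<^sup>2)"
  shows "integrable \<nu> f"
proof (rule Bochner_Integration.integrable_bound)
  show "integrable \<nu> (\<lambda>z. C * min 1 (z\<^sup>2))"
    using integrable_min_sq by simp
  show "AE z in \<nu>. norm (f z) \<le> norm (C * min 1 (z\<^sup>2))"
    using AE_pos
  proof eventually_elim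
    case (elim z)
    show ?case
      using assms(2)[OF elim] by (metis abs_ge_self order_trans real_norm_def)
  qed
qed measurable

text \<open>Fubini for a mixture over \<nu>; what has to be integrable over \<nu> are the weighted
  L1 norms of the components.\<close>

lemma
  assumes m[measurable]: "case_prod m \<in> borel_measurable (borel \<Otimes>\<^sub>M borel)"
    and i1: "\<And>z. exp_integrable \<theta> (m z)"
    and i2: "integrable \<nu> (\<lambda>z. \<integral>x. \<bar>exp (- \<theta> * x) * m z x\<bar> \<partial>lborel)"
  shows exp_integrable_mixture: "exp_integrable \<theta> (\<lambda>x. \<integral>z. m z x \<partial>\<nu>)"
    and laplace_mixture: "laplace (\<lambda>x. \<integral>z. m z x \<partial>\<nu>) \<theta> = (\<integral>z. laplace (m z) \<theta> \<partial>\<nu>)"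
proof -
  have p: "integrable (\<nu> \<Otimes>\<^sub>M lborel) (\<lambda>(z, x). exp (- \<theta> * x) * m z x)"
  proof (rule Fubini_integrable)
    show "(\<lambda>(z, x). exp (- \<theta> * x) * m z x) \<in> borel_measurable (\<nu> \<Otimes>\<^sub>M lborel)"
      by measurable
  qed (use i1 i2 in \<open>auto simp: exp_integrable_def\<close>)
  have *: "exp (- \<theta> * x) * (\<integral>z. m z x \<partial>\<nu>) = (\<integral>z. exp (- \<theta> * x) * m z x \<partial>\<nu>)" for x
    by (simp only: integral_mult_right_zero)
  show "exp_integrable \<theta> (\<lambda>x. \<integral>z. m z x \<partial>\<nu>)"
    unfolding exp_integrable_def * by (rule integrable_snd[OF p])
  show "laplace (\<lambda>x. \<integral>z. m z x \<partial>\<nu>) \<theta> = (\<integral>z. laplace (m z) \<theta> \<partial>\<nu>)"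
    unfolding laplace_def * by (rule Fubini_integral[OF p])
qed

end

section \<open>The jump part of the exponent as a Laplace transform\<close>

lemma
  assumes "\<theta> > 0" "z > 0"
  shows exp_integrable_interval: "exp_integrable \<theta> (indicator {0<..z})"
    and laplace_interval: "laplace (indicator {0<..z}) \<theta> = (1 - exp (- \<theta> * z)) / \<theta>"
proof -
  have "exp (- \<theta> * x) = exp (- \<theta> * z) * exp (- \<theta> * (x - z))" for x
    by (simp add: exp_add[symmetric] algebra_simps)
  then have *: "exp (- \<theta> * x) * heaviside (x - z) = exp (- \<theta> * z) * (exp (- \<theta> * (x - z)) * heaviside (x - z))" for x
    by (metis mult.assoc)
  have h: "integrable lborel (\<lambda>x. exp (- \<theta> * x) * heaviside x)"
    using exp_integrable_heaviside[OF assms(1)] by (simp add: exp_integrable_def)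
  have "exp_integrable \<theta> (\<lambda>x. heaviside (x - z))"
    unfolding exp_integrable_def * by (intro integrable_mult_right integrable_translate[OF h])
  moreover have "laplace (\<lambda>x. heaviside (x - z)) \<theta> = exp (- \<theta> * z) / \<theta>"
  proof -
    have "laplace (\<lambda>x. heaviside (x - z)) \<theta> =
        exp (- \<theta> * z) * (\<integral>x. exp (- \<theta> * (x - z)) * heaviside (x - z) \<partial>lborel)"
      unfolding laplace_def * by (rule integral_mult_right_zero)
    also have "(\<integral>x. exp (- \<theta> * (x - z)) * heaviside (x - z) \<partial>lborel) = laplace heaviside \<theta>"
      unfolding laplace_def by (rule integral_translate)
    finally show ?thesis
      using assms by (simp add: laplace_heaviside)
  qed
  moreover have "indicator {0<..z} = (\<lambda>x. heaviside x - heaviside (x - z))"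
    using assms by (auto simp: heaviside_def indicator_def fun_eq_iff)
  ultimately show "exp_integrable \<theta> (indicator {0<..z})"
    "laplace (indicator {0<..z}) \<theta> = (1 - exp (- \<theta> * z)) / \<theta>"
    using exp_integrable_heaviside laplace_heaviside assms
    by (auto simp: laplace_diff diff_divide_distrib intro!: exp_integrable_diff)
qed

lemma primitive_interval:
  assumes "z > 0"
  shows "primitive (indicator {0<..z}) x = heaviside x * min x z"
proof -
  have "primitive (indicator {0<..z}) x = measure lborel ({0<..z} \<inter> {..<x})"
    by (simp add: primitive_def set_lebesgue_integral_def indicator_inter_arith[symmetric] Int_commute)
  also have "{0<..z} \<inter> {..<x} = (if x \<le> z then {0<..<x} else {0<..z})"
    using assms by auto
  finally show ?thesis
    using assms by (cases "x \<le> 0") (auto simp: heaviside_def min_def)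
qed

lemma exp_minus_le_quadratic:
  fixes t :: real
  assumes "t \<ge> 0"
  shows "exp (- t) - 1 + t \<le> t\<^sup>2 / 2"
proof -
  define f where "f t = t\<^sup>2 / 2 - (exp (- t) - 1 + t)" for t :: real
  have "f 0 \<le> f t"
  proof (rule DERIV_nonneg_imp_nondecreasing[OF assms])
    fix x :: real assume "0 \<le> x"
    have "(f has_real_derivative x + exp (- x) - 1) (at x)"
      unfolding f_def by (auto intro!: derivative_eq_intros)
    moreover have "x + exp (- x) - 1 \<ge> 0"
      using exp_ge_add_one_self[of "- x"] by simp
    ultimately show "\<exists>y. (f has_real_derivative y) (at x) \<and> 0 \<le> y"
      by blast
  qed
  then show ?thesis
    by (simp add: f_def)
qed

definition jump_exponent :: "real \<Rightarrow> real \<Rightarrow> real" where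
  "jump_exponent \<theta> z = indicator {0<..} z * (exp (- \<theta> * z) - 1 + \<theta> * z * indicator {0<..1} z)"

lemma borel_measurable_jump_exponent[measurable]: "jump_exponent \<theta> \<in> borel_measurable borel"
  unfolding jump_exponent_def[abs_def] by measurable

lemma laplace_exponent_eq:
  "laplace_exponent \<gamma> \<sigma> \<nu> \<theta> = \<gamma> * \<theta> + \<sigma>\<^sup>2 * \<theta>\<^sup>2 / 2 + (\<integral>z. jump_exponent \<theta> z \<partial>\<nu>)"
  by (simp add: laplace_exponent_def jump_exponent_def[abs_def] set_lebesgue_integral_def)

lemma jump_exponent_nonneg: "\<theta> \<ge> 0 \<Longrightarrow> z \<le> 1 \<Longrightarrow> jump_exponent \<theta> z \<ge> 0"
  using exp_ge_add_one_self[of "- \<theta> * z"] by (auto simp: jump_exponent_def indicator_def)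

text \<open>Only the uncompensated jumps \<open>z > 1\<close> can contribute negatively, and then by
  at most 1.\<close>

lemma jump_exponent_ge: "\<theta> \<ge> 0 \<Longrightarrow> jump_exponent \<theta> z \<ge> - indicator {1<..} z"
  using jump_exponent_nonneg[of \<theta> z] by (auto simp: jump_exponent_def indicator_def)

lemma abs_jump_exponent_le:
  assumes "\<theta> \<ge> 0" "z > 0"
  shows "\<bar>jump_exponent \<theta> z\<bar> \<le> max 1 (\<theta>\<^sup>2 / 2) * min 1 (z\<^sup>2)"
proof (cases "z \<le> 1")
  case True
  have "jump_exponent \<theta> z \<le> (\<theta> * z)\<^sup>2 / 2"
    using exp_minus_le_quadratic[of "\<theta> * z"] assms True by (simp add: jump_exponent_def)
  also have "\<dots> = \<theta>\<^sup>2 / 2 * z\<^sup>2"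
    by (simp add: power_mult_distrib)
  also have "\<dots> \<le> max 1 (\<theta>\<^sup>2 / 2) * z\<^sup>2"
    by (intro mult_right_mono) auto
  also have "z\<^sup>2 = min 1 (z\<^sup>2)"
    using True assms by (simp add: power_le_one)
  finally show ?thesis
    using jump_exponent_nonneg[OF assms(1) True] by simp
next
  case False
  then have "\<bar>jump_exponent \<theta> z\<bar> \<le> 1"
    using assms by (auto simp: jump_exponent_def indicator_def)
  moreover have "min 1 (z\<^sup>2) = 1"
    using False one_le_power[of z 2] by (simp add: min_absorb1)
  ultimately show ?thesis by simp
qed

context levy_measure
begin

lemma integrable_jump_exponent: "\<theta> \<ge> 0 \<Longrightarrow> integrable \<nu> (jump_exponent \<theta>)"
  using abs_jump_exponent_le by (intro integrable_bound_min_sq) auto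

text \<open>Integrating by parts twice: \<open>exp (- \<theta> * z) - 1 + \<theta> * z\<close> is \<open>\<theta>\<^sup>2\<close> times the Laplace transform
  of \<open>z - min x z\<close>.\<close>

definition double_tail :: "real \<Rightarrow> real" where
  "double_tail x = (\<integral>z. indicator {0<..} z * (heaviside x * (z * indicator {0<..1} z - min x z)) \<partial>\<nu>)"

lemma causal_double_tail: "causal double_tail"
  by (simp add: causal_def double_tail_def heaviside_def)

lemma
  assumes t: "\<theta> > 0"
  shows exp_integrable_double_tail: "exp_integrable \<theta> double_tail"
    and laplace_double_tail: "laplace double_tail \<theta> = (\<integral>z. jump_exponent \<theta> z \<partial>\<nu>) / \<theta>\<^sup>2"
proof -
  define m where "m z x = indicator {0<..} z * (heaviside x * (z * indicator {0<..1} z - min x z))" for z x :: real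
  have mm: "case_prod m \<in> borel_measurable (borel \<Otimes>\<^sub>M borel)"
    unfolding m_def heaviside_def by measurable
  have m: "exp_integrable \<theta> (m z) \<and> laplace (m z) \<theta> = jump_exponent \<theta> z / \<theta>\<^sup>2" for z
  proof (cases "z > 0")
    case True
    have "m z = (\<lambda>x. (z * indicator {0<..1} z) * heaviside x - primitive (indicator {0<..z}) x)"
      using True by (auto simp: m_def primitive_interval algebra_simps)
    moreover have "exp_integrable \<theta> (\<lambda>x. (z * indicator {0<..1} z) * heaviside x)"
      "exp_integrable \<theta> (primitive (indicator {0<..z}))"
      using True t by (auto intro!: exp_integrable_cmult exp_integrable_heaviside exp_integrable_primitive exp_integrable_interval)
    moreover have "(z * indicator {0<..1} z) * (1 / \<theta>) - (1 - exp (- \<theta> * z)) / \<theta> / \<theta> = jump_exponent \<theta> z / \<theta>\<^sup>2"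
      using True t by (simp add: jump_exponent_def field_simps power2_eq_square)
    ultimately show ?thesis
      using True t by (simp add: exp_integrable_diff laplace_diff laplace_cmult laplace_primitive
          exp_integrable_interval laplace_heaviside laplace_interval)
  qed (simp add: m_def[abs_def] exp_integrable_def laplace_def jump_exponent_def)
  \<comment> \<open>Each \<open>m z\<close> has constant sign, nonnegative for
    \<open>z \<le> 1\<close> and nonpositive for \<open>z > 1\<close>, so its weighted L1 norm is
    the absolute value of its transform.\<close>
  have "(\<integral>x. \<bar>exp (- \<theta> * x) * m z x\<bar> \<partial>lborel) = \<bar>jump_exponent \<theta> z / \<theta>\<^sup>2\<bar>" for z
  proof (cases "z \<le> 1")
    case True
    then have "m z x \<ge> 0" for x
      by (auto simp: m_def indicator_def heaviside_def)
    then show ?thesis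
      using m[of z] jump_exponent_nonneg[OF _ True, of \<theta>] t by (simp add: laplace_def abs_mult)
  next
    case False
    then have neg: "m z x \<le> 0" for x
      by (auto simp: m_def indicator_def heaviside_def)
    then have "(\<integral>x. \<bar>exp (- \<theta> * x) * m z x\<bar> \<partial>lborel) = - laplace (m z) \<theta>"
      unfolding laplace_def by (simp add: abs_mult abs_of_nonpos)
    moreover have "jump_exponent \<theta> z \<le> 0"
      using False t by (simp add: jump_exponent_def)
    ultimately show ?thesis
      using m[of z] t by (simp add: abs_of_nonpos)
  qed
  then have i2: "integrable \<nu> (\<lambda>z. \<integral>x. \<bar>exp (- \<theta> * x) * m z x\<bar> \<partial>lborel)"
    using integrable_jump_exponent t by simp
  have "double_tail = (\<lambda>x. \<integral>z. m z x \<partial>\<nu>)"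
    by (simp add: double_tail_def[abs_def] m_def)
  then show "exp_integrable \<theta> double_tail" "laplace double_tail \<theta> = (\<integral>z. jump_exponent \<theta> z \<partial>\<nu>) / \<theta>\<^sup>2"
    using exp_integrable_mixture[OF mm _ i2] laplace_mixture[OF mm _ i2] m by auto
qed

text \<open>For \<open>x > 0\<close> this is the mass that \<nu> gives to [x, \<infinity>), written
  as a mixture of indicators of intervals.\<close>

definition tail :: "real \<Rightarrow> real" where
  "tail x = (\<integral>z. indicator {0<..} z * indicator {0<..z} x \<partial>\<nu>)"

lemma causal_tail: "causal tail"
  by (simp add: causal_def tail_def)

text \<open>A single integration by parts: \<open>1 - exp (- \<theta> * z)\<close> is \<theta> times
  the transform of the indicator of \<open>{0<..z}\<close>. Undoing the compensation leaves the
  first moment of the small jumps as a drift.\<close>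

lemma
  assumes t: "\<theta> > 0" and small: "integrable \<nu> (\<lambda>z. indicator {0<..1} z * z)"
  shows exp_integrable_tail: "exp_integrable \<theta> tail"
    and laplace_tail: "(\<integral>z. jump_exponent \<theta> z \<partial>\<nu>) = \<theta> * ((\<integral>z. indicator {0<..1} z * z \<partial>\<nu>) - laplace tail \<theta>)"
proof -
  define m where "m z x = (indicator {0<..} z * indicator {0<..z} x :: real)" for z x :: real
  have m_eq: "m z x = (if 0 < z \<and> 0 < x \<and> x \<le> z then 1 else 0)" for z x
    by (auto simp: m_def)
  have mm: "case_prod m \<in> borel_measurable (borel \<Otimes>\<^sub>M borel)"
    unfolding m_eq by measurable
  have jump: "(\<theta> * (indicator {0<..1} z * z) - jump_exponent \<theta> z) / \<theta> = indicator {0<..} z * ((1 - exp (- \<theta> * z)) / \<theta>)" for z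
    using t by (auto simp: jump_exponent_def indicator_def field_simps)
  have m: "exp_integrable \<theta> (m z) \<and> laplace (m z) \<theta> = (\<theta> * (indicator {0<..1} z * z) - jump_exponent \<theta> z) / \<theta>" for z
    unfolding jump
  proof (cases "z > 0")
    case True
    then have "m z = indicator {0<..z}"
      by (auto simp: m_def)
    then show "exp_integrable \<theta> (m z) \<and> laplace (m z) \<theta> = indicator {0<..} z * ((1 - exp (- \<theta> * z)) / \<theta>)"
      using True t exp_integrable_interval laplace_interval by simp
  qed (simp add: m_def[abs_def] exp_integrable_def laplace_def)
  have i: "integrable \<nu> (\<lambda>z. (\<theta> * (indicator {0<..1} z * z) - jump_exponent \<theta> z) / \<theta>)"
    using small integrable_jump_exponent t by (intro integrable_divide Bochner_Integration.integrable_diff integrable_mult_right) auto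
  have "\<bar>exp (- \<theta> * x) * m z x\<bar> = exp (- \<theta> * x) * m z x" for z x
    by (simp add: m_eq)
  then have "(\<integral>x. \<bar>exp (- \<theta> * x) * m z x\<bar> \<partial>lborel) = laplace (m z) \<theta>" for z
    by (simp add: laplace_def)
  then have i2: "integrable \<nu> (\<lambda>z. \<integral>x. \<bar>exp (- \<theta> * x) * m z x\<bar> \<partial>lborel)"
    using i m by simp
  have eq: "tail = (\<lambda>x. \<integral>z. m z x \<partial>\<nu>)"
    by (simp add: tail_def[abs_def] m_def)
  show "exp_integrable \<theta> tail"
    using exp_integrable_mixture[OF mm _ i2] m eq by auto
  have "laplace tail \<theta> = (\<integral>z. (\<theta> * (indicator {0<..1} z * z) - jump_exponent \<theta> z) / \<theta> \<partial>\<nu>)"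
    using laplace_mixture[OF mm _ i2] m eq by auto
  also have "\<dots> = (\<theta> * (\<integral>z. indicator {0<..1} z * z \<partial>\<nu>) - (\<integral>z. jump_exponent \<theta> z \<partial>\<nu>)) / \<theta>"
    using small integrable_jump_exponent[of \<theta>] t by simp
  finally show "(\<integral>z. jump_exponent \<theta> z \<partial>\<nu>) = \<theta> * ((\<integral>z. indicator {0<..1} z * z \<partial>\<nu>) - laplace tail \<theta>)"
    using t by (simp add: field_simps)
qed

lemma laplace_tail_nonneg: "laplace tail \<theta> \<ge> 0"
  unfolding laplace_def tail_def by (intro Bochner_Integration.integral_nonneg mult_nonneg_nonneg) auto

text \<open>After division by \<open>\<theta>\<^sup>2\<close> every term below the Gaussian one is a
  transform: of \<open>double_tail\<close> for the jumps, of the unit step for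
  \<open>\<gamma> / \<theta>\<close>, of its primitive for
  \<open>q / \<theta>\<^sup>2\<close>.\<close>

lemma laplace_exponent_gaussian:
  assumes "\<sigma> \<noteq> 0"
  obtains \<kappa> where "causal \<kappa>" "\<And>\<theta>. \<theta> > 0 \<Longrightarrow> exp_integrable \<theta> \<kappa>"
    "\<And>\<theta>. \<theta> > 0 \<Longrightarrow> laplace_exponent \<gamma> \<sigma> \<nu> \<theta> - q = \<sigma>\<^sup>2 / 2 * \<theta>\<^sup>2 * (1 - laplace \<kappa> \<theta>)"
proof
  define K where "K x = double_tail x + (\<gamma> * heaviside x - q * primitive heaviside x)" for x
  have K: "exp_integrable \<theta> K" "laplace K \<theta> = (\<integral>z. jump_exponent \<theta> z \<partial>\<nu>) / \<theta>\<^sup>2 + (\<gamma> / \<theta> - q / \<theta>\<^sup>2)"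
    if t: "\<theta> > 0" for \<theta>
  proof -
    have i: "exp_integrable \<theta> (\<lambda>x. \<gamma> * heaviside x)" "exp_integrable \<theta> (\<lambda>x. q * primitive heaviside x)"
      using t by (auto intro!: exp_integrable_cmult exp_integrable_heaviside exp_integrable_primitive)
    then have j: "exp_integrable \<theta> (\<lambda>x. \<gamma> * heaviside x - q * primitive heaviside x)"
      by (rule exp_integrable_diff)
    show "exp_integrable \<theta> K"
      unfolding K_def[abs_def] by (intro exp_integrable_add exp_integrable_double_tail t j)
    show "laplace K \<theta> = (\<integral>z. jump_exponent \<theta> z \<partial>\<nu>) / \<theta>\<^sup>2 + (\<gamma> / \<theta> - q / \<theta>\<^sup>2)"
      unfolding K_def[abs_def] laplace_add[OF exp_integrable_double_tail[OF t] j] laplace_diff[OF i]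
      using t by (simp add: laplace_double_tail laplace_cmult laplace_primitive laplace_heaviside
          exp_integrable_heaviside power2_eq_square)
  qed
  define \<kappa> where "\<kappa> x = - (2 / \<sigma>\<^sup>2) * K x" for x
  show "causal \<kappa>"
    using causal_double_tail causal_heaviside causal_primitive[OF causal_heaviside]
    by (simp add: causal_def \<kappa>_def K_def)
  show "exp_integrable \<theta> \<kappa>" if "\<theta> > 0" for \<theta>
    unfolding \<kappa>_def[abs_def] using K that by (intro exp_integrable_cmult)
  show "laplace_exponent \<gamma> \<sigma> \<nu> \<theta> - q = \<sigma>\<^sup>2 / 2 * \<theta>\<^sup>2 * (1 - laplace \<kappa> \<theta>)" if t: "\<theta> > 0" for \<theta>
    unfolding \<kappa>_def[abs_def] laplace_cmult K(2)[OF t] laplace_exponent_eq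
    using assms t by (simp add: field_simps power2_eq_square)
qed

lemma laplace_exponent_drift:
  assumes small: "integrable \<nu> (\<lambda>z. indicator {0<..1} z * z)" and t: "\<theta> > 0"
  shows "laplace_exponent \<gamma> 0 \<nu> \<theta> = \<theta> * (\<gamma> + (\<integral>z. indicator {0<..1} z * z \<partial>\<nu>) - laplace tail \<theta>)"
  unfolding laplace_exponent_eq laplace_tail[OF t small] by (simp add: algebra_simps)

text \<open>For small jumps \<open>z \<ge> 2 / \<theta>\<close> the compensated exponent is at least \<open>\<theta> * z / 2\<close>.\<close>

lemma laplace_exponent_superlinear:
  assumes large: "\<not> integrable \<nu> (\<lambda>z. indicator {0<..1} z * z)"
  shows "filterlim (\<lambda>\<theta>. laplace_exponent \<gamma> 0 \<nu> \<theta> / \<theta>) at_top at_top"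
  unfolding filterlim_at_top
proof
  fix B :: real
  \<comment> \<open>Jumps are cut off at \<open>2 / (n + 1)\<close>, so that
    \<open>\<theta> * z \<ge> 2\<close> as soon as \<open>\<theta> \<ge> n + 1\<close>. Their first
    moments increase to the infinite moment of all small jumps.\<close>
  define J where "J n z = indicator {2 / real (Suc n)..1} z * z" for n z
  have [measurable]: "J n \<in> borel_measurable borel" for n
    unfolding J_def[abs_def] by measurable
  have Ji: "integrable \<nu> (J n)" for n
  proof (rule integrable_bound_min_sq)
    fix z :: real assume z: "z > 0"
    show "\<bar>J n z\<bar> \<le> real (Suc n) * min 1 (z\<^sup>2)"
    proof (cases "2 / real (Suc n) \<le> z \<and> z \<le> 1")
      case True
      then have "1 \<le> real (Suc n) * z"
        by (simp add: field_simps)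
      then have "z \<le> real (Suc n) * z * z"
        using z mult_right_mono[of 1 "real (Suc n) * z" z] by simp
      moreover have "min 1 (z\<^sup>2) = z * z"
        using True z power_le_one[of z 2] by (simp add: min_absorb2 power2_eq_square)
      ultimately show ?thesis
        using True z by (simp add: J_def mult.assoc)
    qed (use z in \<open>auto simp: J_def indicator_def\<close>)
  qed measurable
  have Jpos: "J n z \<ge> 0" for n z
  proof (cases "2 / real (Suc n) \<le> z")
    case True
    then have "0 \<le> z"
      by (rule order_trans[rotated]) simp
    then show ?thesis
      by (simp add: J_def)
  qed (simp add: J_def)
  have tailI: "integrable \<nu> (indicator {1<..} :: real \<Rightarrow> real)"
  proof (rule integrable_bound_min_sq)
    show "\<bar>indicator {1<..} z :: real\<bar> \<le> 1 * min 1 (z\<^sup>2)" if "z > 0" for z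
      using that one_le_power[of z 2] by (auto simp: indicator_def min_def)
  qed simp
  define T where "T = (\<integral>z. (indicator {1<..} z :: real) \<partial>\<nu>)"
  have "norm (indicator {0<..1} z * z) = indicator {0<..1} z * z" for z :: real
    by (auto simp: indicator_def)
  then have "\<not> (\<integral>\<^sup>+z. ennreal (indicator {0<..1} z * z) \<partial>\<nu>) < \<infinity>"
    using large by (simp add: integrable_iff_bounded)
  then have "(\<integral>\<^sup>+z. ennreal (indicator {0<..1} z * z) \<partial>\<nu>) = \<infinity>"
    by (metis infinity_ennreal_def top.not_eq_extremum)
  also have "(\<integral>\<^sup>+z. ennreal (indicator {0<..1} z * z) \<partial>\<nu>) = (\<integral>\<^sup>+z. (SUP n. ennreal (J n z)) \<partial>\<nu>)"
  proof (rule nn_integral_cong)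
    fix z :: real
    show "ennreal (indicator {0<..1} z * z) = (SUP n. ennreal (J n z))"
    proof (cases "0 < z \<and> z \<le> 1")
      case True
      obtain n :: nat where "2 / z < real n"
        using reals_Archimedean2 by blast
      then have "2 / real (Suc n) \<le> z"
        using True by (simp add: field_simps)
      then have "J n z = z"
        using True by (simp add: J_def)
      moreover have "J k z \<le> z" for k
        using True by (simp add: J_def indicator_def)
      ultimately have "(SUP n. ennreal (J n z)) = ennreal z"
        by (intro antisym SUP_least) (auto intro!: SUP_upper2[of n] ennreal_leI)
      then show ?thesis
        using True by simp
    next
      case False
      then have "J k z = 0" for k
        using order_less_le_trans[of 0 "2 / real (Suc k)" z] by (auto simp: J_def indicator_def)
      then show ?thesis
        using False by (auto simp: indicator_def)
    qed
  qed
  also have "\<dots> = (SUP n. \<integral>\<^sup>+z. ennreal (J n z) \<partial>\<nu>)"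
  proof (rule nn_integral_monotone_convergence_SUP)
    show "incseq (\<lambda>n z. ennreal (J n z))"
    proof (intro monoI le_funI ennreal_leI)
      fix m n :: nat and z :: real assume "m \<le> n"
      then have "2 / real (Suc n) \<le> 2 / real (Suc m)"
        by (intro divide_left_mono) auto
      moreover have "indicator {e..1} z * z \<le> indicator {d..1} z * z" if "0 < d" "d \<le> e" for d e :: real
        using that by (auto simp: indicator_def)
      moreover have "2 / real (Suc n) > 0" by simp
      ultimately show "J m z \<le> J n z"
        unfolding J_def by blast
    qed
  qed measurable
  finally have "(SUP n. \<integral>\<^sup>+z. ennreal (J n z) \<partial>\<nu>) = \<infinity>" .
  \<comment> \<open>The factor 2 offsets the \<open>\<theta> / 2\<close> of the lower bound;
    \<open>\<bar>\<gamma>\<bar>\<close> pays for the linear term, \<open>T\<close> for the jumps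
    above 1, and \<open>\<bar>B\<bar>\<close> is the target.\<close>
  moreover have "ennreal (2 * (\<bar>B\<bar> + \<bar>\<gamma>\<bar> + T + 1)) < \<infinity>"
    by simp
  ultimately have "ennreal (2 * (\<bar>B\<bar> + \<bar>\<gamma>\<bar> + T + 1)) < (SUP n. \<integral>\<^sup>+z. ennreal (J n z) \<partial>\<nu>)"
    by (simp only:)
  then obtain n where "ennreal (2 * (\<bar>B\<bar> + \<bar>\<gamma>\<bar> + T + 1)) < (\<integral>\<^sup>+z. ennreal (J n z) \<partial>\<nu>)"
    by (auto simp: less_SUP_iff)
  also have "(\<integral>\<^sup>+z. ennreal (J n z) \<partial>\<nu>) = ennreal (\<integral>z. J n z \<partial>\<nu>)"
    using Ji Jpos by (intro nn_integral_eq_integral) auto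
  finally have n: "2 * (\<bar>B\<bar> + \<bar>\<gamma>\<bar> + T + 1) < (\<integral>z. J n z \<partial>\<nu>)"
    by (subst (asm) ennreal_less_iff) (auto simp: T_def)
  show "\<forall>\<^sub>F \<theta> in at_top. B \<le> laplace_exponent \<gamma> 0 \<nu> \<theta> / \<theta>"
    using eventually_ge_at_top[of "real (Suc n)"]
  proof eventually_elim
    case (elim \<theta>)
    then have t: "\<theta> \<ge> 1" by simp
    have "\<theta> / 2 * (\<integral>z. J n z \<partial>\<nu>) - T = (\<integral>z. \<theta> / 2 * J n z - indicator {1<..} z \<partial>\<nu>)"
      using Ji tailI by (simp add: T_def)
    also have "\<dots> \<le> (\<integral>z. jump_exponent \<theta> z \<partial>\<nu>)"
    proof (rule integral_mono)
      show "integrable \<nu> (\<lambda>z. \<theta> / 2 * J n z - indicator {1<..} z)"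
        using Ji tailI by simp
      show "integrable \<nu> (jump_exponent \<theta>)"
        using integrable_jump_exponent t by simp
      fix z :: real
      show "\<theta> / 2 * J n z - indicator {1<..} z \<le> jump_exponent \<theta> z"
      proof (cases "2 / real (Suc n) \<le> z \<and> z \<le> 1")
        case True
        have "2 \<le> real (Suc n) * z"
          using True by (simp add: field_simps)
        moreover have z: "z > 0"
          using True order_less_le_trans[of 0 "2 / real (Suc n)" z] by simp
        ultimately have "2 \<le> \<theta> * z"
          using elim mult_right_mono[of "real (Suc n)" \<theta> z] by linarith
        then show ?thesis
          using True z exp_gt_zero[of "- \<theta> * z"] unfolding J_def jump_exponent_def by (simp del: exp_gt_zero)
      next
        case False
        then show ?thesis
          using jump_exponent_ge[of \<theta> z] t by (auto simp: J_def indicator_def)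
      qed
    qed
    finally have 1: "(\<integral>z. jump_exponent \<theta> z \<partial>\<nu>) \<ge> \<theta> / 2 * (\<integral>z. J n z \<partial>\<nu>) - T" .
    have "T \<ge> 0" by (simp add: T_def)
    have "\<theta> * (\<bar>B\<bar> + \<bar>\<gamma>\<bar> + T + 1) \<le> \<theta> * ((\<integral>z. J n z \<partial>\<nu>) / 2)"
      using n t by (intro mult_left_mono) auto
    then have "\<theta> * \<bar>B\<bar> + \<theta> * \<bar>\<gamma>\<bar> + \<theta> * T \<le> \<theta> / 2 * (\<integral>z. J n z \<partial>\<nu>)"
      using t by (simp add: algebra_simps)
    moreover have "T \<le> \<theta> * T"
      using t \<open>T \<ge> 0\<close> mult_right_mono[of 1 \<theta> T] by simp
    moreover have "\<theta> * B \<le> \<theta> * \<bar>B\<bar>" "- (\<theta> * \<bar>\<gamma>\<bar>) \<le> \<theta> * \<gamma>"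
      using t mult_left_mono[of "- \<bar>\<gamma>\<bar>" \<gamma> \<theta>] by (auto intro!: mult_left_mono)
    ultimately have "\<theta> * B \<le> \<gamma> * \<theta> + (\<integral>z. jump_exponent \<theta> z \<partial>\<nu>)"
      using 1 by (simp add: mult.commute[of \<gamma>])
    then show ?case
      using t by (simp add: laplace_exponent_eq le_divide_eq mult.commute)
  qed
qed

end

section \<open>Paths dominated by a drift\<close>

context spectrally_negative_levy_process
begin

abbreviation "\<psi> \<equiv> laplace_exponent \<gamma> \<sigma> \<nu>"

text \<open>Chernoff's bound: reaching \<open>b * u + e\<close> has probability at most
  \<open>exp (- \<theta> * e)\<close> for every \<open>\<theta> > 0\<close>, hence probability
  0.\<close>

lemma AE_le_drift:
  assumes le: "\<And>\<theta>. \<theta> > 0 \<Longrightarrow> \<psi> \<theta> \<le> b * \<theta>" and u: "u \<ge> 0"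
  shows "AE w in M. X u w \<le> b * u"
proof -
  have [measurable]: "X u \<in> borel_measurable M"
    using measurable_X u by simp
  have null: "AE w in M. X u w < b * u + e" if e: "e > 0" for e
  proof -
    define A where "A = {w \<in> space M. X u w \<ge> b * u + e}"
    have [measurable]: "A \<in> sets M"
      unfolding A_def by measurable
    have Chernoff: "prob A \<le> exp (- \<theta> * e)" if t: "\<theta> > 0" for \<theta>
    proof -
      have "prob A * exp (\<theta> * (b * u + e)) = (LINT w|M. indicator A w * exp (\<theta> * (b * u + e)))"
        by simp
      also have "\<dots> \<le> (LINT w|M. exp (\<theta> * X u w))"
      proof (rule integral_mono)
        show "integrable M (\<lambda>w. exp (\<theta> * X u w))"
          using integrable_exp u t by simp
        show "indicator A w * exp (\<theta> * (b * u + e)) \<le> exp (\<theta> * X u w)" for w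
          using t by (auto simp: A_def indicator_def)
      qed (intro integrable_mult_left integrable_real_indicator, auto simp: emeasure_eq_measure)
      also have "\<dots> = exp (u * \<psi> \<theta>)"
        using expectation_exp u t by simp
      also have "\<dots> \<le> exp (u * (b * \<theta>))"
        using le[OF t] u by (auto intro: mult_left_mono)
      also have "\<dots> = exp (- \<theta> * e) * exp (\<theta> * (b * u + e))"
        by (simp add: exp_add[symmetric] algebra_simps)
      finally show ?thesis by simp
    qed
    have "prob A = 0"
    proof (rule ccontr)
      assume "prob A \<noteq> 0"
      then have p: "prob A > 0" "ln (prob A) \<le> 0"
        using prob_le_1[of A] by (auto simp: zero_less_measure_iff)
      \<comment> \<open>With this \<theta> the bound equals \<open>exp (ln (prob A) - 1)\<close>,
        which is below \<open>prob A\<close>.\<close>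
      define \<theta> where "\<theta> = (1 - ln (prob A)) / e"
      have "prob A \<le> exp (- \<theta> * e)"
        using p(2) e unfolding \<theta>_def by (intro Chernoff divide_pos_pos) linarith+
      also have "\<dots> = exp (ln (prob A) - 1)"
        using e by (simp add: \<theta>_def)
      also have "\<dots> < exp (ln (prob A))"
        by simp
      finally show False
        using p by simp
    qed
    then have "AE w in M. w \<notin> A"
      by (intro AE_not_in) (simp add: null_sets_def emeasure_eq_measure)
    then show ?thesis
      using AE_space by eventually_elim (auto simp: A_def)
  qed
  have "AE w in M. \<forall>n. X u w < b * u + 1 / real (Suc n)"
    using null by (simp add: AE_all_countable)
  then show ?thesis
  proof eventually_elim
    case (elim w)
    show ?case
    proof (rule field_le_epsilon)
      fix e :: real assume "e > 0"
      then obtain n where "1 / real (Suc n) < e"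
        using nat_approx_posE by (metis)
      then show "X u w \<le> b * u + e"
        using elim[rule_format, of n] by linarith
    qed
  qed
qed

lemma AE_increment_le_drift:
  assumes le: "\<And>\<theta>. \<theta> > 0 \<Longrightarrow> \<psi> \<theta> \<le> b * \<theta>" and st: "0 \<le> s" "s \<le> t"
  shows "AE w in M. X t w - b * t \<le> X s w - b * s"
proof -
  have [measurable]: "X t \<in> borel_measurable M" "X s \<in> borel_measurable M" "X (t - s) \<in> borel_measurable M"
    using measurable_X st by auto
  have "AE w in M. X (t - s) w \<le> b * (t - s)"
    using AE_le_drift[OF le] st by simp
  then have "AE x in distr M borel (X (t - s)). x \<le> b * (t - s)"
    by (subst AE_distr_iff) auto
  also have "distr M borel (X (t - s)) = distr M borel (\<lambda>w. X t w - X s w)"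
    using stationary_increments st by simp
  finally have "AE w in M. X t w - X s w \<le> b * (t - s)"
    by (subst (asm) AE_distr_iff) auto
  then show ?thesis
    by eventually_elim (simp add: algebra_simps)
qed

text \<open>Almost surely all pairs of rational times can be handled at once; right-continuity of
  the paths then extends monotonicity to all times.\<close>

lemma AE_antimono_minus_drift:
  assumes le: "\<And>\<theta>. \<theta> > 0 \<Longrightarrow> \<psi> \<theta> \<le> b * \<theta>"
  shows "AE w in M. antimono_on {0..} (\<lambda>t. X t w - b * t)"
proof -
  have "AE w in M. \<forall>q r :: rat. 0 \<le> q \<longrightarrow> q \<le> r \<longrightarrow>
      X (of_rat r) w - b * of_rat r \<le> X (of_rat q) w - b * of_rat q"
    using AE_increment_le_drift[OF le] by (auto simp: AE_all_countable of_rat_less_eq)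
  then show ?thesis
    using cadlag_X
  proof eventually_elim
    case (elim w)
    define f where "f t = X t w - b * t" for t
    have rc: "(f \<longlongrightarrow> f t) (at_right t)" if "t \<ge> 0" for t
      unfolding f_def using elim(2) that by (intro tendsto_intros) (auto simp: cadlag_def)
    have "f t \<le> f s" if st: "0 \<le> s" "s \<le> t" for s t
    proof (rule ccontr)
      assume "\<not> f t \<le> f s"
      then have lt: "f s < f t" and "s < t"
        using st by (auto simp: not_le intro: le_neq_trans)
      \<comment> \<open>A separating level: \<open>f\<close> stays below \<open>m\<close> just after
        \<open>s\<close> and above \<open>m\<close> just after \<open>t\<close>, which contradicts
        monotonicity at suitable rational times \<open>q < t < r\<close>.\<close>
      define m where "m = (f s + f t) / 2"
      have m: "f s < m" "m < f t"
        using lt by (auto simp: m_def)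
      obtain u where u: "u > s" "\<And>y. s < y \<Longrightarrow> y < u \<Longrightarrow> f y < m"
        using order_tendstoD(2)[OF rc m(1)] st by (auto simp: eventually_at_right_field)
      obtain v where v: "v > t" "\<And>y. t < y \<Longrightarrow> y < v \<Longrightarrow> m < f y"
        using order_tendstoD(1)[OF rc m(2)] st by (auto simp: eventually_at_right_field)
      obtain q where q: "s < of_rat q" "of_rat q < min u t"
        using of_rat_dense[of s "min u t"] u \<open>s < t\<close> by auto
      obtain r where r: "t < of_rat r" "of_rat r < v"
        using of_rat_dense[of t v] v by auto
      have "(0 :: real) \<le> of_rat q" "(of_rat q :: real) \<le> of_rat r"
        using q(1) q(2)[unfolded min_less_iff_conj] r(1) st(1) by linarith+
      then have "0 \<le> q" "q \<le> r"
        unfolding of_rat_less_eq zero_le_of_rat_iff by auto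
      then have "f (of_rat r) \<le> f (of_rat q)"
        using elim(1) by (simp add: f_def)
      then show False
        using u(2)[of "of_rat q"] v(2)[of "of_rat r"] q r by auto
    qed
    then show ?case
      by (auto simp: monotone_on_def f_def)
  qed
qed

text \<open>Otherwise \<open>X t\<close> would be a decreasing process plus \<open>b * t\<close>,
  hence decreasing. With \<open>b = 0\<close> this provides a positive value of the exponent; with
  the drift of a process without Gaussian part for \<open>b\<close>, it shows that this drift is
  positive.\<close>

lemma laplace_exponent_above_drift:
  assumes "b \<le> 0"
  shows "\<exists>\<theta>>0. \<psi> \<theta> > b * \<theta>"
proof (rule ccontr)
  assume "\<not> (\<exists>\<theta>>0. \<psi> \<theta> > b * \<theta>)"
  then have "\<And>\<theta>. \<theta> > 0 \<Longrightarrow> \<psi> \<theta> \<le> b * \<theta>"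
    using not_less by blast
  then have "AE w in M. antimono_on {0..} (\<lambda>t. X t w - b * t)"
    by (rule AE_antimono_minus_drift)
  then have "AE w in M. antimono_on {0..} (\<lambda>t. X t w)"
  proof eventually_elim
    case (elim w)
    show ?case
    proof (rule monotone_onI)
      fix s t :: real assume "s \<in> {0..}" "t \<in> {0..}" "s \<le> t"
      then show "X s w \<ge> X t w"
        using elim mult_left_mono_neg[OF \<open>s \<le> t\<close> assms] by (force simp: monotone_on_def)
    qed
  qed
  then show False
    using not_decreasing by simp
qed

text \<open>Almost every path is a decreasing function plus \<open>b * t\<close>, that is a
  difference of monotone functions.\<close>

lemma bounded_variation_pathsI:
  assumes le: "\<And>\<theta>. \<theta> > 0 \<Longrightarrow> \<psi> \<theta> \<le> b * \<theta>"
  shows "bounded_variation_paths M X"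
proof -
  have "AE w in M. antimono_on {0..} (\<lambda>t. X t w - b * t)"
    using le by (rule AE_antimono_minus_drift)
  then show ?thesis
    unfolding bounded_variation_paths_def
  proof eventually_elim
    case (elim w)
    define f where "f t = X t w - b * t" for t
    have f: "f t \<le> f s" if "0 \<le> s" "s \<le> t" for s t
      using elim that by (auto simp: monotone_on_def f_def)
    show ?case
    proof (intro allI impI)
      fix T :: real assume "0 \<le> T"
      have "(\<Sum>i<n. \<bar>X (s (Suc i)) w - X (s i) w\<bar>) \<le> f 0 - f T + \<bar>b\<bar> * T"
        if s: "0 \<le> s 0" "\<forall>i<n. s i \<le> s (Suc i)" "s n \<le> T" for n :: nat and s
      proof -
        have "0 \<le> s i" if "i \<le> n" for i
          using that s by (induction i) (auto intro: order_trans)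
        \<comment> \<open>The decrease of \<open>f t - \<bar>b\<bar> * t\<close> bounds each
          increment, so that the sum telescopes.\<close>
        then have "\<bar>X (s (Suc i)) w - X (s i) w\<bar> \<le> (f (s i) - \<bar>b\<bar> * s i) - (f (s (Suc i)) - \<bar>b\<bar> * s (Suc i))"
          if "i < n" for i
        proof -
          have i: "0 \<le> s i" "s i \<le> s (Suc i)"
            using that s \<open>\<And>i. i \<le> n \<Longrightarrow> 0 \<le> s i\<close> by auto
          have "\<bar>b * (s (Suc i) - s i)\<bar> = \<bar>b\<bar> * (s (Suc i) - s i)"
            using i by (simp add: abs_mult)
          moreover have "X (s (Suc i)) w - X (s i) w = (f (s (Suc i)) - f (s i)) + b * (s (Suc i) - s i)"
            by (simp add: f_def algebra_simps)
          moreover have "f (s (Suc i)) \<le> f (s i)"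
            using f i by simp
          ultimately show ?thesis
            by (simp add: right_diff_distrib)
        qed
        then have "(\<Sum>i<n. \<bar>X (s (Suc i)) w - X (s i) w\<bar>)
            \<le> (\<Sum>i<n. (f (s i) - \<bar>b\<bar> * s i) - (f (s (Suc i)) - \<bar>b\<bar> * s (Suc i)))"
          by (intro sum_mono) auto
        also have "\<dots> = (f (s 0) - \<bar>b\<bar> * s 0) - (f (s n) - \<bar>b\<bar> * s n)"
          by (rule sum_lessThan_telescope')
        also have "\<dots> \<le> f 0 - f T + \<bar>b\<bar> * T"
        proof -
          have "0 \<le> s n"
            using \<open>\<And>i. i \<le> n \<Longrightarrow> 0 \<le> s i\<close> by simp
          then have "f (s 0) \<le> f 0" "f T \<le> f (s n)" "\<bar>b\<bar> * s n \<le> \<bar>b\<bar> * T" "0 \<le> \<bar>b\<bar> * s 0"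
            using f s by (auto intro: mult_left_mono)
          then show ?thesis by linarith
        qed
        finally show ?thesis .
      qed
      then show "bounded_variation_on_Icc (\<lambda>t. X t w) 0 T"
        unfolding bounded_variation_on_Icc_def by blast
    qed
  qed
qed

end

section \<open>Scale functions as primitives\<close>

lemma continuous_on_primitive_loc:
  assumes "loc_integrable f"
  shows "continuous_on UNIV (primitive f)"
proof (rule continuous_at_imp_continuous_on, rule ballI)
  fix x :: real
  have "isCont (primitive (trunc (x + 1) f)) x"
    using continuous_on_primitive assms by (auto simp: loc_integrable_def continuous_on_eq_continuous_at)
  moreover have "eventually (\<lambda>y. primitive f y = primitive (trunc (x + 1) f) y) (nhds x)"
    unfolding eventually_nhds by (intro exI[of _ "{..<x + 1}"]) (auto simp: primitive_trunc)
  ultimately show "isCont (primitive f) x"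
    using isCont_cong by fast
qed

lemma loc_integrable_cmult: "loc_integrable f \<Longrightarrow> loc_integrable (\<lambda>x. c * f x)"
  unfolding loc_integrable_def trunc_def[abs_def] by (simp add: mult.left_commute)

lemma loc_integrable_add: "loc_integrable f \<Longrightarrow> loc_integrable g \<Longrightarrow> loc_integrable (\<lambda>x. f x + g x)"
  unfolding loc_integrable_def trunc_def[abs_def] by (simp add: distrib_left)

lemma primitive_cmult: "primitive (\<lambda>x. c * f x) x = c * primitive f x"
  unfolding primitive_def by (rule set_integral_mult_right)

lemma primitive_add:
  assumes "loc_integrable f" "loc_integrable g"
  shows "primitive (\<lambda>x. f x + g x) x = primitive f x + primitive g x"
proof -
  have "set_integrable lborel {..<x} f" if "loc_integrable f" for f
  proof -
    have "integrable lborel (\<lambda>t. indicator {..<x} t *\<^sub>R trunc x f t)"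
      using that by (intro integrable_mult_indicator) (auto simp: loc_integrable_def)
    moreover have "indicator {..<x} t *\<^sub>R trunc x f t = indicator {..<x} t *\<^sub>R f t" for t
      by (auto simp: trunc_def indicator_def)
    ultimately show ?thesis
      unfolding set_integrable_def by (simp only:)
  qed
  then show ?thesis
    unfolding primitive_def using assms by (intro set_integral_add) auto
qed

lemma
  assumes "causal f" "loc_integrable f" "causal g" "loc_integrable g"
  shows loc_integrable_conv: "loc_integrable (conv f g)"
    and conv_primitive_loc: "conv (primitive f) g x = primitive (conv f g) x"
proof -
  have g0: "\<And>x. x < 0 \<Longrightarrow> g x = 0"
    using assms by (simp add: causal_def)
  have i: "integrable lborel (trunc R f)" "integrable lborel (trunc R g)" for R
    using assms by (auto simp: loc_integrable_def)
  have eq: "conv f g y = conv (trunc R f) (trunc R g) y" if "y \<le> R" for y R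
    using conv_trunc[OF assms(1) g0 that] by simp
  show "loc_integrable (conv f g)"
    unfolding loc_integrable_def
  proof
    fix R
    have "trunc R (conv f g) = (\<lambda>y. indicator {..R} y *\<^sub>R conv (trunc R f) (trunc R g) y)"
      using eq by (auto simp: trunc_def indicator_def fun_eq_iff)
    then show "integrable lborel (trunc R (conv f g))"
      using integrable_mult_indicator[OF _ integrable_conv[OF i[of R]], of "{..R}"] by simp
  qed
  have "conv (primitive f) g x = conv (trunc x (primitive f)) (trunc x g) x"
    using conv_trunc[OF causal_primitive[OF assms(1)] g0, where x = x and R = x] by simp
  also have "\<dots> = conv (primitive (trunc x f)) (trunc x g) x"
    unfolding conv_def
  proof (rule Bochner_Integration.integral_cong[OF refl])
    fix y
    show "trunc x (primitive f) (x - y) * trunc x g y = primitive (trunc x f) (x - y) * trunc x g y"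
      using g0[of y] primitive_trunc[of "x - y" x f] by (cases "y < 0") (auto simp: trunc_def)
  qed
  also have "\<dots> = primitive (conv (trunc x f) (trunc x g)) x"
    by (rule conv_primitive[OF i])
  also have "\<dots> = primitive (conv f g) x"
    unfolding primitive_def using eq[of _ x] by (intro set_lebesgue_integral_cong) auto
  finally show "conv (primitive f) g x = primitive (conv f g) x" .
qed

text \<open>Sets the value at 0, which the notion of scale function leaves open, to 0.\<close>

definition causal_part :: "(real \<Rightarrow> real) \<Rightarrow> real \<Rightarrow> real" where
  "causal_part f x = heaviside x * f x"

lemma causal_causal_part: "causal (causal_part f)"
  by (simp add: causal_def causal_part_def heaviside_def)

lemma scale_function_laplace:
  assumes W: "is_scale_function \<psi> q W" and t: "\<theta> > right_inverse_exponent \<psi> q"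
  shows "exp_integrable \<theta> (causal_part W)" "laplace (causal_part W) \<theta> = 1 / (\<psi> \<theta> - q)"
proof -
  have *: "exp (- \<theta> * x) * causal_part W x = indicator {0<..} x *\<^sub>R (exp (- \<theta> * x) * W x)" for x
    by (simp add: causal_part_def heaviside_def)
  show "exp_integrable \<theta> (causal_part W)" "laplace (causal_part W) \<theta> = 1 / (\<psi> \<theta> - q)"
    using W t unfolding is_scale_function_def exp_integrable_def laplace_def set_integrable_def set_lebesgue_integral_def *
    by auto
qed

lemma continuous_on_causal_part:
  assumes "is_scale_function \<psi> q W"
  shows "continuous_on {0<..} (causal_part W)"
  using assms unfolding is_scale_function_def
  by (auto simp: causal_part_def heaviside_def cong: continuous_on_cong_simp)

lemma loc_integrable_causal_part:
  assumes "is_scale_function \<psi> q W"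
  shows "loc_integrable (causal_part W)"
  using scale_function_laplace(1)[OF assms, of "right_inverse_exponent \<psi> q + 1"]
  by (intro exp_integrable_imp_loc_integrable causal_causal_part) auto

text \<open>The hypothesis in product form carries \<open>\<psi> \<theta> \<noteq> q\<close> with
  it, so that \<open>1 / (\<psi> \<theta> - q)\<close> is a genuine reciprocal for large
  \<theta>.\<close>

lemma scale_function_eqI:
  assumes W: "is_scale_function \<psi> q W"
    and f: "causal f" "continuous_on {0<..} f"
    and L: "\<And>\<theta>. \<theta> \<ge> \<theta>\<^sub>0 \<Longrightarrow> exp_integrable \<theta> f \<and> laplace f \<theta> * (\<psi> \<theta> - q) = 1"
  shows "causal_part W = f"
proof (rule laplace_inject[where \<theta> = "max \<theta>\<^sub>0 (right_inverse_exponent \<psi> q + 1)"])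
  show "laplace (causal_part W) \<theta> = laplace f \<theta>"
    if "max \<theta>\<^sub>0 (right_inverse_exponent \<psi> q + 1) \<le> \<theta>" for \<theta>
  proof -
    have "\<psi> \<theta> - q \<noteq> 0"
      using L[of \<theta>] that by auto
    then show ?thesis
      using scale_function_laplace(2)[OF W, of \<theta>] L[of \<theta>] that by (simp add: nonzero_divide_eq_eq)
  qed
qed (use f L scale_function_laplace(1)[OF W] continuous_on_causal_part[OF W] in \<open>auto intro: causal_causal_part\<close>)

context levy_measure
begin

text \<open>\<open>1 / (\<psi> \<theta> - q)\<close> is
  \<open>2 / (\<sigma>\<^sup>2 * \<theta>\<^sup>2)\<close> times
  \<open>1 + laplace r \<theta>\<close>, and each factor \<open>1 / \<theta>\<close> is an
  integration. So \<open>w\<close> is the derivative of the scale function, \<open>c\<close> its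
  value at 0+, and \<open>u\<close> a density of \<open>w\<close>.\<close>

lemma scale_function_gaussian:
  assumes s: "\<sigma> \<noteq> 0" and W: "is_scale_function (laplace_exponent \<gamma> \<sigma> \<nu>) q W"
  obtains u w c where "causal u" "loc_integrable u" "causal w" "loc_integrable w"
    "\<And>x. x > 0 \<Longrightarrow> w x = c + primitive u x" "causal_part W = primitive w"
proof -
  obtain \<kappa> where k: "causal \<kappa>" "\<And>\<theta>. \<theta> > 0 \<Longrightarrow> exp_integrable \<theta> \<kappa>"
    and psi: "\<And>\<theta>. \<theta> > 0 \<Longrightarrow> laplace_exponent \<gamma> \<sigma> \<nu> \<theta> - q = \<sigma>\<^sup>2 / 2 * \<theta>\<^sup>2 * (1 - laplace \<kappa> \<theta>)"
    using laplace_exponent_gaussian[OF s, of \<gamma> q] by blast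
  obtain r \<theta>\<^sub>1 where r: "(1::real) \<le> \<theta>\<^sub>1" "causal r"
    "\<And>\<theta>. \<theta> \<ge> \<theta>\<^sub>1 \<Longrightarrow> exp_integrable \<theta> r \<and> (1 - laplace \<kappa> \<theta>) * (1 + laplace r \<theta>) = 1"
    using neumann_series[OF k(2)[OF zero_less_one] k(1)] by blast
  define c where "c = 2 / \<sigma>\<^sup>2"
  define u where "u x = c * r x" for x
  define w where "w x = c * heaviside x + primitive u x" for x
  have u: "causal u" "loc_integrable u"
    using r exp_integrable_imp_loc_integrable[of \<theta>\<^sub>1 r]
    by (auto simp: u_def[abs_def] causal_def intro!: loc_integrable_cmult)
  have w: "causal w"
    using causal_heaviside causal_primitive[OF u(1)] by (simp add: causal_def w_def)
  have wL: "exp_integrable \<theta> w \<and> laplace w \<theta> = c / \<theta> * (1 + laplace r \<theta>)" if t: "\<theta> \<ge> \<theta>\<^sub>1" for \<theta>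
  proof -
    have t0: "\<theta> > 0" using t r(1) by linarith
    have ui: "exp_integrable \<theta> u"
      unfolding u_def[abs_def] using r(3)[OF t] by (intro exp_integrable_cmult) simp
    have i: "exp_integrable \<theta> (\<lambda>x. c * heaviside x)" "exp_integrable \<theta> (primitive u)"
      using t0 ui by (auto intro: exp_integrable_cmult exp_integrable_heaviside exp_integrable_primitive)
    have "laplace w \<theta> = c * (1 / \<theta>) + c * laplace r \<theta> / \<theta>"
      unfolding w_def[abs_def] laplace_add[OF i] laplace_primitive[OF ui t0]
      unfolding u_def[abs_def] laplace_cmult laplace_heaviside[OF t0] ..
    moreover have "exp_integrable \<theta> w"
      unfolding w_def[abs_def] by (rule exp_integrable_add[OF i])
    ultimately show ?thesis
      by (simp add: add_divide_distrib distrib_left)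
  qed
  have wl: "loc_integrable w"
    using wL[of \<theta>\<^sub>1] w exp_integrable_imp_loc_integrable by auto
  have "causal_part W = primitive w"
  proof (rule scale_function_eqI[OF W causal_primitive[OF w]])
    show "continuous_on {0<..} (primitive w)"
      using continuous_on_primitive_loc[OF wl] continuous_on_subset by blast
    fix \<theta> assume t: "\<theta> \<ge> \<theta>\<^sub>1"
    then have t0: "\<theta> > 0" using r(1) by linarith
    have "laplace (primitive w) \<theta> = c / \<theta> * (1 + laplace r \<theta>) / \<theta>"
      using t0 wL[OF t] by (simp add: laplace_primitive)
    then have "laplace (primitive w) \<theta> * (\<sigma>\<^sup>2 / 2 * \<theta>\<^sup>2) = 1 + laplace r \<theta>"
      using s t0 by (simp add: c_def power2_eq_square)
    then have "laplace (primitive w) \<theta> * (laplace_exponent \<gamma> \<sigma> \<nu> \<theta> - q) =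
        (1 - laplace \<kappa> \<theta>) * (1 + laplace r \<theta>)"
      unfolding psi[OF t0] by (metis mult.assoc mult.commute)
    then show "exp_integrable \<theta> (primitive w) \<and> laplace (primitive w) \<theta> * (laplace_exponent \<gamma> \<sigma> \<nu> \<theta> - q) = 1"
      using r(3)[OF t] t0 wL[OF t] exp_integrable_primitive by auto
  qed
  moreover have "w x = c + primitive u x" if "x > 0" for x
    using that by (simp add: w_def heaviside_def)
  ultimately show thesis
    using that u w wl by blast
qed

text \<open>Only one factor \<open>1 / \<theta>\<close> is available, so the scale function itself
  jumps at 0, by \<open>1 / d\<close>; here \<open>d\<close> is the drift after undoing the
  compensation of the small jumps.\<close>

lemma scale_function_drift:
  assumes small: "integrable \<nu> (\<lambda>z. indicator {0<..1} z * z)"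
    and c: "\<gamma> + (\<integral>z. indicator {0<..1} z * z \<partial>\<nu>) \<noteq> 0"
    and W: "is_scale_function (laplace_exponent \<gamma> 0 \<nu>) q W"
  obtains v c where "causal v" "loc_integrable v" "\<And>x. x > 0 \<Longrightarrow> causal_part W x = c + primitive v x"
proof -
  define d where "d = \<gamma> + (\<integral>z. indicator {0<..1} z * z \<partial>\<nu>)"
  define \<kappa> where "\<kappa> x = 1 / d * (tail x + q * heaviside x)" for x
  have d: "d \<noteq> 0" using c by (simp add: d_def)
  have k: "causal \<kappa>"
    using causal_tail causal_heaviside by (simp add: causal_def \<kappa>_def)
  have kL: "exp_integrable \<theta> \<kappa> \<and> laplace \<kappa> \<theta> = 1 / d * (laplace tail \<theta> + q / \<theta>)" if t: "\<theta> > 0" for \<theta>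
  proof -
    have i: "exp_integrable \<theta> tail" "exp_integrable \<theta> (\<lambda>x. q * heaviside x)"
      using exp_integrable_tail[OF t small] exp_integrable_heaviside[OF t] by (auto intro: exp_integrable_cmult)
    have "exp_integrable \<theta> (\<lambda>x. 1 / d * (tail x + q * heaviside x))"
      by (rule exp_integrable_cmult[OF exp_integrable_add[OF i]])
    moreover have "laplace (\<lambda>x. 1 / d * (tail x + q * heaviside x)) \<theta> = 1 / d * (laplace tail \<theta> + q / \<theta>)"
      unfolding laplace_cmult laplace_add[OF i] laplace_heaviside[OF t] by simp
    ultimately show ?thesis
      by (simp only: \<kappa>_def[abs_def])
  qed
  have psi: "laplace_exponent \<gamma> 0 \<nu> \<theta> - q = d * \<theta> * (1 - laplace \<kappa> \<theta>)" if t: "\<theta> > 0" for \<theta>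
    using kL[OF t] d t unfolding laplace_exponent_drift[OF small t] d_def[symmetric]
    by (simp add: field_simps)
  obtain r \<theta>\<^sub>1 where r: "(1::real) \<le> \<theta>\<^sub>1" "causal r"
    "\<And>\<theta>. \<theta> \<ge> \<theta>\<^sub>1 \<Longrightarrow> exp_integrable \<theta> r \<and> (1 - laplace \<kappa> \<theta>) * (1 + laplace r \<theta>) = 1"
    using neumann_series[OF kL[OF zero_less_one, THEN conjunct1] k] by blast
  define v where "v x = 1 / d * r x" for x
  define w where "w x = 1 / d * heaviside x + primitive v x" for x
  have v: "causal v" "loc_integrable v"
    using r exp_integrable_imp_loc_integrable[of \<theta>\<^sub>1 r]
    by (auto simp: v_def[abs_def] causal_def intro!: loc_integrable_cmult[of r "1 / d", simplified])
  have w: "causal w"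
    using causal_heaviside causal_primitive[OF v(1)] by (simp add: causal_def w_def)
  have "causal_part W = w"
  proof (rule scale_function_eqI[OF W w])
    have "continuous_on {0<..} (\<lambda>x. 1 / d + primitive v x)"
      using continuous_on_primitive_loc[OF v(2)] continuous_on_subset by (intro continuous_intros) blast
    then show "continuous_on {0<..} w"
      by (rule continuous_on_cong[THEN iffD1, rotated -1]) (auto simp: w_def heaviside_def)
    fix \<theta> assume t: "\<theta> \<ge> \<theta>\<^sub>1"
    then have t0: "\<theta> > 0" using r(1) by linarith
    have vi: "exp_integrable \<theta> v"
      unfolding v_def[abs_def] using r(3)[OF t] by (intro exp_integrable_cmult) simp
    have i: "exp_integrable \<theta> (\<lambda>x. 1 / d * heaviside x)" "exp_integrable \<theta> (primitive v)"
      by (rule exp_integrable_cmult[OF exp_integrable_heaviside[OF t0]], rule exp_integrable_primitive[OF vi t0])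
    have "laplace w \<theta> = 1 / d * (1 / \<theta>) + (1 / d * laplace r \<theta>) / \<theta>"
      unfolding w_def[abs_def] laplace_add[OF i] laplace_primitive[OF vi t0]
      unfolding v_def[abs_def] laplace_cmult laplace_heaviside[OF t0] ..
    then have "laplace w \<theta> * (d * \<theta>) = 1 + laplace r \<theta>"
      using d t0 by (simp add: field_simps)
    then have "laplace w \<theta> * (laplace_exponent \<gamma> 0 \<nu> \<theta> - q) = (1 - laplace \<kappa> \<theta>) * (1 + laplace r \<theta>)"
      unfolding psi[OF t0] by (metis mult.assoc mult.commute)
    moreover have "exp_integrable \<theta> w"
      unfolding w_def[abs_def] by (rule exp_integrable_add[OF i])
    ultimately show "exp_integrable \<theta> w \<and> laplace w \<theta> * (laplace_exponent \<gamma> 0 \<nu> \<theta> - q) = 1"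
      using r(3)[OF t] by simp
  qed
  then have "causal_part W x = 1 / d + primitive v x" if "x > 0" for x
    using that by (simp add: w_def heaviside_def)
  then show thesis
    using that v by blast
qed

end

section \<open>The initial value of a scale function\<close>

text \<open>An Abelian estimate: if \<open>f \<ge> e > 0\<close> on \<open>{0<..d}\<close>, this
  part contributes at least \<open>e * (1 - exp (- \<theta> * d))\<close> to
  \<open>\<theta> * laplace f \<theta>\<close>, while the part beyond \<open>d\<close> is
  exponentially small in \<theta>, whatever its sign.\<close>

lemma initial_value_le_0:
  assumes f: "causal f" "exp_integrable \<theta>\<^sub>1 f"
    and lim: "((\<lambda>\<theta>. \<theta> * laplace f \<theta>) \<longlongrightarrow> 0) at_top"
    and d: "d > 0" "\<And>x. 0 < x \<Longrightarrow> x \<le> d \<Longrightarrow> e \<le> f x"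
  shows "e \<le> 0"
proof (rule ccontr)
  assume "\<not> e \<le> 0"
  then have e: "e > 0" by simp
  define C where "C = (\<integral>x. \<bar>exp (- \<theta>\<^sub>1 * x) * f x\<bar> \<partial>lborel)"
  have le: "\<theta> * laplace f \<theta> \<ge> e * (1 - exp (- \<theta> * d)) - \<theta> * (exp (- (\<theta> - \<theta>\<^sub>1) * d) * C)"
    if t: "\<theta> \<ge> max 1 \<theta>\<^sub>1" for \<theta>
  proof -
    have t0: "\<theta> > 0" using t by simp
    have i1: "integrable lborel (\<lambda>x. exp (- \<theta> * x) * f x)"
      using exp_integrable_mono[OF f(2) f(1)] t by (simp add: exp_integrable_def)
    have i2: "integrable lborel (\<lambda>x. exp (- \<theta> * x) * indicator {0<..d} x)"
      using exp_integrable_interval[OF t0 d(1)] by (simp add: exp_integrable_def)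
    have i3: "integrable lborel (\<lambda>x. \<bar>exp (- \<theta>\<^sub>1 * x) * f x\<bar>)"
      using f(2) by (simp add: exp_integrable_def)
    have "e * laplace (indicator {0<..d}) \<theta> - exp (- (\<theta> - \<theta>\<^sub>1) * d) * C =
        (\<integral>x. e * (exp (- \<theta> * x) * indicator {0<..d} x) - exp (- (\<theta> - \<theta>\<^sub>1) * d) * \<bar>exp (- \<theta>\<^sub>1 * x) * f x\<bar> \<partial>lborel)"
      unfolding laplace_def C_def using i2 i3 by (subst Bochner_Integration.integral_diff) auto
    also have "\<dots> \<le> laplace f \<theta>"
      unfolding laplace_def
    proof (rule integral_mono[OF _ i1])
      show "integrable lborel (\<lambda>x. e * (exp (- \<theta> * x) * indicator {0<..d} x) - exp (- (\<theta> - \<theta>\<^sub>1) * d) * \<bar>exp (- \<theta>\<^sub>1 * x) * f x\<bar>)"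
        using i2 i3 by (intro Bochner_Integration.integrable_diff integrable_mult_right)
      fix x
      show "e * (exp (- \<theta> * x) * indicator {0<..d} x) - exp (- (\<theta> - \<theta>\<^sub>1) * d) * \<bar>exp (- \<theta>\<^sub>1 * x) * f x\<bar>
          \<le> exp (- \<theta> * x) * f x"
      proof (cases "x \<le> 0")
        case True
        then show ?thesis using f(1) by (simp add: causal_def)
      next
        case x: False
        show ?thesis
        proof (cases "x \<le> d")
          case True
          have "e * exp (- \<theta> * x) \<le> f x * exp (- \<theta> * x)"
            using d(2)[of x] x True by (intro mult_right_mono) auto
          moreover have "0 \<le> exp (- (\<theta> - \<theta>\<^sub>1) * d) * \<bar>exp (- \<theta>\<^sub>1 * x) * f x\<bar>"
            by simp
          ultimately have "e * exp (- \<theta> * x) - exp (- (\<theta> - \<theta>\<^sub>1) * d) * \<bar>exp (- \<theta>\<^sub>1 * x) * f x\<bar> \<le> f x * exp (- \<theta> * x)"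
            by linarith
          then show ?thesis
            using x True by (simp add: mult.commute[of "f x"])
        next
          case False
          have "(\<theta> - \<theta>\<^sub>1) * d \<le> (\<theta> - \<theta>\<^sub>1) * x"
            using t False by (intro mult_left_mono) auto
          then have "exp (- \<theta> * x) \<le> exp (- (\<theta> - \<theta>\<^sub>1) * d) * exp (- \<theta>\<^sub>1 * x)"
            by (simp add: exp_add[symmetric] algebra_simps)
          then have "exp (- \<theta> * x) * \<bar>f x\<bar> \<le> exp (- (\<theta> - \<theta>\<^sub>1) * d) * exp (- \<theta>\<^sub>1 * x) * \<bar>f x\<bar>"
            by (intro mult_right_mono) auto
          moreover have "- (exp (- \<theta> * x) * \<bar>f x\<bar>) \<le> exp (- \<theta> * x) * f x"
            using abs_ge_minus_self[of "exp (- \<theta> * x) * f x"] by (simp add: abs_mult)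
          ultimately have "- (exp (- (\<theta> - \<theta>\<^sub>1) * d) * exp (- \<theta>\<^sub>1 * x) * \<bar>f x\<bar>) \<le> exp (- \<theta> * x) * f x"
            by linarith
          then show ?thesis
            using False by (simp add: abs_mult mult.assoc)
        qed
      qed
    qed
    finally have "\<theta> * (e * ((1 - exp (- \<theta> * d)) / \<theta>) - exp (- (\<theta> - \<theta>\<^sub>1) * d) * C) \<le> \<theta> * laplace f \<theta>"
      using t0 d(1) by (intro mult_left_mono) (auto simp: laplace_interval)
    moreover have "\<theta> * (e * ((1 - exp (- \<theta> * d)) / \<theta>)) = e * (1 - exp (- \<theta> * d))"
      using t0 by simp
    ultimately show ?thesis
      by (simp only: right_diff_distrib)
  qed
  have top: "filterlim (\<lambda>\<theta>. \<theta> * d) at_top at_top"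
    using d(1) by (intro filterlim_at_top_mult_tendsto_pos[OF tendsto_const] filterlim_ident)
  have E0: "((\<lambda>\<theta>. exp (- \<theta> * d)) \<longlongrightarrow> 0) at_top"
    using filterlim_compose[OF exp_at_bot filterlim_compose[OF filterlim_uminus_at_bot_at_top top]] by simp
  \<comment> \<open>Up to a constant, the error term is \<open>t / exp t\<close> at
    \<open>t = \<theta> * d\<close>.\<close>
  have "((\<lambda>\<theta>. (\<theta> * d) ^ 1 / exp (\<theta> * d)) \<longlongrightarrow> 0) at_top"
    by (rule filterlim_compose[OF tendsto_power_div_exp_0 top])
  then have "((\<lambda>\<theta>. (exp (\<theta>\<^sub>1 * d) * C / d) * ((\<theta> * d) ^ 1 / exp (\<theta> * d))) \<longlongrightarrow> (exp (\<theta>\<^sub>1 * d) * C / d) * 0) at_top"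
    by (intro tendsto_mult tendsto_const)
  moreover have "(exp (\<theta>\<^sub>1 * d) * C / d) * ((\<theta> * d) ^ 1 / exp (\<theta> * d)) = \<theta> * (exp (- (\<theta> - \<theta>\<^sub>1) * d) * C)" for \<theta>
  proof -
    have "exp (- (\<theta> - \<theta>\<^sub>1) * d) = exp (\<theta>\<^sub>1 * d) / exp (\<theta> * d)"
      by (simp add: exp_diff[symmetric] algebra_simps)
    then show ?thesis
      using d(1) by (simp add: field_simps)
  qed
  ultimately have E1: "((\<lambda>\<theta>. \<theta> * (exp (- (\<theta> - \<theta>\<^sub>1) * d) * C)) \<longlongrightarrow> 0) at_top"
    by (simp only: mult_zero_right)
  have "((\<lambda>\<theta>. e * (1 - exp (- \<theta> * d)) - \<theta> * (exp (- (\<theta> - \<theta>\<^sub>1) * d) * C)) \<longlongrightarrow> e * (1 - 0) - 0) at_top"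
    by (intro tendsto_intros E0 E1)
  moreover have "\<forall>\<^sub>F \<theta> in at_top. e * (1 - exp (- \<theta> * d)) - \<theta> * (exp (- (\<theta> - \<theta>\<^sub>1) * d) * C) \<le> \<theta> * laplace f \<theta>"
    using eventually_ge_at_top[of "max 1 \<theta>\<^sub>1"] by eventually_elim (rule le)
  ultimately have "e * (1 - 0) - 0 \<le> 0"
    by (rule tendsto_le[OF trivial_limit_at_top_linorder lim])
  then show False
    using e by simp
qed

section \<open>Functions with convex derivative as primitives\<close>

lemma convex_on_eq_on:
  assumes f: "convex_on S f" and eq: "\<And>x. x \<in> S \<Longrightarrow> f x = g x"
  shows "convex_on S g"
  unfolding convex_on_def
proof (intro conjI ballI allI impI)
  show S: "convex S"
    using f by (simp add: convex_on_def)
  fix x y u v assume *: "x \<in> S" "y \<in> S" "0 \<le> u" "0 \<le> v" "u + v = (1::real)"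
  then have "u *\<^sub>R x + v *\<^sub>R y \<in> S"
    using S by (simp add: convex_def)
  moreover have "f (u *\<^sub>R x + v *\<^sub>R y) \<le> u * f x + v * f y"
    using f * by (simp add: convex_on_def)
  ultimately show "g (u *\<^sub>R x + v *\<^sub>R y) \<le> u * g x + v * g y"
    using * eq by simp
qed

text \<open>The chord from \<open>x\<close> to \<open>R + 1\<close> lies above the graph at
  \<open>R\<close>, which bounds \<open>w x\<close> from below. As \<open>R\<close> and
  \<open>R + 1\<close> are at distance 1, the coefficient of \<open>w x\<close> is 1, and the bound
  is uniform in \<open>x\<close>.\<close>

lemma convex_on_bounded_below_near_0:
  fixes w :: "real \<Rightarrow> real"
  assumes w: "convex_on {0<..} w" and R: "R > 0"
  shows "\<exists>B\<ge>0. \<forall>x. 0 < x \<longrightarrow> x \<le> R \<longrightarrow> - B \<le> w x"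
proof -
  define B where "B = \<bar>w R\<bar> * (R + 1) + \<bar>w (R + 1)\<bar> * R"
  have "- B \<le> w x" if x: "0 < x" "x \<le> R" for x
  proof -
    have "convex_on {x..R + 1} w"
      using w x by (auto intro: convex_on_subset)
    from convex_onD_Icc'[OF this, of R] x
    have "w R \<le> (w (R + 1) - w x) / (R + 1 - x) * (R - x) + w x"
      by auto
    then have "w R * (R + 1 - x) \<le> w (R + 1) * (R - x) + w x"
      using x by (simp add: field_simps)
    moreover have "- (\<bar>w R\<bar> * (R + 1)) \<le> w R * (R + 1 - x)"
      using x R mult_mono[of "\<bar>w R\<bar>" "\<bar>w R\<bar>" "R + 1 - x" "R + 1"] abs_ge_minus_self[of "w R * (R + 1 - x)"]
      by (simp add: abs_mult)
    moreover have "w (R + 1) * (R - x) \<le> \<bar>w (R + 1)\<bar> * R"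
      using x R by (intro mult_mono) auto
    ultimately show ?thesis
      unfolding B_def by linarith
  qed
  moreover have "B \<ge> 0"
    using R by (simp add: B_def)
  ultimately show ?thesis by blast
qed

text \<open>A convex function can blow up at 0 only upwards. A linear correction therefore makes
  \<open>f\<close> nondecreasing on \<open>{0<..R}\<close>, the limit condition forces the value 0
  at 0+, and the fundamental theorem for nonnegative integrands yields integrability of
  \<open>w\<close> down to 0.\<close>

lemma primitive_of_convex_derivative:
  assumes f: "causal f" "exp_integrable \<theta>\<^sub>1 f"
    and lim: "((\<lambda>\<theta>. \<theta> * laplace f \<theta>) \<longlongrightarrow> 0) at_top"
    and D: "\<And>x. x > 0 \<Longrightarrow> (f has_real_derivative w x) (at x)" and w: "convex_on {0<..} w" "causal w"
  shows "loc_integrable w" "f = primitive w"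
proof -
  have wc: "isCont w x" if "x > 0" for x
    using convex_on_continuous[OF _ w(1)] that by (auto simp: continuous_on_eq_continuous_at)
  have main: "integrable lborel (\<lambda>x. indicator {0<..<R} x * w x) \<and> (\<integral>x. indicator {0<..<R} x * w x \<partial>lborel) = f R"
    if R: "R > 0" for R
  proof -
    obtain B where B: "B \<ge> 0" "\<And>x. 0 < x \<Longrightarrow> x \<le> R \<Longrightarrow> - B \<le> w x"
      using convex_on_bounded_below_near_0[OF w(1) R] by blast
    define V where "V x = f x + B * x" for x
    have VD: "(V has_real_derivative w x + B) (at x)" if "x > 0" for x
      unfolding V_def using D[OF that] by (auto intro!: derivative_eq_intros)
    have Vmono: "V x \<le> V y" if "0 < x" "x \<le> y" "y \<le> R" for x y
    proof (rule DERIV_nonneg_imp_nondecreasing[OF that(2)])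
      fix z assume "x \<le> z" "z \<le> y"
      then show "\<exists>y. (V has_real_derivative y) (at z) \<and> 0 \<le> y"
        using VD[of z] B(2)[of z] that by (intro exI[of _ "w z + B"]) auto
    qed
    \<comment> \<open>Were \<open>V x\<close> negative, monotonicity would keep \<open>- f\<close>
      above \<open>- V x > 0\<close> on all of \<open>{0<..x}\<close>.\<close>
    have Vpos: "0 \<le> V x" if x: "0 < x" "x \<le> R" for x
    proof -
      have "- V x \<le> 0"
      proof (rule initial_value_le_0[where f = "\<lambda>x. - 1 * f x"])
        show "causal (\<lambda>x. - 1 * f x)" "exp_integrable \<theta>\<^sub>1 (\<lambda>x. - 1 * f x)"
          using f(1) exp_integrable_cmult[OF f(2), of "-1"] by (auto simp: causal_def)
        show "((\<lambda>\<theta>. \<theta> * laplace (\<lambda>x. - 1 * f x) \<theta>) \<longlongrightarrow> 0) at_top"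
          unfolding laplace_cmult using tendsto_minus[OF lim] by simp
        fix y assume "0 < y" "y \<le> x"
        then show "- V x \<le> - 1 * f y"
          using Vmono[of y x] x B(1) mult_nonneg_nonneg[of B y] unfolding V_def by linarith
      qed (use x in auto)
      then show ?thesis by simp
    qed
    have V0: "(V \<longlongrightarrow> 0) (at_right 0)"
    proof (rule tendstoI)
      fix e :: real assume e: "e > 0"
      have "\<exists>x. 0 < x \<and> x \<le> R \<and> V x < e"
      proof (rule ccontr)
        assume "\<nexists>x. 0 < x \<and> x \<le> R \<and> V x < e"
        then have ge: "e \<le> V x" if "0 < x" "x \<le> R" for x
          using that not_less by blast
        have "e / 2 \<le> 0"
        proof (rule initial_value_le_0[OF f lim])
          \<comment> \<open>On this range \<open>B * x \<le> e / 2\<close>, so that half of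
            \<open>e\<close> is left for \<open>f\<close>; \<open>B + 1\<close> keeps the
            denominator positive.\<close>
          show "0 < min R (e / (2 * (B + 1)))"
            using R e B(1) by auto
          fix x assume x: "0 < x" "x \<le> min R (e / (2 * (B + 1)))"
          then have "x * (2 * (B + 1)) \<le> e"
            using B(1) by (simp add: pos_le_divide_eq)
          then have "B * x \<le> e / 2"
            using x(1) by (simp add: algebra_simps)
          then show "e / 2 \<le> f x"
            using ge[of x] x unfolding V_def by auto
        qed
        then show False using e by simp
      qed
      then obtain x where x: "0 < x" "x \<le> R" "V x < e" by blast
      have "\<bar>V y\<bar> < e" if "0 < y" "y < x" for y
        using Vmono[of y x] Vpos[of y] x that by auto
      then show "\<forall>\<^sub>F x in at_right 0. dist (V x) 0 < e"
        using x(1) by (auto simp: eventually_at_right_field dist_real_def)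
    qed
    have VR: "(V \<longlongrightarrow> V R) (at_left R)"
      using DERIV_isCont[OF VD[OF R]] by (auto simp: isCont_def intro: tendsto_within_subset)
    have FTC_prems: "ereal 0 < ereal R"
      "\<And>x. ereal 0 < ereal x \<Longrightarrow> ereal x < ereal R \<Longrightarrow> (V has_real_derivative w x + B) (at x)"
      "\<And>x. ereal 0 < ereal x \<Longrightarrow> ereal x < ereal R \<Longrightarrow> isCont (\<lambda>x. w x + B) x"
      "((V \<circ> real_of_ereal) \<longlongrightarrow> 0) (at_right (ereal 0))"
      "((V \<circ> real_of_ereal) \<longlongrightarrow> V R) (at_left (ereal R))"
      using R VD wc V0 VR unfolding ereal_tendsto_simps1 by (auto intro!: continuous_intros)
    have "0 \<le> w x + B" if "0 < x" "x < R" for x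
      using B(2)[of x] that by simp
    then have "AE x in lborel. ereal 0 < ereal x \<longrightarrow> ereal x < ereal R \<longrightarrow> 0 \<le> w x + B"
      by (intro AE_I2) simp
    note FTC = interval_integral_FTC_nonneg[OF FTC_prems(1-3) this FTC_prems(4,5)]
    have i: "integrable lborel (\<lambda>x. indicator {0<..<R} x * (w x + B))"
      "(\<integral>x. indicator {0<..<R} x * (w x + B) \<partial>lborel) = V R"
      using FTC R by (auto simp: set_integrable_def interval_lebesgue_integral_def set_lebesgue_integral_def)
    have j: "integrable lborel (\<lambda>x. indicator {0<..<R} x * B)"
      using R by (intro integrable_mult_left integrable_real_indicator) auto
    have eq: "(\<lambda>x. indicator {0<..<R} x * w x) = (\<lambda>x. indicator {0<..<R} x * (w x + B) - indicator {0<..<R} x * B)"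
      by (simp add: algebra_simps)
    show ?thesis
      unfolding eq using i j R by (simp add: V_def)
  qed
  show "loc_integrable w"
    unfolding loc_integrable_def
  proof
    fix R
    have "trunc R w x = indicator {..R} x *\<^sub>R (indicator {0<..<\<bar>R\<bar> + 1} x * w x)" for x
      using w(2) by (cases "x \<le> 0") (auto simp: trunc_def causal_def indicator_def)
    then have "trunc R w = (\<lambda>x. indicator {..R} x *\<^sub>R (indicator {0<..<\<bar>R\<bar> + 1} x * w x))"
      by blast
    then show "integrable lborel (trunc R w)"
      using integrable_mult_indicator[of "{..R}" lborel "\<lambda>x. indicator {0<..<\<bar>R\<bar> + 1} x * w x"] main[of "\<bar>R\<bar> + 1"] by simp
  qed
  show "f = primitive w"
  proof
    fix x
    have "indicator {..<x} t *\<^sub>R w t = indicator {0<..<x} t * w t" for t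
      using w(2) by (cases "t \<le> 0") (auto simp: causal_def indicator_def)
    then have "primitive w x = (\<integral>t. indicator {0<..<x} t * w t \<partial>lborel)"
      unfolding primitive_def set_lebesgue_integral_def by (simp only:)
    then show "f x = primitive w x"
      using main[of x] f(1) by (cases "x > 0") (auto simp: causal_def)
  qed
qed

text \<open>The identity linking the two scale functions is verified on transforms: it is
  \<open>1 / A + (A - B) / (A * B) = 1 / B\<close> for \<open>A = \<psi> \<theta> - p\<close> and
  \<open>B = \<psi> \<theta> - q\<close>. A convolution with a primitive is again a primitive, so
  \<open>Wq\<close> inherits a density although it occurs on both sides.\<close>

lemma (in levy_measure) scale_function_superlinear:
  assumes large: "\<not> integrable \<nu> (\<lambda>z. indicator {0<..1} z * z)"
    and Wp: "is_scale_function (laplace_exponent \<gamma> 0 \<nu>) p Wp" and conv: "has_convex_derivative_on Wp {0<..}"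
    and Wq: "is_scale_function (laplace_exponent \<gamma> 0 \<nu>) q Wq"
  obtains v where "causal v" "loc_integrable v" "causal_part Wq = primitive v"
proof -
  let ?\<psi> = "laplace_exponent \<gamma> 0 \<nu>"
  \<comment> \<open>Beyond \<open>\<theta>\<^sub>1\<close> both transforms are given by their
    formulas; beyond \<open>\<theta>\<^sub>2\<close>, chosen below, the exponent also exceeds
    \<open>p\<close> and \<open>q\<close>.\<close>
  define \<theta>\<^sub>1 where "\<theta>\<^sub>1 = max 1 (max (right_inverse_exponent ?\<psi> p) (right_inverse_exponent ?\<psi> q) + 1)"
  have t1: "\<theta> > 0" "\<theta> > right_inverse_exponent ?\<psi> p" "\<theta> > right_inverse_exponent ?\<psi> q" if "\<theta> \<ge> \<theta>\<^sub>1" for \<theta>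
    using that by (auto simp: \<theta>\<^sub>1_def)
  note sup = laplace_exponent_superlinear[OF large, of \<gamma>]
  have "\<forall>\<^sub>F \<theta> in at_top. \<bar>p\<bar> + \<bar>q\<bar> + 1 \<le> ?\<psi> \<theta> / \<theta>"
    using sup by (simp add: filterlim_at_top)
  then obtain N where N: "\<And>\<theta>. \<theta> \<ge> N \<Longrightarrow> \<bar>p\<bar> + \<bar>q\<bar> + 1 \<le> ?\<psi> \<theta> / \<theta>"
    by (auto simp: eventually_at_top_linorder)
  define \<theta>\<^sub>2 where "\<theta>\<^sub>2 = max N \<theta>\<^sub>1"
  have big: "?\<psi> \<theta> - p > 0" "?\<psi> \<theta> - q > 0" if "\<theta> \<ge> \<theta>\<^sub>2" for \<theta>
  proof -
    have t: "\<theta> \<ge> 1" using that by (simp add: \<theta>\<^sub>2_def \<theta>\<^sub>1_def)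
    have "(\<bar>p\<bar> + \<bar>q\<bar> + 1) * 1 \<le> (\<bar>p\<bar> + \<bar>q\<bar> + 1) * \<theta>"
      using t by (intro mult_left_mono) auto
    also have "\<dots> \<le> ?\<psi> \<theta>"
      using N[of \<theta>] that t by (simp add: \<theta>\<^sub>2_def pos_le_divide_eq)
    finally show "?\<psi> \<theta> - p > 0" "?\<psi> \<theta> - q > 0" by auto
  qed
  \<comment> \<open>The product is \<open>\<theta> / (\<psi> \<theta> - p)\<close>, which tends to 0
    by superlinear growth of the exponent. This encodes that the scale function starts at 0.\<close>
  have lim: "((\<lambda>\<theta>. \<theta> * laplace (causal_part Wp) \<theta>) \<longlongrightarrow> 0) at_top"
  proof -
    have "((\<lambda>\<theta>::real. p * inverse \<theta>) \<longlongrightarrow> p * 0) at_top"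
      by (intro tendsto_intros tendsto_inverse_0_at_top filterlim_ident)
    then have "filterlim (\<lambda>\<theta>. - (p * inverse \<theta>) + ?\<psi> \<theta> / \<theta>) at_top at_top"
      by (intro filterlim_tendsto_add_at_top[OF _ sup, of _ 0]) (auto intro: tendsto_eq_intros)
    then have "((\<lambda>\<theta>. inverse (- (p * inverse \<theta>) + ?\<psi> \<theta> / \<theta>)) \<longlongrightarrow> 0) at_top"
      by (rule tendsto_inverse_0_at_top)
    moreover have "\<forall>\<^sub>F \<theta> in at_top. inverse (- (p * inverse \<theta>) + ?\<psi> \<theta> / \<theta>) = \<theta> * laplace (causal_part Wp) \<theta>"
      using eventually_ge_at_top[of \<theta>\<^sub>2]
    proof eventually_elim
      case (elim \<theta>)
      then have "\<theta> \<ge> \<theta>\<^sub>1" by (simp add: \<theta>\<^sub>2_def)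
      note t = t1[OF this]
      have "- (p * inverse \<theta>) + ?\<psi> \<theta> / \<theta> = (?\<psi> \<theta> - p) / \<theta>"
        by (simp add: divide_inverse left_diff_distrib)
      then show ?case
        using scale_function_laplace(2)[OF Wp t(2)] by simp
    qed
    ultimately show ?thesis
      by (rule Lim_transform_eventually)
  qed
  define wp where "wp = causal_part (deriv Wp)"
  have wpc: "causal wp"
    unfolding wp_def by (rule causal_causal_part)
  have D: "(causal_part Wp has_real_derivative wp x) (at x)" if x: "x > 0" for x
  proof -
    have "(Wp has_real_derivative deriv Wp x) (at x)"
      using conv x by (auto simp: has_convex_derivative_on_def DERIV_deriv_iff_real_differentiable)
    moreover have "\<forall>\<^sub>F y in nhds x. causal_part Wp y = Wp y"
      using x unfolding eventually_nhds
      by (intro exI[of _ "{0<..}"]) (auto simp: causal_part_def heaviside_def)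
    ultimately show ?thesis
      using x by (subst DERIV_cong_ev[OF refl _ refl]) (auto simp: wp_def causal_part_def heaviside_def)
  qed
  have "convex_on {0<..} (deriv Wp)"
    using conv by (simp add: has_convex_derivative_on_def)
  then have "convex_on {0<..} wp"
    by (rule convex_on_eq_on) (auto simp: wp_def causal_part_def heaviside_def)
  note prim = primitive_of_convex_derivative[OF causal_causal_part
      scale_function_laplace(1)[OF Wp t1(2)[OF order_refl]] lim D this wpc]
  let ?Wq = "causal_part Wq"
  have Wqc: "causal ?Wq" "loc_integrable ?Wq"
    using causal_causal_part loc_integrable_causal_part[OF Wq] by auto
  \<comment> \<open>The derivative of the right-hand side of the identity, with the derivative
    placed on the factor \<open>Wp\<close>.\<close>
  define v where "v x = wp x + (q - p) * conv wp ?Wq x" for x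
  have v: "causal v" "loc_integrable v"
    using causal_conv[OF wpc Wqc(1)] wpc loc_integrable_conv[OF wpc prim(1) Wqc] prim(1)
    by (auto simp: v_def[abs_def] causal_def intro!: loc_integrable_add loc_integrable_cmult)
  have vprim: "primitive v x = primitive wp x + (q - p) * conv (primitive wp) ?Wq x" for x
    unfolding v_def[abs_def]
    using prim(1) loc_integrable_conv[OF wpc prim(1) Wqc] conv_primitive_loc[OF wpc prim(1) Wqc]
    by (simp add: primitive_add loc_integrable_cmult primitive_cmult)
  have "?Wq = primitive v"
  proof (rule scale_function_eqI[OF Wq causal_primitive[OF v(1)]])
    show "continuous_on {0<..} (primitive v)"
      using continuous_on_primitive_loc[OF v(2)] continuous_on_subset by blast
    fix \<theta> assume t: "\<theta> \<ge> \<theta>\<^sub>2"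
    then have "\<theta> \<ge> \<theta>\<^sub>1" by (simp add: \<theta>\<^sub>2_def)
    note t1 = t1[OF this]
    have Lp: "exp_integrable \<theta> (primitive wp)" "laplace (primitive wp) \<theta> = 1 / (?\<psi> \<theta> - p)"
      using scale_function_laplace[OF Wp t1(2)] prim(2) by simp_all
    note Lq = scale_function_laplace[OF Wq t1(3)]
    have i: "exp_integrable \<theta> (\<lambda>x. (q - p) * conv (primitive wp) ?Wq x)"
      using exp_integrable_conv[OF Lp(1) Lq(1)] by (rule exp_integrable_cmult)
    have "laplace (\<lambda>x. primitive wp x + (q - p) * conv (primitive wp) ?Wq x) \<theta> * (?\<psi> \<theta> - q) = 1"
    proof -
      have "(1 / A + (A - B) * (1 / A * (1 / B))) * B = 1" if "A > 0" "B > 0" for A B :: real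
        using that by (simp add: field_simps)
      from this[OF big[OF t]] show ?thesis
        unfolding laplace_add[OF Lp(1) i] laplace_cmult laplace_conv[OF Lp(1) Lq(1)] Lp(2) Lq(2)
        by simp
    qed
    moreover have "exp_integrable \<theta> (\<lambda>x. primitive wp x + (q - p) * conv (primitive wp) ?Wq x)"
      by (rule exp_integrable_add[OF Lp(1) i])
    ultimately show "exp_integrable \<theta> (primitive v) \<and> laplace (primitive v) \<theta> * (?\<psi> \<theta> - q) = 1"
      by (simp add: vprim[abs_def])
  qed
  then show thesis
    using that v by blast
qed

text \<open>Bernoulli's inequality for \<open>exp (- \<theta> * z)\<close>; it is a discrete form of
  convexity with value 0 at 0. The exponent is thus unbounded once it is positive somewhere.\<close>

lemma (in levy_measure) laplace_exponent_superhomogeneous: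
  assumes t: "\<theta> \<ge> 0"
  shows "real n * laplace_exponent \<gamma> \<sigma> \<nu> \<theta> \<le> laplace_exponent \<gamma> \<sigma> \<nu> (real n * \<theta>)"
proof -
  have "real n * jump_exponent \<theta> z \<le> jump_exponent (real n * \<theta>) z" for z
  proof -
    have "1 + real n * (exp (- \<theta> * z) - 1) \<le> (1 + (exp (- \<theta> * z) - 1)) ^ n"
      by (rule Bernoulli_inequality) simp
    also have "\<dots> = exp (- (real n * \<theta>) * z)"
      by (simp add: exp_of_nat_mult[symmetric] mult.assoc)
    finally show ?thesis
      by (auto simp: jump_exponent_def indicator_def algebra_simps)
  qed
  then have "(\<integral>z. real n * jump_exponent \<theta> z \<partial>\<nu>) \<le> (\<integral>z. jump_exponent (real n * \<theta>) z \<partial>\<nu>)"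
    using integrable_jump_exponent t by (intro integral_mono) auto
  moreover have "real n * (\<sigma>\<^sup>2 * \<theta>\<^sup>2 / 2) \<le> \<sigma>\<^sup>2 * (real n * \<theta>)\<^sup>2 / 2"
  proof -
    have "real n \<le> (real n)\<^sup>2"
      using self_le_power[of "real n" 2] by (cases n) auto
    then have "real n * (\<sigma>\<^sup>2 * \<theta>\<^sup>2 / 2) \<le> (real n)\<^sup>2 * (\<sigma>\<^sup>2 * \<theta>\<^sup>2 / 2)"
      by (intro mult_right_mono) auto
    then show ?thesis
      by (simp add: power_mult_distrib mult.left_commute)
  qed
  ultimately show ?thesis
    by (simp add: laplace_exponent_eq distrib_left mult.assoc mult.left_commute)
qed

text \<open>A vanishing scale function has transform 0, whereas the exponent exceeds
  \<open>q\<close> at large multiples of a point where it is positive.\<close>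

lemma (in spectrally_negative_levy_process) scale_function_nonzero:
  assumes W: "is_scale_function \<psi> q W"
  shows "\<exists>x. causal_part W x \<noteq> 0"
proof (rule ccontr)
  interpret levy_measure \<nu>
    using levy_measure by unfold_locales
  assume "\<nexists>x. causal_part W x \<noteq> 0"
  then have L0: "laplace (causal_part W) \<theta> = 0" for \<theta>
    by (simp add: laplace_def)
  obtain \<theta> where t: "\<theta> > 0" "\<psi> \<theta> > 0"
    using laplace_exponent_above_drift[of 0] by auto
  obtain n\<^sub>1 :: nat where n1: "right_inverse_exponent \<psi> q < real n\<^sub>1 * \<theta>"
    using reals_Archimedean3[OF t(1)] by blast
  obtain n\<^sub>2 :: nat where n2: "q < real n\<^sub>2 * \<psi> \<theta>"
    using reals_Archimedean3[OF t(2)] by blast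
  define n where "n = max n\<^sub>1 n\<^sub>2"
  have le: "real n\<^sub>1 * \<theta> \<le> real n * \<theta>" "real n\<^sub>2 * \<psi> \<theta> \<le> real n * \<psi> \<theta>"
    using t by (auto simp: n_def intro!: mult_right_mono)
  have "real n * \<psi> \<theta> \<le> \<psi> (real n * \<theta>)"
    using t by (intro laplace_exponent_superhomogeneous) simp
  \<comment> \<open>The strict bound on \<open>q\<close> matters: since \<open>1 / 0 = 0\<close>, a
    point with \<open>\<psi> = q\<close> would be consistent with a vanishing transform.\<close>
  with le n1 n2 have "right_inverse_exponent \<psi> q < real n * \<theta>" "q < \<psi> (real n * \<theta>)"
    by linarith+
  then show False
    using scale_function_laplace(2)[OF W, of "real n * \<theta>"] L0 by simp
qed

section \<open>Smoothness of the omega-scale function\<close>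

lemma abs_continuous_fun_on_imp_isCont:
  assumes f: "abs_continuous_fun_on S f" and S: "open S" and x: "x \<in> S"
  shows "isCont f x"
proof -
  obtain r where r: "r > 0" "ball x r \<subseteq> S"
    using S x by (auto simp: open_contains_ball)
  show ?thesis
    unfolding continuous_at_eps_delta
  proof (intro allI impI)
    fix e :: real assume "e > 0"
    from f[unfolded abs_continuous_fun_on_def, rule_format, OF this] obtain d
      where d: "d > 0" "\<forall>(n::nat) u v.
        (\<forall>i<n. u i \<in> S \<and> v i \<in> S \<and> u i \<le> v i) \<and>
        (\<forall>i<n. \<forall>j<n. i \<noteq> j \<longrightarrow> {u i<..<v i} \<inter> {u j<..<v j} = {}) \<and>
        (\<Sum>i<n. v i - u i) < d \<longrightarrow> (\<Sum>i<n. \<bar>f (v i) - f (u i)\<bar>) < e"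
      by (elim exE conjE)
    have two: "\<bar>f v - f u\<bar> < e" if "u \<in> S" "v \<in> S" "u \<le> v" "v - u < d" for u v
      using d(2)[THEN spec, THEN spec, THEN spec, of 1 "\<lambda>_. u" "\<lambda>_. v"] that by simp
    have "\<bar>f y - f x\<bar> < e" if y: "\<bar>y - x\<bar> < min r d" for y
    proof -
      have "y \<in> S"
        using r y by (auto simp: dist_real_def)
      then show ?thesis
        using two[of x y] two[of y x] x y by (cases "x \<le> y") (auto simp: abs_minus_commute)
    qed
    then show "\<exists>d>0. \<forall>y. dist y x < d \<longrightarrow> dist (f y) (f x) < e"
      using r d by (intro exI[of _ "min r d"]) (auto simp: dist_real_def)
  qed
qed

locale omega_scale_function =
  fixes \<psi> W \<omega> H :: "real \<Rightarrow> real" and \<phi> :: real and n :: nat and a :: "nat \<Rightarrow> real"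
  assumes omega: "discounting_intensity \<omega> \<phi> n a"
    and H: "is_omega_scale_function \<psi> W \<omega> \<phi> (a 1) H"
    and W: "is_scale_function \<psi> \<phi> W"
    and nonzero: "\<exists>x. causal_part W x \<noteq> 0"
begin

abbreviation "\<Phi> \<equiv> right_inverse_exponent \<psi> \<phi>"

abbreviation "partition_points \<equiv> a ` {1..n + 1}"

text \<open>With this function the integral equation for \<open>H\<close> becomes a convolution over
  the whole line.\<close>

definition source :: "real \<Rightarrow> real" where
  "source y = indicator {a 1..} y * ((\<omega> y - \<phi>) * H y)"

lemma source_eq_0: "y < a 1 \<Longrightarrow> source y = 0"
  by (simp add: source_def)

lemma abs_omega_le: "\<bar>\<omega> y - \<phi>\<bar> \<le> \<phi>"
proof -
  have *: "antimono \<omega>" "\<forall>x<a 1. \<omega> x = \<phi>" "0 \<le> \<omega> y"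
    using omega unfolding discounting_intensity_def by blast+
  have "\<omega> y \<le> \<omega> (min y (a 1 - 1))"
    using *(1) by (rule antimonoD) simp
  then have "\<omega> y \<le> \<phi>"
    using *(2) by simp
  with *(3) show ?thesis by simp
qed

lemma source_bounded: "\<exists>B. \<forall>y\<le>R. \<bar>source y\<bar> \<le> B"
proof -
  have "bounded (H ` {a 1..R})"
    using H compact_Icc unfolding is_omega_scale_function_def by blast
  then obtain B where "\<forall>z\<in>H ` {a 1..R}. norm z \<le> B"
    unfolding bounded_iff by blast
  then have B: "\<bar>H y\<bar> \<le> B" if "y \<in> {a 1..R}" for y
    using that by auto
  have phi: "\<phi> > 0"
    using omega by (simp add: discounting_intensity_def)
  have "\<bar>source y\<bar> \<le> \<phi> * \<bar>B\<bar>" if "y \<le> R" for y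
  proof (cases "a 1 \<le> y")
    case True
    then have "\<bar>\<omega> y - \<phi>\<bar> * \<bar>H y\<bar> \<le> \<phi> * \<bar>B\<bar>"
      using B[of y] that phi by (intro mult_mono abs_omega_le) auto
    then show ?thesis
      using True by (simp add: source_def abs_mult)
  qed (use phi in \<open>simp add: source_def\<close>)
  then show ?thesis by blast
qed

lemma borel_measurable_W[measurable]: "causal_part W \<in> borel_measurable borel"
  using borel_measurable_exp_integrable scale_function_laplace(1)[OF W, of "\<Phi> + 1"] by simp

text \<open>The hypotheses only make \<open>W (x - y) * source y\<close> measurable in \<open>y\<close>. Dividing by \<open>W (x - y)\<close>
  for rational \<open>x\<close> recovers \<open>source\<close>, because \<open>W\<close> has no zeros on some open interval.\<close>

lemma borel_measurable_source[measurable]: "source \<in> borel_measurable borel"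
proof -
  obtain x\<^sub>0 where x0: "causal_part W x\<^sub>0 \<noteq> 0"
    using nonzero by blast
  then have pos: "x\<^sub>0 > 0"
    by (auto simp: causal_part_def heaviside_def indicator_def split: if_splits)
  have "isCont (causal_part W) x\<^sub>0"
    using continuous_on_causal_part[OF W] pos by (simp add: continuous_on_eq_continuous_at)
  then have "\<forall>\<^sub>F x in at x\<^sub>0. causal_part W x \<noteq> 0"
    using x0 by (intro tendsto_imp_eventually_ne) (auto simp: isCont_def)
  then have "\<forall>\<^sub>F x in nhds x\<^sub>0. causal_part W x \<noteq> 0"
    using x0 by (simp add: eventually_nhds_conv_at)
  then obtain d where d: "d > 0" "\<And>x. dist x x\<^sub>0 < d \<Longrightarrow> causal_part W x \<noteq> 0"
    by (auto simp: eventually_nhds_metric)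
  define F where "F q y = indicator {a 1..q} y *\<^sub>R (W (q - y) * (\<omega> y - \<phi>) * H y)" for q y
  have [measurable]: "F q \<in> borel_measurable borel" for q
  proof -
    have "set_integrable lborel {a 1..q} (\<lambda>y. W (q - y) * (\<omega> y - \<phi>) * H y)"
      using H unfolding is_omega_scale_function_def by blast
    then show ?thesis
      using borel_measurable_integrable by (fastforce simp: set_integrable_def F_def[abs_def])
  qed
  define S where "S q = {y. causal_part W (q - y) \<noteq> 0}" for q
  have S: "S q \<in> sets borel" for q
  proof -
    have "S q = (\<lambda>y. causal_part W (q - y)) -` (- {0}) \<inter> space borel"
      by (auto simp: S_def)
    also have "\<dots> \<in> sets borel"
      by (rule measurable_sets[of _ borel borel]) measurable
    finally show ?thesis .
  qed
  have eq: "source y = F q y / causal_part W (q - y)" if "y \<in> S q" for q y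
  proof -
    have "q - y > 0" "W (q - y) \<noteq> 0"
      using that by (auto simp: S_def causal_part_def heaviside_def indicator_def split: if_splits)
    then show ?thesis
      by (auto simp: F_def source_def causal_part_def heaviside_def indicator_def)
  qed
  \<comment> \<open>It suffices that \<open>of_rat q - y\<close> falls within \<open>d\<close> of
    \<open>x\<^sub>0\<close>, where the scale function has no zero.\<close>
  have cover: "\<exists>q::rat. y \<in> S (of_rat q)" for y
  proof -
    obtain q :: rat where "y + x\<^sub>0 - d < of_rat q" "of_rat q < y + x\<^sub>0 + d"
      using of_rat_dense[of "y + x\<^sub>0 - d" "y + x\<^sub>0 + d"] d(1) by auto
    then show ?thesis
      unfolding S_def using d(2)[of "of_rat q - y"] by (auto simp: dist_real_def abs_less_iff)
  qed
  show ?thesis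
  proof (rule measurableI)
    fix A :: "real set" assume A: "A \<in> sets borel"
    have "source -` A \<inter> space borel =
        (\<Union>q::rat. S (of_rat q) \<inter> ((\<lambda>y. F (of_rat q) y / causal_part W (of_rat q - y)) -` A \<inter> space borel))"
      (is "?L = ?R")
    proof (rule set_eqI)
      fix y
      obtain q where "y \<in> S (of_rat q)"
        using cover by blast
      then show "y \<in> ?L \<longleftrightarrow> y \<in> ?R"
        using eq by fastforce
    qed
    also have "\<dots> \<in> sets borel"
    proof (intro sets.countable_UN'' sets.Int[OF S])
      fix q :: rat
      have "(\<lambda>y. F (of_rat q) y / causal_part W (of_rat q - y)) \<in> borel_measurable borel"
        by measurable
      then show "(\<lambda>y. F (of_rat q) y / causal_part W (of_rat q - y)) -` A \<inter> space borel \<in> sets borel"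
        using A by (rule measurable_sets)
    qed auto
    finally show "source -` A \<inter> space borel \<in> sets borel" .
  qed simp
qed

lemma H_eq: "H x = exp (\<Phi> * (x - a 1)) + conv (causal_part W) source x"
proof -
  have si: "set_integrable lborel {a 1..x} (\<lambda>y. W (x - y) * (\<omega> y - \<phi>) * H y)"
    and Hx: "H x = exp (\<Phi> * (x - a 1)) + (LBINT y:{a 1..x}. W (x - y) * (\<omega> y - \<phi>) * H y)"
    using H unfolding is_omega_scale_function_def by blast+
  have "(LBINT y:{a 1..x}. W (x - y) * (\<omega> y - \<phi>) * H y) = conv (causal_part W) source x"
    unfolding set_lebesgue_integral_def conv_def
  proof (rule integral_cong_AE)
    show "(\<lambda>y. indicator {a 1..x} y *\<^sub>R (W (x - y) * (\<omega> y - \<phi>) * H y)) \<in> borel_measurable lborel"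
      using si by (auto simp: set_integrable_def dest: borel_measurable_integrable)
    \<comment> \<open>The integrands can differ only at \<open>y = x\<close>, where the unspecified
      value \<open>W 0\<close> enters.\<close>
    show "AE y in lborel. indicator {a 1..x} y *\<^sub>R (W (x - y) * (\<omega> y - \<phi>) * H y) = causal_part W (x - y) * source y"
      by (rule AE_lborelI_except[of x]) (auto simp: causal_part_def heaviside_def source_def indicator_def)
  qed measurable
  with Hx show ?thesis by simp
qed

lemma H_fun: "H = (\<lambda>x. exp (\<Phi> * (x - a 1)) + conv (causal_part W) source x)"
  by (rule ext) (rule H_eq)

lemma kernel_convolution_source:
  "causal v \<Longrightarrow> loc_integrable v \<Longrightarrow> kernel_convolution v source (a 1)"
  by (intro kernel_convolution.intro borel_measurable_source source_eq_0 source_bounded)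

text \<open>First step of a bootstrap: \<open>source\<close> is so far only measurable and locally
  bounded, but convolution with the scale function makes \<open>H\<close> continuous, and then
  \<open>source\<close> is continuous off the partition points.\<close>

lemma isCont_H: "isCont H x"
proof -
  interpret kernel_convolution "causal_part W" source "a 1"
    by (rule kernel_convolution_source[OF causal_causal_part loc_integrable_causal_part[OF W]])
  have "isCont (\<lambda>x. exp (\<Phi> * (x - a 1)) + conv (causal_part W) source x) x"
    by (intro continuous_intros isCont_conv)
  then show ?thesis
    unfolding H_fun[symmetric] .
qed

lemma isCont_omega:
  assumes x: "x \<notin> partition_points" "a 1 < x"
  shows "isCont \<omega> x"
proof (cases "x > 0")
  case True
  obtain \<rho> where "\<forall>x\<ge>0. \<omega> x = \<rho>"
    using omega unfolding discounting_intensity_def by blast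
  then have "\<forall>\<^sub>F y in nhds x. \<omega> y = \<rho>"
    using True unfolding eventually_nhds by (intro exI[of _ "{0<..}"]) auto
  then show ?thesis
    using isCont_cong[of \<omega> "\<lambda>_. \<rho>" x] by simp
next
  case False
  have a0: "a (n + 1) = 0" and ac: "\<And>k. k \<in> {1..n} \<Longrightarrow> abs_continuous_fun_on {a k<..<a (k + 1)} \<omega>"
    using omega unfolding discounting_intensity_def by blast+
  \<comment> \<open>Lying in none of the sub-intervals, \<open>x\<close> would pass all partition
    points one after the other, up to \<open>a (n + 1) = 0\<close>.\<close>
  have "\<exists>k\<in>{1..n}. a k < x \<and> x < a (k + 1)"
  proof (rule ccontr)
    assume none: "\<not> (\<exists>k\<in>{1..n}. a k < x \<and> x < a (k + 1))"
    have "k \<le> n \<Longrightarrow> a (k + 1) < x" for k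
    proof (induction k)
      case 0
      then show ?case using x(2) by simp
    next
      case (Suc k)
      then have k: "Suc k \<in> {1..n}" "a (Suc k) < x"
        by auto
      then have "\<not> x < a (Suc k + 1)"
        using none by blast
      moreover have "x \<noteq> a (Suc k + 1)"
        using x(1) Suc.prems by (auto simp del: add_Suc)
      ultimately show ?case
        by linarith
    qed
    from this[of n] show False
      using a0 False by simp
  qed
  then obtain k where "k \<in> {1..n}" "a k < x" "x < a (k + 1)"
    by blast
  then show ?thesis
    by (intro abs_continuous_fun_on_imp_isCont[OF ac]) auto
qed

lemma isCont_source:
  assumes x: "x \<notin> partition_points"
  shows "isCont source x"
proof (cases "x < a 1")
  case True
  then have "\<forall>\<^sub>F y in nhds x. source y = 0"
    unfolding eventually_nhds by (intro exI[of _ "{..<a 1}"]) (auto simp: source_eq_0)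
  then show ?thesis
    using isCont_cong[of source "\<lambda>_. 0" x] by simp
next
  case False
  have "a 1 \<in> partition_points" by auto
  with False x have gt: "a 1 < x"
    by (metis linorder_neqE_linordered_idom)
  then have "\<forall>\<^sub>F y in nhds x. source y = (\<omega> y - \<phi>) * H y"
    unfolding eventually_nhds by (intro exI[of _ "{a 1<..}"]) (auto simp: source_def)
  moreover have "isCont (\<lambda>y. (\<omega> y - \<phi>) * H y) x"
    by (intro continuous_intros isCont_H isCont_omega x gt)
  ultimately show ?thesis
    using isCont_cong by fast
qed

context
  fixes v :: "real \<Rightarrow> real" and c :: real
  assumes v: "causal v" "loc_integrable v"
    and Wv: "\<And>x. x > 0 \<Longrightarrow> causal_part W x = c + primitive v x"
begin

interpretation kernel_convolution v source "a 1"
  by (rule kernel_convolution_source[OF v])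

text \<open>\<open>c\<close> is the value of the scale function at 0+. If it is 0, jumps of \<omega>
  are smoothed out in the derivative of \<open>H\<close>, and no partition point has to be
  excluded.\<close>

lemma H_has_real_derivative:
  assumes "c = 0 \<or> x \<notin> partition_points"
  shows "(H has_real_derivative \<Phi> * exp (\<Phi> * (x - a 1)) + (c * source x + conv v source x)) (at x)"
proof -
  have "c = 0 \<or> isCont source x"
    using assms isCont_source by blast
  then have "((\<lambda>x. exp (\<Phi> * (x - a 1)) + conv (causal_part W) source x) has_real_derivative
      \<Phi> * exp (\<Phi> * (x - a 1)) + (c * source x + conv v source x)) (at x)"
    by (intro DERIV_add conv_has_real_derivative causal_causal_part Wv) (auto intro!: derivative_eq_intros)
  then show ?thesis
    unfolding H_fun[symmetric] .
qed

lemma H_C1_differentiable_on: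
  assumes "c = 0 \<or> S \<inter> partition_points = {}"
  shows "H C1_differentiable_on S"
  unfolding C1_differentiable_on_def
proof (intro exI conjI ballI)
  show "(H has_vector_derivative \<Phi> * exp (\<Phi> * (x - a 1)) + (c * source x + conv v source x)) (at x)"
    if "x \<in> S" for x
    using H_has_real_derivative[of x] assms that
    by (auto simp: has_real_derivative_iff_has_vector_derivative)
  show "continuous_on S (\<lambda>x. \<Phi> * exp (\<Phi> * (x - a 1)) + (c * source x + conv v source x))"
  proof (intro continuous_at_imp_continuous_on ballI)
    fix x assume "x \<in> S"
    then have "c = 0 \<or> isCont source x"
      using assms isCont_source by blast
    then have "isCont (\<lambda>x. c * source x) x"
      by auto
    moreover have "isCont (\<lambda>x. \<Phi> * exp (\<Phi> * (x - a 1))) x"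
      by (intro continuous_intros)
    ultimately show "isCont (\<lambda>x. \<Phi> * exp (\<Phi> * (x - a 1)) + (c * source x + conv v source x)) x"
      using isCont_conv by (intro continuous_add)
  qed
qed

end

text \<open>As the scale function starts at 0, the first derivative contains only a convolution, now
  with kernel \<open>w\<close>. Differentiating it again brings in \<open>source\<close> through the
  jump \<open>c\<close> of \<open>w\<close>, hence the excluded points.\<close>

lemma H_C2_differentiable_on:
  assumes w: "causal w" "loc_integrable w" "causal_part W = primitive w"
    and u: "causal u" "loc_integrable u" "\<And>x. x > 0 \<Longrightarrow> w x = c + primitive u x"
    and S: "S \<inter> partition_points = {}"
  shows "H C2_differentiable_on S"
  unfolding C2_differentiable_on_def
proof (intro exI conjI ballI)
  interpret kernel_convolution u source "a 1"
    by (rule kernel_convolution_source[OF u(1,2)])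
  show "(H has_real_derivative \<Phi> * exp (\<Phi> * (x - a 1)) + conv w source x) (at x)" for x
    using H_has_real_derivative[OF w(1,2), of 0 x] w(3) by simp
  show "(\<lambda>x. \<Phi> * exp (\<Phi> * (x - a 1)) + conv w source x) C1_differentiable_on S"
    unfolding C1_differentiable_on_def
  proof (intro exI conjI ballI)
    fix x assume "x \<in> S"
    then have "isCont source x"
      using S isCont_source by blast
    then have "(conv w source has_real_derivative c * source x + conv u source x) (at x)"
      by (intro conv_has_real_derivative w u) auto
    then have "((\<lambda>x. \<Phi> * exp (\<Phi> * (x - a 1)) + conv w source x) has_real_derivative
        \<Phi> * (\<Phi> * exp (\<Phi> * (x - a 1))) + (c * source x + conv u source x)) (at x)"
      by (intro DERIV_add) (auto intro!: derivative_eq_intros)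
    then show "((\<lambda>x. \<Phi> * exp (\<Phi> * (x - a 1)) + conv w source x) has_vector_derivative
        \<Phi> * (\<Phi> * exp (\<Phi> * (x - a 1))) + (c * source x + conv u source x)) (at x)"
      by (simp add: has_real_derivative_iff_has_vector_derivative)
  next
    show "continuous_on S (\<lambda>x. \<Phi> * (\<Phi> * exp (\<Phi> * (x - a 1))) + (c * source x + conv u source x))"
      using S isCont_source
      by (intro continuous_at_imp_continuous_on ballI continuous_intros isCont_conv) blast
  qed
qed

end

theorem theorem2p1:
  fixes M :: "'a measure" and X :: "real \<Rightarrow> 'a \<Rightarrow> real"
    and \<gamma> \<sigma> :: real and \<nu> :: "real measure" and \<psi> :: "real \<Rightarrow> real"
    and W :: "real \<Rightarrow> real \<Rightarrow> real" and p :: real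
    and \<omega> :: "real \<Rightarrow> real" and \<phi> :: real and n :: nat and a :: "nat \<Rightarrow> real"
    and H :: "real \<Rightarrow> real"
  assumes X: "spectrally_negative_levy_process M X \<gamma> \<sigma> \<nu>"
    and psi: "\<psi> = laplace_exponent \<gamma> \<sigma> \<nu>"
    and nu_ac: "bounded_variation_paths M X \<longrightarrow> absolutely_continuous lborel \<nu>"
    and W: "\<And>q. q \<ge> 0 \<Longrightarrow> is_scale_function \<psi> q (W q)"
    and p: "p \<ge> 0"
    and omega: "discounting_intensity \<omega> \<phi> n a"
    and H: "is_omega_scale_function \<psi> (W \<phi>) \<omega> \<phi> (a 1) H"
  shows
    "(\<sigma>\<^sup>2 > 0 \<longrightarrow> H C1_differentiable_on UNIV) \<and>
     (\<sigma>\<^sup>2 = 0 \<and> \<not> bounded_variation_paths M X \<and> has_convex_derivative_on (W p) {0<..} \<longrightarrow>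
        H C1_differentiable_on UNIV) \<and>
     (\<sigma>\<^sup>2 = 0 \<and> bounded_variation_paths M X \<and> emeasure \<nu> {0<..} = \<infinity> \<and>
        has_convex_derivative_on (W p) {0<..} \<longrightarrow>
        H C1_differentiable_on (UNIV - a ` {1..n + 1})) \<and>
     (\<sigma>\<^sup>2 = 0 \<and> emeasure \<nu> {0<..} < \<infinity> \<longrightarrow>
        H C1_differentiable_on (UNIV - a ` {1..n + 1})) \<and>
     (\<sigma> > 0 \<and> has_convex_derivative_on (W p) {0<..} \<longrightarrow>
        H C2_differentiable_on (UNIV - a ` {1..n + 1}))"
proof -
  interpret X: spectrally_negative_levy_process M X \<gamma> \<sigma> \<nu>
    by (rule X)
  interpret levy_measure \<nu>
    using X.levy_measure by unfold_locales
  have phi: "\<phi> \<ge> 0"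
    using omega by (simp add: discounting_intensity_def)
  note Wphi = W[OF phi, unfolded psi] and Wp = W[OF p, unfolded psi]
  interpret omega_scale_function \<psi> "W \<phi>" \<omega> H \<phi> n a
    using omega H W[OF phi] X.scale_function_nonzero[OF Wphi] by unfold_locales
  show ?thesis
  proof (cases "\<sigma> = 0")
    case False
    obtain u w c where u: "causal u" "loc_integrable u" and w: "causal w" "loc_integrable w"
      and wu: "\<And>x. x > 0 \<Longrightarrow> w x = c + primitive u x" and Ww: "causal_part (W \<phi>) = primitive w"
      using scale_function_gaussian[OF False Wphi] by metis
    have "H C1_differentiable_on UNIV"
      using H_C1_differentiable_on[OF w, of 0] Ww by simp
    moreover have "H C2_differentiable_on (UNIV - a ` {1..n + 1})"
      by (rule H_C2_differentiable_on[OF w Ww u wu]) auto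
    ultimately show ?thesis
      using False by simp
  next
    case s: True
    show ?thesis
    proof (cases "integrable \<nu> (\<lambda>z. indicator {0<..1} z * z)")
      case small: True
      define d where "d = \<gamma> + (\<integral>z. indicator {0<..1} z * z \<partial>\<nu>)"
      have le: "laplace_exponent \<gamma> \<sigma> \<nu> \<theta> \<le> d * \<theta>" if "\<theta> > 0" for \<theta>
        using laplace_exponent_drift[OF small that, of \<gamma>] that
          mult_nonneg_nonneg[OF less_imp_le[OF that] laplace_tail_nonneg[of \<theta>]]
        by (simp add: s d_def algebra_simps)
      have BV: "bounded_variation_paths M X"
        using le by (rule X.bounded_variation_pathsI)
      have "d > 0"
      proof (rule ccontr)
        assume "\<not> d > 0"
        then obtain \<theta> where "\<theta> > 0" "laplace_exponent \<gamma> \<sigma> \<nu> \<theta> > d * \<theta>"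
          using X.laplace_exponent_above_drift[of d] by auto
        then show False
          using le[of \<theta>] by simp
      qed
      then have "\<gamma> + (\<integral>z. indicator {0<..1} z * z \<partial>\<nu>) \<noteq> 0"
        by (simp add: d_def)
      then obtain v c where "causal v" "loc_integrable v" "\<And>x. x > 0 \<Longrightarrow> causal_part (W \<phi>) x = c + primitive v x"
        using scale_function_drift[OF small _ Wphi[unfolded s]] by metis
      then have "H C1_differentiable_on (UNIV - a ` {1..n + 1})"
        by (rule H_C1_differentiable_on) auto
      then show ?thesis
        using BV s by simp
    next
      case large: False
      have "emeasure \<nu> {0<..} = \<infinity>"
      proof (rule ccontr)
        assume "emeasure \<nu> {0<..} \<noteq> \<infinity>"
        then have "integrable \<nu> (indicator {0<..} :: real \<Rightarrow> real)"
          by (intro integrable_real_indicator) (auto simp: sets_nu top.not_eq_extremum)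
        then have "integrable \<nu> (\<lambda>z. indicator {0<..1} z * z)"
          by (rule Bochner_Integration.integrable_bound) (auto simp: indicator_def)
        then show False
          using large by simp
      qed
      \<comment> \<open>\<open>S\<close> is kept arbitrary: the whole line serves for (2), the
        complement of the partition points for (3).\<close>
      moreover have "H C1_differentiable_on S" if cvx: "has_convex_derivative_on (W p) {0<..}" for S
      proof -
        obtain v where "causal v" "loc_integrable v" "causal_part (W \<phi>) = primitive v"
          using scale_function_superlinear[OF large Wp[unfolded s] cvx Wphi[unfolded s]] by metis
        then show ?thesis
          using H_C1_differentiable_on[of v 0 S] by simp
      qed
      ultimately show ?thesis
        using s by simp
    qed
  qed
qed

end
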